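(* Let $\kappa:[0,1]\times[-\pi,\pi]\to\mathbb C$ be measurable and let $\{A_n\}_n$ be a matrix-sequence. If $\{A_n\}_n\sim_{\rm GLT}\kappa$ and the matrices $A_n$ are normal, then $\{f(A_n)\}_n\sim_{\rm GLT}f(\kappa)$ for every continuous function $f:\mathbb C\to\mathbb C$.
   Context: A matrix-sequence is a sequence $\{A_n\}_n$ with $A_n\in\mathbb C^{n\times n}$ for every $n$. All measure-theoretic notions refer to Lebesgue measure; $\|\cdot\|$ is the spectral norm. $f(\kappa)$ denotes the composite function $f\circ\kappa$. Matrix functions: if $A$ is a diagonalizable matrix with $A=X\,\mathrm{diag}(\lambda_1,\ldots,\lambda_n)X^{-1}$, then $f(A)=X\,\mathrm{diag}(f(\lambda_1),\ldots,f(\lambda_n))X^{-1}$, i.e. $f(A)$ is the unique matrix such that $f(A)\mathbf u=f(\lambda)\mathbf u$ whenever $A\mathbf u=\lambda\mathbf u$. Approximating class of sequences (a.c.s.): given a matrix-sequence $\{A_n\}_n$ and matrix-sequences $\{B_{n,m}\}_n$ ($m\in\mathbb N$), we write $\{B_{n,m}\}_n\xrightarrow{\rm a.c.s.}\{A_n\}_n$ if for every $m$ there exists $n_m$ such that, for $n\ge n_m$, $A_n=B_{n,m}+R_{n,m}+N_{n,m}$ with $\mathrm{rank}(R_{n,m})\le c(m)n$ and $\|N_{n,m}\|\le\omega(m)$, where $n_m,c(m),\omega(m)$ depend only on $m$ and $\lim_{m\to\infty}c(m)=\lim_{m\to\infty}\omega(m)=0$. Diagonal sampling and Toeplitz matrices: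 for $a:[0,1]\to\mathbb C$, $D_n(a)=\mathrm{diag}_{i=1,\ldots,n}a(i/n)$. For $g\in L^1([-\pi,\pi])$, $T_n(g)=[g_{i-j}]_{i,j=1}^n$ with $g_k=\frac1{2\pi}\int_{-\pi}^\pi g(\theta)e^{-\mathrm i k\theta}d\theta$. GLT sequences: for a matrix-sequence $\{A_n\}_n$ and a measurable $\kappa:[0,1]\times[-\pi,\pi]\to\mathbb C$, $\{A_n\}_n$ is a GLT sequence with symbol $\kappa$, written $\{A_n\}_n\sim_{\rm GLT}\kappa$, if there exist functions $a_{i,m},f_{i,m}$, $i=1,\ldots,N_m$, with $a_{i,m}:[0,1]\to\mathbb C$ continuous a.e. and $f_{i,m}\in L^1([-\pi,\pi])$, such that $\sum_{i=1}^{N_m}a_{i,m}(x)f_{i,m}(\theta)\to\kappa(x,\theta)$ in measure over $[0,1]\times[-\pi,\pi]$ as $m\to\infty$, and $\{\sum_{i=1}^{N_m}D_n(a_{i,m})T_n(f_{i,m})\}_n\xrightarrow{\rm a.c.s.}\{A_n\}_n$. *)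

theory Defs
  imports
    "HOL-Analysis.Analysis"
    "Jordan_Normal_Form.DL_Rank"
    "Jordan_Normal_Form.Schur_Decomposition"
begin

unbundle no vec_syntax
unbundle no inner_syntax

text \<open>
  Matrices are those of Jordan-Normal-Form, whose rows and columns are indexed from 0; formulas
  over indices 1,...,n are therefore shifted by one.  The term for n = 0 of a matrix-sequence is
  the unique empty matrix and carries no information.
\<close>

definition matrix_seq :: "(nat \<Rightarrow> complex mat) \<Rightarrow> bool" where
  "matrix_seq A \<longleftrightarrow> (\<forall>n. A n \<in> carrier_mat n n)"

definition normal_mat :: "complex mat \<Rightarrow> bool" where
  "normal_mat A \<longleftrightarrow> square_mat A \<and> A * mat_adjoint A = mat_adjoint A * A"

definition cvec_norm :: "complex vec \<Rightarrow> real" where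
  "cvec_norm v = L2_set (\<lambda>i. cmod (v $ i)) {..<dim_vec v}"

text \<open>The supremum is over the unit ball rather than the unit sphere, so that it is over a nonempty
  set also in dimension 0.\<close>

definition spectral_norm :: "complex mat \<Rightarrow> real" where
  "spectral_norm A = (SUP v\<in>{v \<in> carrier_vec (dim_col A). cvec_norm v \<le> 1}. cvec_norm (A *\<^sub>v v))"

text \<open>\<open>mat_fun f A\<close> is only meaningful for diagonalizable \<open>A\<close>, in which case the matrix \<open>B\<close> does
  not depend on the choice of the diagonalization \<open>A = X * diag l * Y\<close> with \<open>Y\<close> the inverse of \<open>X\<close>.\<close>

definition mat_fun :: "(complex \<Rightarrow> complex) \<Rightarrow> complex mat \<Rightarrow> complex mat" where
  "mat_fun f A = (THE B. \<exists>X Y l. similar_mat_wit A (mat_diag (dim_row A) l) X Y \<and>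
      B = X * mat_diag (dim_row A) (\<lambda>i. f (l i)) * Y)"

text \<open>\<open>B m\<close> is the sequence whose \<open>n\<close>-th matrix is written B with indices (n,m) on paper.\<close>

definition acs :: "(nat \<Rightarrow> nat \<Rightarrow> complex mat) \<Rightarrow> (nat \<Rightarrow> complex mat) \<Rightarrow> bool" where
  "acs B A \<longleftrightarrow> matrix_seq A \<and> (\<forall>m. matrix_seq (B m)) \<and>
     (\<exists>(n\<^sub>0 :: nat \<Rightarrow> nat) (c :: nat \<Rightarrow> real) (\<omega> :: nat \<Rightarrow> real).
        c \<longlonglongrightarrow> 0 \<and> \<omega> \<longlonglongrightarrow> 0 \<and>
        (\<forall>m. \<forall>n\<ge>n\<^sub>0 m. \<exists>R\<in>carrier_mat n n. \<exists>N\<in>carrier_mat n n.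
           A n = B m n + R + N \<and>
           real (vec_space.rank n R) \<le> c m * real n \<and>
           spectral_norm N \<le> \<omega> m))"

definition diag_sampling :: "nat \<Rightarrow> (real \<Rightarrow> complex) \<Rightarrow> complex mat" where
  "diag_sampling n a = mat_diag n (\<lambda>i. a (real (i + 1) / real n))"

definition fourier_coeff :: "(real \<Rightarrow> complex) \<Rightarrow> int \<Rightarrow> complex" where
  "fourier_coeff g k = 1 / (2 * pi) *
     (\<integral>\<theta>. g \<theta> * exp (- \<i> * of_int k * of_real \<theta>) \<partial>lebesgue_on {-pi..pi})"

definition toeplitz :: "nat \<Rightarrow> (real \<Rightarrow> complex) \<Rightarrow> complex mat" where
  "toeplitz n g = Matrix.mat n n (\<lambda>(i, j). fourier_coeff g (int i - int j))"

text \<open>Measurability is part of the notion (a nonmeasurable set would have \<open>emeasure\<close> 0).  In the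
  definition of \<open>glt\<close> below it holds automatically, since a.e. continuous functions are Lebesgue
  measurable.\<close>

definition tendsto_in_measure ::
    "'a measure \<Rightarrow> (nat \<Rightarrow> 'a \<Rightarrow> complex) \<Rightarrow> ('a \<Rightarrow> complex) \<Rightarrow> bool" where
  "tendsto_in_measure M F g \<longleftrightarrow>
     (\<forall>m. F m \<in> borel_measurable M) \<and> g \<in> borel_measurable M \<and>
     (\<forall>\<epsilon>>0. (\<lambda>m. emeasure M {z \<in> space M. cmod (F m z - g z) > \<epsilon>}) \<longlonglongrightarrow> 0)"

definition continuous_ae_01 :: "(real \<Rightarrow> complex) \<Rightarrow> bool" where
  "continuous_ae_01 a \<longleftrightarrow>
     (AE x in lebesgue_on {0..1}. continuous (at x within {0..1}) a)"

abbreviation glt_measure :: "(real \<times> real) measure" where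
  "glt_measure \<equiv> lebesgue_on ({0..1} \<times> {-pi..pi})"

definition DT_sum ::
    "nat \<Rightarrow> (nat \<Rightarrow> real \<Rightarrow> complex) \<Rightarrow> (nat \<Rightarrow> real \<Rightarrow> complex) \<Rightarrow> nat \<Rightarrow> complex mat" where
  "DT_sum K a g n =
     Matrix.mat n n (\<lambda>(r, s). \<Sum>i = 1..K. (diag_sampling n (a i) * toeplitz n (g i)) $$ (r, s))"

text \<open>\<open>a m i\<close> and \<open>g m i\<close> are the i-th functions of the m-th approximation.\<close>

definition glt :: "(nat \<Rightarrow> complex mat) \<Rightarrow> (real \<times> real \<Rightarrow> complex) \<Rightarrow> bool"
    (infix \<open>\<sim>\<^sub>G\<^sub>L\<^sub>T\<close> 50) where
  "A \<sim>\<^sub>G\<^sub>L\<^sub>T \<kappa> \<longleftrightarrow> matrix_seq A \<and> \<kappa> \<in> borel_measurable glt_measure \<and>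
     (\<exists>(K :: nat \<Rightarrow> nat) (a :: nat \<Rightarrow> nat \<Rightarrow> real \<Rightarrow> complex) (g :: nat \<Rightarrow> nat \<Rightarrow> real \<Rightarrow> complex).
        (\<forall>m. \<forall>i\<in>{1..K m}. continuous_ae_01 (a m i) \<and> integrable (lebesgue_on {-pi..pi}) (g m i)) \<and>
        tendsto_in_measure glt_measure (\<lambda>m (x, \<theta>). \<Sum>i = 1..K m. a m i x * g m i \<theta>) \<kappa> \<and>
        acs (\<lambda>m. DT_sum (K m) (a m) (g m)) A)"

end

theory Submission
  imports Defs "Jordan_Normal_Form.Spectral_Radius"
begin

text \<open>
  A pair of a matrix-sequence and a symbol is small if the matrices are of the form low rank plus
  small norm and the symbol is small off a set of small measure.  The GLT pairs are the limits, for
  this notion of smallness, of the pairs formed by sums of \<open>D\<^sub>n(b) T\<^sub>n(exp(\<i>k\<theta>))\<close> with continuous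
  \<open>b\<close> and their symbols.  Such sums have bounded norm and multiply like their symbols up to small
  errors, so the limits form a *-algebra.  Hence the claim holds for polynomials in \<open>z\<close> and its
  conjugate.  For continuous \<open>f\<close>, approximate by Stone--Weierstrass on a ball of radius \<open>M\<close>: by
  normality all but a small fraction of the eigenvalues of \<open>A\<^sub>n\<close> lie in the ball, so the error of the
  polynomial approximation is again low rank plus small norm.
\<close>

section \<open>Operator bounds and low-rank factorizations\<close>

text \<open>The approximating sums need not be normal, so comparing \<open>f\<close> of A_n with
  \<open>f\<close> of its approximations is not an option. Functions are applied only to A_n itself:
  in a unitary eigenbasis A_n and its adjoint are diagonal together, so a polynomial in
  \<open>z\<close> and its conjugate can be evaluated on the eigenvalues or by the algebra
  operations, with the same result. The sequences may be unbounded, which threatens both the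
  products and the uniform approximation of \<open>f\<close>. One remedy serves both: for each
  \<epsilon> a single bound \<open>M\<close> holds for matrices and symbol up to a fraction
  \<epsilon>. To use it on the spectrum, "low rank plus norm at most M" is turned into a count of
  eigenvalues by comparing dimensions. The generators need care of their own. For D_n(a) with
  \<open>a\<close> continuous only a.e., a null set can contain every sampling point, so the
  exceptional sets are made compact. For T_n(g) with \<open>g\<close> only integrable, the trace is
  decisive: a small integral bounds the sum of the eigenvalues for each nonnegative part of
  \<open>g\<close>, and hence the number of large ones.\<close>

lemma mat_adjoint_carrier [simp]:
  fixes A :: "complex mat"
  shows "A \<in> carrier_mat n m \<Longrightarrow> mat_adjoint A \<in> carrier_mat m n"
  by (auto simp: mat_adjoint_def)

lemma mat_adjoint_index [simp]:
  assumes "A \<in> carrier_mat n m" "i < m" "j < n"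
  shows "mat_adjoint A $$ (i, j) = cnj (A $$ (j, i))"
  using assms by (auto simp: mat_adjoint_def mat_of_rows_def)

lemma index_mult_mat_sum:
  assumes "A \<in> carrier_mat n m" "B \<in> carrier_mat m k" "i < n" "j < k"
  shows "(A * B) $$ (i, j) = (\<Sum>l<m. A $$ (i, l) * B $$ (l, j))"
  using assms by (auto simp: scalar_prod_def atLeast0LessThan intro!: sum.cong)

lemma index_mult_mat_vec_sum:
  assumes "A \<in> carrier_mat n m" "v \<in> carrier_vec m" "i < n"
  shows "(A *\<^sub>v v) $ i = (\<Sum>l<m. A $$ (i, l) * v $ l)"
  using assms by (auto simp: scalar_prod_def atLeast0LessThan intro!: sum.cong)

lemma mat_adjoint_mult:
  fixes A B :: "complex mat"
  assumes "A \<in> carrier_mat n n" "B \<in> carrier_mat n n"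
  shows "mat_adjoint (A * B) = mat_adjoint B * mat_adjoint A"
proof (rule eq_matI)
  have AB: "A * B \<in> carrier_mat n n" using assms by simp
  fix i j assume "i < dim_row (mat_adjoint B * mat_adjoint A)" "j < dim_col (mat_adjoint B * mat_adjoint A)"
  then have ij: "i < n" "j < n" using assms by (auto simp: mat_adjoint_def)
  show "mat_adjoint (A * B) $$ (i, j) = (mat_adjoint B * mat_adjoint A) $$ (i, j)"
    using assms ij
    by (simp add: mat_adjoint_index[OF AB] mat_adjoint_index[of _ n n] index_mult_mat_sum[of _ n n _ n]
      mult.commute del: index_mult_mat)
qed (use assms in \<open>auto simp: mat_adjoint_def\<close>)

lemma mat_adjoint_add:
  fixes A B :: "complex mat"
  assumes "A \<in> carrier_mat n m" "B \<in> carrier_mat n m"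
  shows "mat_adjoint (A + B) = mat_adjoint A + mat_adjoint B"
  using assms by (intro eq_matI) (auto simp: mat_adjoint_def mat_of_rows_def)

lemma mat_adjoint_minus:
  fixes A B :: "complex mat"
  assumes "A \<in> carrier_mat n m" "B \<in> carrier_mat n m"
  shows "mat_adjoint (A - B) = mat_adjoint A - mat_adjoint B"
  using assms by (intro eq_matI) (auto simp: mat_adjoint_def mat_of_rows_def)

lemma mat_adjoint_adjoint:
  fixes A :: "complex mat"
  assumes "A \<in> carrier_mat n m"
  shows "mat_adjoint (mat_adjoint A) = A"
  using assms by (intro eq_matI) (auto simp: mat_adjoint_def mat_of_rows_def)

section \<open>Euclidean norm and operator bounds\<close>

lemma cvec_norm_nonneg [simp]: "0 \<le> cvec_norm v"
  by (simp add: cvec_norm_def)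

lemma cvec_norm_carrier:
  "v \<in> carrier_vec n \<Longrightarrow> cvec_norm v = L2_set (\<lambda>i. cmod (v $ i)) {..<n}"
  by (auto simp: cvec_norm_def)

lemma cvec_norm_add:
  assumes "v \<in> carrier_vec n" "w \<in> carrier_vec n"
  shows "cvec_norm (v + w) \<le> cvec_norm v + cvec_norm w"
proof -
  have "cvec_norm (v + w) \<le> L2_set (\<lambda>i. cmod (v $ i) + cmod (w $ i)) {..<n}"
    using assms by (auto simp: cvec_norm_carrier[of _ n] intro!: L2_set_mono norm_triangle_ineq)
  also have "\<dots> \<le> cvec_norm v + cvec_norm w"
    using assms by (simp add: cvec_norm_carrier[of _ n] L2_set_triangle_ineq)
  finally show ?thesis .
qed

lemma cvec_norm_smult: "cvec_norm (c \<cdot>\<^sub>v v) = cmod c * cvec_norm v"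
  by (auto simp: cvec_norm_def norm_mult L2_set_right_distrib intro!: L2_set_cong)

lemma cvec_norm_square:
  assumes "v \<in> carrier_vec n"
  shows "complex_of_real ((cvec_norm v)\<^sup>2) = (\<Sum>i<n. v $ i * cnj (v $ i))"
proof -
  have "(cvec_norm v)\<^sup>2 = (\<Sum>i<n. (cmod (v $ i))\<^sup>2)"
    by (simp add: cvec_norm_carrier[OF assms] L2_set_def sum_nonneg)
  then show ?thesis
    by (simp flip: complex_norm_square)
qed

text \<open>Nonnegativity of \<beta> is stated separately because in dimension 0 the vector
  inequality holds for every real \<beta>; it is what allows bounds to be multiplied.\<close>

definition op_bound :: "nat \<Rightarrow> real \<Rightarrow> complex mat \<Rightarrow> bool" where
  "op_bound n \<beta> X \<longleftrightarrow> X \<in> carrier_mat n n \<and> 0 \<le> \<beta> \<and>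
     (\<forall>v\<in>carrier_vec n. cvec_norm (X *\<^sub>v v) \<le> \<beta> * cvec_norm v)"

lemma op_boundD:
  assumes "op_bound n \<beta> X"
  shows "X \<in> carrier_mat n n" "0 \<le> \<beta>" "v \<in> carrier_vec n \<Longrightarrow> cvec_norm (X *\<^sub>v v) \<le> \<beta> * cvec_norm v"
  using assms by (auto simp: op_bound_def)

lemma op_bound_mono: "op_bound n \<beta> X \<Longrightarrow> \<beta> \<le> \<gamma> \<Longrightarrow> op_bound n \<gamma> X"
  unfolding op_bound_def by (meson cvec_norm_nonneg mult_right_mono order_trans)

lemma op_bound_add:
  assumes "op_bound n \<beta> X" "op_bound n \<gamma> Y"
  shows "op_bound n (\<beta> + \<gamma>) (X + Y)"
  unfolding op_bound_def
proof (intro conjI ballI)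
  note X = op_boundD[OF assms(1)] and Y = op_boundD[OF assms(2)]
  show "X + Y \<in> carrier_mat n n" "0 \<le> \<beta> + \<gamma>" using X Y by auto
  fix v :: "complex vec" assume v: "v \<in> carrier_vec n"
  have "cvec_norm ((X + Y) *\<^sub>v v) \<le> cvec_norm (X *\<^sub>v v) + cvec_norm (Y *\<^sub>v v)"
    using X(1) Y(1) v by (simp add: add_mult_distrib_mat_vec[of _ n n] cvec_norm_add[of _ n])
  also have "\<dots> \<le> (\<beta> + \<gamma>) * cvec_norm v"
    using X(3)[OF v] Y(3)[OF v] by (simp add: distrib_right)
  finally show "cvec_norm ((X + Y) *\<^sub>v v) \<le> (\<beta> + \<gamma>) * cvec_norm v" .
qed

lemma op_bound_mult:
  assumes "op_bound n \<beta> X" "op_bound n \<gamma> Y"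
  shows "op_bound n (\<beta> * \<gamma>) (X * Y)"
  unfolding op_bound_def
proof (intro conjI ballI)
  note X = op_boundD[OF assms(1)] and Y = op_boundD[OF assms(2)]
  show "X * Y \<in> carrier_mat n n" "0 \<le> \<beta> * \<gamma>" using X Y by auto
  fix v :: "complex vec" assume v: "v \<in> carrier_vec n"
  have "cvec_norm ((X * Y) *\<^sub>v v) = cvec_norm (X *\<^sub>v (Y *\<^sub>v v))"
    using X(1) Y(1) v by (simp add: assoc_mult_mat_vec[of _ n n _ n])
  also have "\<dots> \<le> \<beta> * cvec_norm (Y *\<^sub>v v)"
    by (rule X) (use Y v in auto)
  also have "\<dots> \<le> \<beta> * \<gamma> * cvec_norm v"
    using mult_left_mono[OF Y(3)[OF v] X(2)] by simp
  finally show "cvec_norm ((X * Y) *\<^sub>v v) \<le> \<beta> * \<gamma> * cvec_norm v" .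
qed

lemma cvec_norm_zero [simp]: "cvec_norm (0\<^sub>v n) = 0"
  by (simp add: cvec_norm_carrier[of _ n] L2_set_eq_0_iff)

lemma op_bound_zero: "op_bound n 0 (0\<^sub>m n n)"
proof -
  have "0\<^sub>m n n *\<^sub>v v = 0\<^sub>v n" if "v \<in> carrier_vec n" for v :: "complex vec"
    using that by (intro eq_vecI) auto
  then show ?thesis by (auto simp: op_bound_def)
qed

text \<open>This is |Xv|^2 = <v, X'Xv> with X' the adjoint, the link between adjoint and norm.
  Applied to X' it bounds the adjoint; applied to an isometry it gives preservation of
  norms.\<close>

lemma cvec_norm_adjoint_square:
  assumes "X \<in> carrier_mat n n" "v \<in> carrier_vec n"
  shows "complex_of_real ((cvec_norm (X *\<^sub>v v))\<^sup>2) = (\<Sum>i<n. v $ i * cnj ((mat_adjoint X *\<^sub>v (X *\<^sub>v v)) $ i))"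
proof -
  define w where "w = X *\<^sub>v v"
  have w: "w \<in> carrier_vec n" using assms by (auto simp: w_def)
  have "complex_of_real ((cvec_norm (X *\<^sub>v v))\<^sup>2) = (\<Sum>i<n. w $ i * cnj (w $ i))"
    using cvec_norm_square[OF w] by (simp add: w_def)
  also have "\<dots> = (\<Sum>i<n. (\<Sum>l<n. X $$ (i, l) * v $ l) * cnj (w $ i))"
    using assms by (intro sum.cong refl) (simp only: w_def index_mult_mat_vec_sum[of _ n n] lessThan_iff)
  also have "\<dots> = (\<Sum>i<n. \<Sum>l<n. v $ l * cnj (cnj (X $$ (i, l)) * w $ i))"
    by (intro sum.cong refl) (simp add: sum_distrib_right sum_distrib_left mult_ac)
  also have "\<dots> = (\<Sum>l<n. \<Sum>i<n. v $ l * cnj (cnj (X $$ (i, l)) * w $ i))"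
    by (rule sum.swap)
  also have "\<dots> = (\<Sum>l<n. v $ l * cnj ((mat_adjoint X *\<^sub>v w) $ l))"
    using assms w by (intro sum.cong refl)
      (simp add: index_mult_mat_vec_sum[of "mat_adjoint X" n n] sum_distrib_left del: index_mult_mat_vec)
  finally show ?thesis by (simp add: w_def)
qed

text \<open>With \<open>w\<close> the image of \<open>v\<close> under the adjoint, |w|^2 = <v, Xw>
  is at most |v| \<beta> |w| by Cauchy-Schwarz; dividing by |w| leaves the claim.\<close>

lemma op_bound_adjoint:
  assumes "op_bound n \<beta> X"
  shows "op_bound n \<beta> (mat_adjoint X)"
  unfolding op_bound_def
proof (intro conjI ballI)
  note X = op_boundD[OF assms]
  show "mat_adjoint X \<in> carrier_mat n n" "0 \<le> \<beta>" using X by auto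
  fix v :: "complex vec" assume v: "v \<in> carrier_vec n"
  define w where "w = mat_adjoint X *\<^sub>v v"
  have w: "w \<in> carrier_vec n"
    unfolding w_def by (intro mult_mat_vec_carrier[of _ n n] mat_adjoint_carrier X v)
  define u where "u = X *\<^sub>v w"
  have u: "u \<in> carrier_vec n" using X w by (auto simp: u_def)
  have "complex_of_real ((cvec_norm w)\<^sup>2) = (\<Sum>i<n. v $ i * cnj (u $ i))"
    using cvec_norm_adjoint_square[of "mat_adjoint X" n v] X v
    by (simp add: mat_adjoint_adjoint[of _ n n] w_def u_def)
  then have "(cvec_norm w)\<^sup>2 = cmod (\<Sum>i<n. v $ i * cnj (u $ i))"
    by (metis norm_of_real abs_of_nonneg zero_le_power2)
  also have "\<dots> \<le> (\<Sum>i<n. \<bar>cmod (v $ i)\<bar> * \<bar>cmod (u $ i)\<bar>)"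
    by (rule order_trans[OF norm_sum]) (simp add: norm_mult)
  also have "\<dots> \<le> cvec_norm v * cvec_norm u"
    using L2_set_mult_ineq[of "\<lambda>i. cmod (v $ i)" "\<lambda>i. cmod (u $ i)" "{..<n}"] v u
    by (simp add: cvec_norm_carrier[of _ n])
  also have "\<dots> \<le> cvec_norm v * (\<beta> * cvec_norm w)"
    using X(3)[OF w] by (intro mult_left_mono) (auto simp: u_def)
  finally have *: "cvec_norm w * cvec_norm w \<le> (\<beta> * cvec_norm v) * cvec_norm w"
    by (simp add: power2_eq_square mult_ac)
  show "cvec_norm (mat_adjoint X *\<^sub>v v) \<le> \<beta> * cvec_norm v"
  proof (cases "cvec_norm w = 0")
    case True then show ?thesis using X by (simp flip: w_def)
  next
    case False
    then have "0 < cvec_norm w" by (simp add: order_less_le)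
    then show ?thesis using * by (simp flip: w_def)
  qed
qed

lemma op_bound_isometry:
  assumes "U \<in> carrier_mat n n" "mat_adjoint U * U = 1\<^sub>m n"
  shows "op_bound n 1 U"
  unfolding op_bound_def
proof (intro conjI ballI)
  fix v :: "complex vec" assume v: "v \<in> carrier_vec n"
  have "mat_adjoint U *\<^sub>v (U *\<^sub>v v) = v"
    using assms v by (metis assoc_mult_mat_vec mat_adjoint_carrier one_mult_mat_vec)
  then have "complex_of_real ((cvec_norm (U *\<^sub>v v))\<^sup>2) = complex_of_real ((cvec_norm v)\<^sup>2)"
    unfolding cvec_norm_adjoint_square[OF assms(1) v] cvec_norm_square[OF v] by simp
  then have "(cvec_norm (U *\<^sub>v v))\<^sup>2 = (cvec_norm v)\<^sup>2" by (simp only: of_real_eq_iff)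
  then show "cvec_norm (U *\<^sub>v v) \<le> 1 * cvec_norm v" by simp
qed (use assms in auto)

text \<open>All nonzero entries lie on one diagonal, so each row and each column has at most one:
  \<open>X\<close> moves coordinates injectively and scales them by at most \<beta>.\<close>

lemma op_bound_partial_perm:
  assumes X: "X \<in> carrier_mat n n" and "0 \<le> \<beta>"
    and entry: "\<And>i j. i < n \<Longrightarrow> j < n \<Longrightarrow> cmod (X $$ (i, j)) \<le> \<beta>"
    and supp: "\<And>i j. i < n \<Longrightarrow> j < n \<Longrightarrow> int i - int j \<noteq> k \<Longrightarrow> X $$ (i, j) = 0"
  shows "op_bound n \<beta> X"
  unfolding op_bound_def
proof (intro conjI ballI)
  fix v :: "complex vec" assume v: "v \<in> carrier_vec n"
  \<comment> \<open>\<open>g i\<close> is the column of the only possible entry of row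
    \<open>i\<close>. The truncation by \<open>nat\<close> is harmless because \<open>I\<close>
    keeps only the rows for which that column exists.\<close>
  define g where "g = (\<lambda>i. nat (int i - k))"
  define I where "I = {i\<in>{..<n}. 0 \<le> int i - k \<and> int i - k < int n}"
  have Xv: "cmod ((X *\<^sub>v v) $ i) \<le> (if i \<in> I then \<beta> * cmod (v $ g i) else 0)" if "i < n" for i
  proof -
    have "(X *\<^sub>v v) $ i = (\<Sum>l<n. if int l = int i - k then X $$ (i, l) * v $ l else 0)"
      unfolding index_mult_mat_vec_sum[OF X v that] using supp[OF that] by (intro sum.cong) auto
    also have "\<dots> = (if i \<in> I then X $$ (i, g i) * v $ g i else 0)"
    proof (cases "i \<in> I")
      case True
      then have "int l = int i - k \<longleftrightarrow> l = g i" for l by (auto simp: g_def I_def)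
      moreover have "g i < n" using True by (auto simp: g_def I_def)
      ultimately show ?thesis using True by simp
    next
      case False
      then have "\<forall>l<n. int l \<noteq> int i - k" using that by (auto simp: I_def)
      then show ?thesis using False by (auto intro!: sum.neutral)
    qed
    also have "cmod \<dots> \<le> (if i \<in> I then \<beta> * cmod (v $ g i) else 0)"
      using entry[OF that, of "g i"] by (auto simp: norm_mult g_def I_def intro!: mult_right_mono)
    finally show ?thesis .
  qed
  have "(cvec_norm (X *\<^sub>v v))\<^sup>2 = (\<Sum>i<n. (cmod ((X *\<^sub>v v) $ i))\<^sup>2)"
    using X v by (simp add: cvec_norm_carrier[of _ n] L2_set_def sum_nonneg del: index_mult_mat_vec)
  also have "\<dots> \<le> (\<Sum>i<n. (if i \<in> I then \<beta> * cmod (v $ g i) else 0)\<^sup>2)"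
    using Xv by (intro sum_mono power_mono) auto
  also have "\<dots> = (\<Sum>i\<in>I. (\<beta> * cmod (v $ g i))\<^sup>2)"
    by (intro sum.mono_neutral_cong_right) (auto simp: I_def)
  also have "\<dots> = (\<Sum>j\<in>g ` I. (\<beta> * cmod (v $ j))\<^sup>2)"
    by (subst sum.reindex) (auto simp: inj_on_def g_def I_def)
  also have "\<dots> \<le> (\<Sum>j<n. (\<beta> * cmod (v $ j))\<^sup>2)"
    by (intro sum_mono2) (auto simp: g_def I_def)
  also have "\<dots> = (\<beta> * cvec_norm v)\<^sup>2"
    using v by (simp add: cvec_norm_carrier[of _ n] L2_set_def sum_nonneg power_mult_distrib sum_distrib_left)
  finally show "cvec_norm (X *\<^sub>v v) \<le> \<beta> * cvec_norm v"
    by (rule power2_le_imp_le) (simp add: \<open>0 \<le> \<beta>\<close>)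
qed (simp_all add: X \<open>0 \<le> \<beta>\<close>)

text \<open>The crude bound by the sum of all entries is enough: it makes the supremum in
  \<open>spectral_norm\<close> one over a bounded set and settles the vectors of norm 0.\<close>

lemma op_bound_exists:
  assumes A: "A \<in> carrier_mat n n"
  shows "\<exists>\<beta>. op_bound n \<beta> A"
proof
  define \<beta> where "\<beta> = (\<Sum>i<n. \<Sum>j<n. cmod (A $$ (i, j)))"
  show "op_bound n \<beta> A"
    unfolding op_bound_def
  proof (intro conjI ballI)
    show "0 \<le> \<beta>" by (simp add: \<beta>_def sum_nonneg)
    fix v :: "complex vec" assume v: "v \<in> carrier_vec n"
    have "cvec_norm (A *\<^sub>v v) \<le> (\<Sum>i<n. cmod ((A *\<^sub>v v) $ i))"
      using A v L2_set_le_sum_abs[of "\<lambda>i. cmod ((A *\<^sub>v v) $ i)" "{..<n}"]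
      by (simp add: cvec_norm_carrier[of _ n] del: index_mult_mat_vec)
    also have "\<dots> \<le> (\<Sum>i<n. \<Sum>j<n. cmod (A $$ (i, j)) * cvec_norm v)"
    proof (intro sum_mono)
      fix i assume "i \<in> {..<n}"
      then have "cmod ((A *\<^sub>v v) $ i) \<le> (\<Sum>j<n. cmod (A $$ (i, j)) * cmod (v $ j))"
        using A v by (simp add: index_mult_mat_vec_sum[of _ n n] norm_mult[symmetric] norm_sum del: index_mult_mat_vec)
      also have "\<dots> \<le> (\<Sum>j<n. cmod (A $$ (i, j)) * cvec_norm v)"
        using member_le_L2_set[of "{..<n}" _ "\<lambda>i. cmod (v $ i)"] v
        by (intro sum_mono mult_left_mono) (auto simp: cvec_norm_carrier[of _ n])
      finally show "cmod ((A *\<^sub>v v) $ i) \<le> (\<Sum>j<n. cmod (A $$ (i, j)) * cvec_norm v)" .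
    qed
    also have "\<dots> = \<beta> * cvec_norm v"
      by (simp add: \<beta>_def sum_distrib_right)
    finally show "cvec_norm (A *\<^sub>v v) \<le> \<beta> * cvec_norm v" .
  qed (use A in auto)
qed

lemma spectral_norm_le:
  assumes "op_bound n \<beta> A"
  shows "spectral_norm A \<le> \<beta>"
  unfolding spectral_norm_def
proof (rule cSUP_least)
  note A = op_boundD[OF assms]
  have d: "dim_col A = n" using A by auto
  have "0\<^sub>v n \<in> {v \<in> carrier_vec (dim_col A). cvec_norm v \<le> 1}" by (simp add: d)
  then show "{v \<in> carrier_vec (dim_col A). cvec_norm v \<le> 1} \<noteq> {}" by blast
  fix v assume "v \<in> {v \<in> carrier_vec (dim_col A). cvec_norm v \<le> 1}"
  then have v: "v \<in> carrier_vec n" "cvec_norm v \<le> 1" by (auto simp: d)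
  have "cvec_norm (A *\<^sub>v v) \<le> \<beta> * cvec_norm v" by (rule A) fact
  also have "\<dots> \<le> \<beta>" using A(2) v by (simp add: mult_left_le)
  finally show "cvec_norm (A *\<^sub>v v) \<le> \<beta>" .
qed

text \<open>A real supremum is informative only over a bounded set, hence the auxiliary \<beta>; the
  estimate on the unit ball extends to all vectors by scaling.\<close>

lemma op_bound_spectral_norm:
  assumes A: "A \<in> carrier_mat n n"
  shows "op_bound n (spectral_norm A) A"
proof -
  obtain \<beta> where \<beta>: "op_bound n \<beta> A" using op_bound_exists[OF A] by blast
  have d: "dim_col A = n" using A by auto
  have bdd: "bdd_above ((\<lambda>v. cvec_norm (A *\<^sub>v v)) ` {v \<in> carrier_vec (dim_col A). cvec_norm v \<le> 1})"
  proof (rule bdd_aboveI2)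
    fix v assume "v \<in> {v \<in> carrier_vec (dim_col A). cvec_norm v \<le> 1}"
    then have v: "v \<in> carrier_vec n" "cvec_norm v \<le> 1" by (auto simp: d)
    have "cvec_norm (A *\<^sub>v v) \<le> \<beta> * cvec_norm v" by (rule op_boundD[OF \<beta>]) fact
    also have "\<dots> \<le> \<beta>" using op_boundD(2)[OF \<beta>] v by (simp add: mult_left_le)
    finally show "cvec_norm (A *\<^sub>v v) \<le> \<beta>" .
  qed
  have le: "cvec_norm (A *\<^sub>v v) \<le> spectral_norm A" if "v \<in> carrier_vec n" "cvec_norm v \<le> 1" for v
    unfolding spectral_norm_def by (rule cSUP_upper[OF _ bdd]) (use that d in auto)
  show ?thesis
    unfolding op_bound_def
  proof (intro conjI ballI)
    show "0 \<le> spectral_norm A" using le[of "0\<^sub>v n"] by (simp add: order_trans[OF cvec_norm_nonneg])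
    fix v :: "complex vec" assume v: "v \<in> carrier_vec n"
    show "cvec_norm (A *\<^sub>v v) \<le> spectral_norm A * cvec_norm v"
    proof (cases "cvec_norm v = 0")
      case True then show ?thesis using op_boundD(3)[OF \<beta> v] by simp
    next
      case False
      let ?u = "complex_of_real (1 / cvec_norm v) \<cdot>\<^sub>v v"
      have "cvec_norm (A *\<^sub>v ?u) \<le> spectral_norm A"
        by (rule le) (use v False in \<open>auto simp: cvec_norm_smult norm_divide\<close>)
      moreover have "A *\<^sub>v ?u = complex_of_real (1 / cvec_norm v) \<cdot>\<^sub>v (A *\<^sub>v v)"
        using A v by (simp add: mult_mat_vec[of _ n n])
      ultimately have "cvec_norm (A *\<^sub>v v) / cvec_norm v \<le> spectral_norm A"
        by (simp add: cvec_norm_smult norm_divide)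
      then show ?thesis using False by (simp add: divide_le_eq order_less_le)
    qed
  qed (use A in auto)
qed

section \<open>Low rank, and low rank plus bounded norm\<close>

text \<open>A factorization of length \<open>k\<close> witnesses rank at most \<open>k\<close>; unlike the rank itself it is
  visibly stable under sums, products and adjoints.\<close>

definition lowrank :: "nat \<Rightarrow> real \<Rightarrow> complex mat \<Rightarrow> bool" where
  "lowrank n r X \<longleftrightarrow> X \<in> carrier_mat n n \<and> (\<exists>(k::nat) (p::nat \<Rightarrow> nat \<Rightarrow> complex) (q::nat \<Rightarrow> nat \<Rightarrow> complex).
     real k \<le> r \<and> (\<forall>i<n. \<forall>j<n. X $$ (i, j) = (\<Sum>t<k. p t i * q t j)))"

lemma lowrank_carrier: "lowrank n r X \<Longrightarrow> X \<in> carrier_mat n n"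
  by (simp add: lowrank_def)

lemma lowrank_mono: "lowrank n r X \<Longrightarrow> r \<le> s \<Longrightarrow> lowrank n s X"
  unfolding lowrank_def by (meson order_trans)

lemma lowrank_zero: "0 \<le> r \<Longrightarrow> lowrank n r (0\<^sub>m n n)"
  unfolding lowrank_def by (intro conjI exI[of _ "0::nat"]) auto

lemma lowrank_add:
  assumes "lowrank n r X" "lowrank n s Y"
  shows "lowrank n (r + s) (X + Y)"
proof -
  obtain k p q where X: "X \<in> carrier_mat n n" "real k \<le> r" "\<And>i j. i < n \<Longrightarrow> j < n \<Longrightarrow> X $$ (i, j) = (\<Sum>t<k. p t i * q t j)"
    using assms(1) unfolding lowrank_def by blast
  obtain k' p' q' where Y: "Y \<in> carrier_mat n n" "real k' \<le> s" "\<And>i j. i < n \<Longrightarrow> j < n \<Longrightarrow> Y $$ (i, j) = (\<Sum>t<k'. p' t i * q' t j)"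
    using assms(2) unfolding lowrank_def by blast
  define p'' where "p'' t = (if t < k then p t else p' (t - k))" for t
  define q'' where "q'' t = (if t < k then q t else q' (t - k))" for t
  have "(X + Y) $$ (i, j) = (\<Sum>t<k+k'. p'' t i * q'' t j)" if "i < n" "j < n" for i j
  proof -
    have "(\<Sum>t<k+k'. p'' t i * q'' t j) = (\<Sum>t<k. p'' t i * q'' t j) + (\<Sum>t=k..<k+k'. p'' t i * q'' t j)"
      using sum.atLeastLessThan_concat[of 0 k "k+k'" "\<lambda>t. p'' t i * q'' t j"] by (simp add: atLeast0LessThan)
    also have "(\<Sum>t<k. p'' t i * q'' t j) = (\<Sum>t<k. p t i * q t j)"
      by (simp add: p''_def q''_def)
    also have "(\<Sum>t=k..<k+k'. p'' t i * q'' t j) = (\<Sum>t<k'. p' t i * q' t j)"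
      using sum.shift_bounds_nat_ivl[of "\<lambda>t. p'' t i * q'' t j" 0 k k']
      by (simp add: p''_def q''_def atLeast0LessThan add.commute)
    finally show ?thesis using X Y that by auto
  qed
  then show ?thesis
    unfolding lowrank_def using X Y
    by (intro conjI exI[of _ "k + k'"] exI[of _ p''] exI[of _ q'']) auto
qed

lemma lowrank_mult_left:
  assumes "lowrank n r X" "Y \<in> carrier_mat n n"
  shows "lowrank n r (Y * X)"
proof -
  obtain k p q where X: "X \<in> carrier_mat n n" "real k \<le> r" "\<And>i j. i < n \<Longrightarrow> j < n \<Longrightarrow> X $$ (i, j) = (\<Sum>t<k. p t i * q t j)"
    using assms(1) unfolding lowrank_def by blast
  define p' where "p' t i = (\<Sum>l<n. Y $$ (i, l) * p t l)" for t i
  have "(Y * X) $$ (i, j) = (\<Sum>t<k. p' t i * q t j)" if "i < n" "j < n" for i j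
  proof -
    have "(Y * X) $$ (i, j) = (\<Sum>l<n. \<Sum>t<k. Y $$ (i, l) * (p t l * q t j))"
      using assms X that by (simp add: index_mult_mat_sum[of _ n n _ n] sum_distrib_left del: index_mult_mat)
    also have "\<dots> = (\<Sum>t<k. \<Sum>l<n. Y $$ (i, l) * (p t l * q t j))" by (rule sum.swap)
    finally show ?thesis by (simp add: p'_def sum_distrib_right mult.assoc)
  qed
  then show ?thesis
    unfolding lowrank_def using X assms
    by (intro conjI exI[of _ "k"] exI[of _ p'] exI[of _ q]) auto
qed

lemma lowrank_adjoint:
  assumes "lowrank n r X"
  shows "lowrank n r (mat_adjoint X)"
proof -
  obtain k p q where X: "X \<in> carrier_mat n n" "real k \<le> r" "\<And>i j. i < n \<Longrightarrow> j < n \<Longrightarrow> X $$ (i, j) = (\<Sum>t<k. p t i * q t j)"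
    using assms(1) unfolding lowrank_def by blast
  show ?thesis
    unfolding lowrank_def using X
    by (intro conjI exI[of _ "k"] exI[of _ "\<lambda>t i. cnj (q t i)"] exI[of _ "\<lambda>t i. cnj (p t i)"])
       (auto simp: mult.commute)
qed

lemma lowrank_mult_right:
  assumes "lowrank n r X" "Y \<in> carrier_mat n n"
  shows "lowrank n r (X * Y)"
proof -
  have X: "X \<in> carrier_mat n n" using assms by (simp add: lowrank_carrier)
  \<comment> \<open>The product is the adjoint of the reversed product of adjoints, which turns the
    right factor into a left one.\<close>
  have "lowrank n r (mat_adjoint (mat_adjoint Y * mat_adjoint X))"
    using assms by (intro lowrank_adjoint lowrank_mult_left) auto
  also have "mat_adjoint (mat_adjoint Y * mat_adjoint X) = X * Y"
    using assms X by (subst mat_adjoint_mult[symmetric]) (auto simp: mat_adjoint_adjoint[of _ n n])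
  finally show ?thesis .
qed

text \<open>The matrix is the sum over \<open>J\<close> of a column times a coordinate row, one
  rank-one term for each index.\<close>

lemma lowrank_columns:
  assumes X: "X \<in> carrier_mat n n" and J: "finite J"
    and zero: "\<And>i j. i < n \<Longrightarrow> j < n \<Longrightarrow> j \<notin> J \<Longrightarrow> X $$ (i, j) = 0"
    and card: "real (card J) \<le> r"
  shows "lowrank n r X"
proof -
  obtain h where h: "bij_betw h {..<card J} J"
    using ex_bij_betw_nat_finite[OF J] by (auto simp: atLeast0LessThan)
  have "X $$ (i, j) = (\<Sum>t<card J. X $$ (i, h t) * (if j = h t then 1 else 0))" if "i < n" "j < n" for i j
  proof -
    have "(\<Sum>t<card J. X $$ (i, h t) * (if j = h t then 1 else 0)) = (\<Sum>l\<in>J. X $$ (i, l) * (if j = l then 1 else 0))"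
      by (rule sum.reindex_bij_betw[OF h])
    also have "\<dots> = (\<Sum>l\<in>J. if j = l then X $$ (i, l) else 0)"
      by (intro sum.cong) auto
    also have "\<dots> = X $$ (i, j)" using zero that J by (auto simp: sum.delta')
    finally show ?thesis by simp
  qed
  then show ?thesis
    unfolding lowrank_def using X card
    by (intro conjI exI[of _ "card J"] exI[of _ "\<lambda>t i. X $$ (i, h t)"] exI[of _ "\<lambda>t j. if j = h t then 1 else 0"]) auto
qed

text \<open>\<alpha> measures rank as a fraction of \<open>n\<close>, to be comparable with a
  measure. Besides smallness (both parameters small) this also expresses boundedness up to few
  directions: \<alpha> small and \<beta> large.\<close>

definition mat_split :: "nat \<Rightarrow> real \<Rightarrow> real \<Rightarrow> complex mat \<Rightarrow> bool" where
  "mat_split n \<alpha> \<beta> X \<longleftrightarrow> (\<exists>R N. lowrank n (\<alpha> * real n) R \<and> op_bound n \<beta> N \<and> X = R + N)"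

lemma mat_splitI: "lowrank n (\<alpha> * real n) R \<Longrightarrow> op_bound n \<beta> N \<Longrightarrow> X = R + N \<Longrightarrow> mat_split n \<alpha> \<beta> X"
  by (auto simp: mat_split_def)

lemma mat_split_mono:
  assumes "mat_split n \<alpha> \<beta> X" "\<alpha> \<le> \<alpha>'" "\<beta> \<le> \<beta>'"
  shows "mat_split n \<alpha>' \<beta>' X"
  using assms unfolding mat_split_def by (metis lowrank_mono op_bound_mono mult_right_mono of_nat_0_le_iff)

lemma mat_split_op_bound: "op_bound n \<beta> X \<Longrightarrow> mat_split n 0 \<beta> X"
  by (rule mat_splitI[OF lowrank_zero]) (auto dest: op_boundD)

lemma mat_split_add:
  assumes "mat_split n \<alpha> \<beta> X" "mat_split n \<alpha>' \<beta>' Y"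
  shows "mat_split n (\<alpha> + \<alpha>') (\<beta> + \<beta>') (X + Y)"
proof -
  obtain R N where X: "lowrank n (\<alpha> * real n) R" "op_bound n \<beta> N" "X = R + N"
    using assms(1) by (auto simp: mat_split_def)
  obtain R' N' where Y: "lowrank n (\<alpha>' * real n) R'" "op_bound n \<beta>' N'" "Y = R' + N'"
    using assms(2) by (auto simp: mat_split_def)
  note c = lowrank_carrier[OF X(1)] op_boundD(1)[OF X(2)] lowrank_carrier[OF Y(1)] op_boundD(1)[OF Y(2)]
  have "X + Y = (R + R') + (N + N')"
    using c by (intro eq_matI) (auto simp: X Y)
  then show ?thesis
    using lowrank_add[OF X(1) Y(1)] op_bound_add[OF X(2) Y(2)] by (auto simp: mat_split_def distrib_right)
qed

text \<open>The product expands to R Y + N R' + N N'. The first two terms have low rank whatever the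
  norms of \<open>Y\<close> and \<open>N\<close>, so rank fractions add and only the norms of the
  bounded parts are multiplied.\<close>

lemma mat_split_mult:
  assumes "mat_split n \<alpha> \<beta> X" "mat_split n \<alpha>' \<beta>' Y"
  shows "mat_split n (\<alpha> + \<alpha>') (\<beta> * \<beta>') (X * Y)"
proof -
  obtain R N where X: "lowrank n (\<alpha> * real n) R" "op_bound n \<beta> N" "X = R + N"
    using assms(1) by (auto simp: mat_split_def)
  obtain R' N' where Y: "lowrank n (\<alpha>' * real n) R'" "op_bound n \<beta>' N'" "Y = R' + N'"
    using assms(2) by (auto simp: mat_split_def)
  note c = lowrank_carrier[OF X(1)] op_boundD(1)[OF X(2)] lowrank_carrier[OF Y(1)] op_boundD(1)[OF Y(2)]
  have Yc: "Y \<in> carrier_mat n n" using c Y by auto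
  have "X * Y = R * Y + (N * R' + N * N')"
    using c Yc by (simp add: X(3) add_mult_distrib_mat[of _ n n _ _ n])
      (simp add: Y(3) mult_add_distrib_mat[of _ n n _ n])
  also have "\<dots> = (R * Y + N * R') + N * N'"
    using c Yc by (intro assoc_add_mat[symmetric, of _ n n]) auto
  finally have "X * Y = (R * Y + N * R') + N * N'" .
  moreover have "lowrank n ((\<alpha> + \<alpha>') * real n) (R * Y + N * R')"
    unfolding distrib_right
    by (intro lowrank_add lowrank_mult_left[OF Y(1)] lowrank_mult_right[OF X(1)]) (use c Yc in auto)
  ultimately show ?thesis
    using op_bound_mult[OF X(2) Y(2)] by (auto simp: mat_split_def)
qed

lemma mat_split_adjoint:
  assumes "mat_split n \<alpha> \<beta> X"
  shows "mat_split n \<alpha> \<beta> (mat_adjoint X)"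
proof -
  obtain R N where X: "lowrank n (\<alpha> * real n) R" "op_bound n \<beta> N" "X = R + N"
    using assms(1) by (auto simp: mat_split_def)
  show ?thesis
    by (rule mat_splitI[OF lowrank_adjoint[OF X(1)] op_bound_adjoint[OF X(2)]])
      (use X(3) lowrank_carrier[OF X(1)] op_boundD(1)[OF X(2)] in \<open>simp add: mat_adjoint_add[of _ n n]\<close>)
qed

section \<open>Unitary diagonalization of normal matrices\<close>

text \<open>Gaussian elimination, by induction on the set \<open>W\<close> of equations in the
  unknowns \<open>J\<close>. It serves as the dimension count both for ranks and for the number of
  large eigenvalues.\<close>

lemma homogeneous_system_nontrivial:
  fixes F :: "'w \<Rightarrow> 'j \<Rightarrow> 'a :: field"
  assumes "finite W" "finite J" "card W < card J"
  shows "\<exists>c. (\<exists>j\<in>J. c j \<noteq> 0) \<and> (\<forall>w\<in>W. (\<Sum>j\<in>J. F w j * c j) = 0)"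
  using assms
proof (induction W arbitrary: J F rule: finite_induct)
  case empty
  then have "J \<noteq> {}" by auto
  then show ?case by (intro exI[of _ "\<lambda>_. 1"]) auto
next
  case (insert w W)
  show ?case
  proof (cases "\<forall>j\<in>J. F w j = 0")
    case True
    then show ?thesis using insert.IH[of J F] insert.hyps insert.prems by auto
  next
    case False
    then obtain j0 where j0: "j0 \<in> J" "F w j0 \<noteq> 0" by blast
    define J' where "J' = J - {j0}"
    \<comment> \<open>Equation \<open>w\<close> is used to eliminate the unknown \<open>j0\<close>
      from the others.\<close>
    define F' where "F' u j = F u j - F w j / F w j0 * F u j0" for u j
    have J': "finite J'" "card W < card J'" using insert j0 by (auto simp: J'_def)
    obtain c where c: "\<exists>j\<in>J'. c j \<noteq> 0" "\<And>u. u \<in> W \<Longrightarrow> (\<Sum>j\<in>J'. F' u j * c j) = 0"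
      using insert.IH[OF J', of F'] by blast
    define s where "s = (\<Sum>j\<in>J'. F w j * c j)"
    \<comment> \<open>Back substitution: the value at \<open>j0\<close> is the one that solves
      equation \<open>w\<close>.\<close>
    define c' where "c' = c(j0 := - s / F w j0)"
    have split: "(\<Sum>j\<in>J. F u j * c' j) = (\<Sum>j\<in>J'. F u j * c j) - F u j0 * s / F w j0" for u
    proof -
      have "(\<Sum>j\<in>J. F u j * c' j) = F u j0 * c' j0 + (\<Sum>j\<in>J'. F u j * c' j)"
        unfolding J'_def using insert.prems j0 by (intro sum.remove) auto
      also have "(\<Sum>j\<in>J'. F u j * c' j) = (\<Sum>j\<in>J'. F u j * c j)"
        by (intro sum.cong) (auto simp: c'_def J'_def)
      finally show ?thesis by (simp add: c'_def)
    qed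
    have "(\<Sum>j\<in>J. F u j * c' j) = 0" if "u \<in> W" for u
    proof -
      have "0 = (\<Sum>j\<in>J'. F u j * c j - F u j0 / F w j0 * (F w j * c j))"
        using c(2)[OF that] by (simp add: F'_def algebra_simps)
      also have "\<dots> = (\<Sum>j\<in>J'. F u j * c j) - F u j0 / F w j0 * s"
        by (simp add: sum_subtractf s_def sum_distrib_left)
      finally show ?thesis by (simp add: split)
    qed
    moreover have "(\<Sum>j\<in>J. F w j * c' j) = 0"
      using j0 by (simp add: split s_def)
    moreover have "\<exists>j\<in>J. c' j \<noteq> 0" using c(1) by (auto simp: c'_def J'_def)
    ultimately show ?thesis by blast
  qed
qed

text \<open>A maximal independent set of columns has as many elements as the rank. With more than
  \<open>k\<close> of them, some nontrivial combination would be annihilated by all \<open>k\<close>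
  row factors \<open>q t\<close> and hence vanish.\<close>

lemma rank_le_lowrank:
  assumes "lowrank n r A"
  shows "real (vec_space.rank n A) \<le> r"
proof -
  interpret vec_space "TYPE(complex)" n .
  obtain k p q where A: "A \<in> carrier_mat n n" "real k \<le> r"
    and fac: "\<And>i j. i < n \<Longrightarrow> j < n \<Longrightarrow> A $$ (i, j) = (\<Sum>t<k. p t i * q t j)"
    using assms unfolding lowrank_def by blast
  have cols: "set (cols A) \<subseteq> carrier_vec n" using A cols_dim by blast
  obtain S where S: "finite S" "maximal S (\<lambda>T. T \<subseteq> set (cols A) \<and> lin_indpt T)"
    using maximal_exists_superset[of "set (cols A)" "\<lambda>T. T \<subseteq> set (cols A) \<and> lin_indpt T" "{}"]
    by (auto simp: lin_dep_def)
  have rank: "rank A = card S" by (rule rank_card_indpt[OF A(1) S(2)])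
  have SA: "S \<subseteq> set (cols A)" "lin_indpt S" using S(2) by (auto simp: maximal_def)
  have "\<forall>x\<in>S. \<exists>j<n. x = col A j"
    using SA A by (force simp: cols_def)
  then obtain h where h: "\<And>x. x \<in> S \<Longrightarrow> h x < n \<and> x = col A (h x)" by metis
  have "card S \<le> k"
  proof (rule ccontr)
    assume "\<not> card S \<le> k"
    then have "card {..<k} < card S" by simp
    \<comment> \<open>One equation for each \<open>t\<close>, one unknown for each chosen column;
      \<open>h x\<close> is a position at which the column \<open>x\<close> occurs.\<close>
    from homogeneous_system_nontrivial[OF _ S(1) this, of "\<lambda>t x. q t (h x)"]
    obtain c x where c: "x \<in> S" "c x \<noteq> 0" "\<And>t. t < k \<Longrightarrow> (\<Sum>x\<in>S. q t (h x) * c x) = 0" by auto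
    have "lincomb c S = 0\<^sub>v n"
    proof (rule eq_vecI)
      fix i assume i: "i < dim_vec (0\<^sub>v n :: complex vec)"
      have "lincomb c S $ i = (\<Sum>x\<in>S. c x * x $ i)"
        using i SA cols by (subst lincomb_index) auto
      also have "\<dots> = (\<Sum>x\<in>S. c x * (\<Sum>t<k. p t i * q t (h x)))"
      proof (intro sum.cong refl)
        fix x assume x: "x \<in> S"
        have "x $ i = A $$ (i, h x)" using h[OF x] i A by (metis carrier_matD index_col index_zero_vec(2))
        then show "c x * x $ i = c x * (\<Sum>t<k. p t i * q t (h x))" using fac h[OF x] i by simp
      qed
      also have "\<dots> = (\<Sum>x\<in>S. \<Sum>t<k. p t i * (q t (h x) * c x))"
        by (simp add: sum_distrib_left mult_ac)
      also have "\<dots> = (\<Sum>t<k. \<Sum>x\<in>S. p t i * (q t (h x) * c x))"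
        by (rule sum.swap)
      also have "\<dots> = 0" using c(3) by (simp flip: sum_distrib_left)
      finally show "lincomb c S $ i = 0\<^sub>v n $ i" using i by simp
    next
      show "dim_vec (lincomb c S) = dim_vec (0\<^sub>v n)"
        using SA cols lincomb_dim[OF S(1)] by auto
    qed
    then have "lin_dep S" using lin_dep_crit[where S=S and A=S and a=c and v=x] S(1) c(1,2) by auto
    then show False using SA by simp
  qed
  then show ?thesis using A rank by simp
qed

text \<open>Rank factorization: the left factors are the columns of a maximal independent set, the
  right factors the coordinates of all columns with respect to it.\<close>

lemma lowrank_rank:
  assumes A: "A \<in> carrier_mat n n"
  shows "lowrank n (real (vec_space.rank n A)) A"
proof -
  interpret vec_space "TYPE(complex)" n .
  have cols: "set (cols A) \<subseteq> carrier_vec n" using A cols_dim by blast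
  obtain S where S: "finite S" "maximal S (\<lambda>T. T \<subseteq> set (cols A) \<and> lin_indpt T)"
    using maximal_exists_superset[of "set (cols A)" "\<lambda>T. T \<subseteq> set (cols A) \<and> lin_indpt T" "{}"]
    by (auto simp: lin_dep_def)
  have rank: "rank A = card S" by (rule rank_card_indpt[OF A S(2)])
  have SA: "S \<subseteq> set (cols A)" "lin_indpt S" using S(2) by (auto simp: maximal_def)
  have Sc: "S \<subseteq> carrier_vec n" using SA cols by blast
  have in_span: "x \<in> span S" if "x \<in> set (cols A)" for x
  proof (cases "x \<in> S")
    case True then show ?thesis using Sc by (meson in_own_span subsetD)
  next
    case False
    then have "lin_dep (insert x S)"
      using S(2) that SA unfolding maximal_def by (metis insert_subset subset_insertI insertI1)
    then show ?thesis using lin_dep_iff_in_span[OF Sc SA(2) _ False] that cols by auto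
  qed
  have "\<forall>j<n. \<exists>a. col A j = lincomb a S"
  proof (intro allI impI)
    fix j assume "j < n"
    then have "col A j \<in> span S" using A by (intro in_span) (auto simp: cols_def)
    then show "\<exists>a. col A j = lincomb a S"
      using finite_span[OF S(1) ] Sc by auto
  qed
  then obtain a where a: "\<And>j. j < n \<Longrightarrow> col A j = lincomb (a j) S" by metis
  obtain h where h: "bij_betw h {..<card S} S"
    using ex_bij_betw_nat_finite[OF S(1)] by (auto simp: atLeast0LessThan)
  have "A $$ (i, j) = (\<Sum>t<card S. h t $ i * a j (h t))" if "i < n" "j < n" for i j
  proof -
    have "A $$ (i, j) = lincomb (a j) S $ i" using a[OF that(2)] that A by (metis carrier_matD index_col)
    also have "\<dots> = (\<Sum>x\<in>S. x $ i * a j x)"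
      using that Sc by (subst lincomb_index) (auto simp: mult.commute)
    also have "\<dots> = (\<Sum>t<card S. h t $ i * a j (h t))"
      by (rule sum.reindex_bij_betw[OF h, symmetric])
    finally show ?thesis .
  qed
  then show ?thesis
    unfolding lowrank_def rank using A
    by (intro conjI exI[of _ "card S"] exI[of _ "\<lambda>t i. h t $ i"] exI[of _ "\<lambda>t j. a j (h t)"]) auto
qed

section \<open>Unitary matrices and unitarily diagonalized matrices\<close>

lemma dim_mat_adjoint [simp]:
  "dim_row (mat_adjoint A) = dim_col A" "dim_col (mat_adjoint A) = dim_row A"
  by (auto simp: mat_adjoint_def)

definition unitary_mat :: "nat \<Rightarrow> complex mat \<Rightarrow> bool" where
  "unitary_mat n U \<longleftrightarrow> U \<in> carrier_mat n n \<and> mat_adjoint U * U = 1\<^sub>m n \<and> U * mat_adjoint U = 1\<^sub>m n"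

lemma unitary_matD:
  assumes "unitary_mat n U"
  shows "U \<in> carrier_mat n n" "mat_adjoint U \<in> carrier_mat n n" "mat_adjoint U * U = 1\<^sub>m n" "U * mat_adjoint U = 1\<^sub>m n"
  using assms by (auto simp: unitary_mat_def)

text \<open>Orthonormal columns suffice because a left inverse of a square matrix is also a right
  inverse.\<close>

lemma unitary_matI:
  assumes U: "U \<in> carrier_mat n n"
    and orth: "\<And>i j. i < n \<Longrightarrow> j < n \<Longrightarrow> (\<Sum>l<n. cnj (U $$ (l, i)) * U $$ (l, j)) = (if i = j then 1 else 0)"
  shows "unitary_mat n U"
proof -
  have c: "mat_adjoint U \<in> carrier_mat n n" using U by simp
  have "mat_adjoint U * U = 1\<^sub>m n"
  proof (rule eq_matI)
    fix i j assume "i < dim_row (1\<^sub>m n :: complex mat)" "j < dim_col (1\<^sub>m n :: complex mat)"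
    then have ij: "i < n" "j < n" by auto
    show "(mat_adjoint U * U) $$ (i, j) = 1\<^sub>m n $$ (i, j)"
      unfolding index_mult_mat_sum[OF c U ij] using ij orth[OF ij] U
      by (simp add: mat_adjoint_index[of _ n n])
  qed (use U in auto)
  then show ?thesis
    using mat_mult_left_right_inverse[OF c U] U by (auto simp: unitary_mat_def)
qed

lemma unitary_mat_mult:
  assumes "unitary_mat n U" "unitary_mat n V"
  shows "unitary_mat n (U * V)"
proof -
  note U = unitary_matD[OF assms(1)] and V = unitary_matD[OF assms(2)]
  have c: "U * V \<in> carrier_mat n n" using U V by auto
  have "mat_adjoint (U * V) * (U * V) = mat_adjoint V * (mat_adjoint U * (U * V))"
    unfolding mat_adjoint_mult[OF U(1) V(1)] by (rule assoc_mult_mat[OF V(2) U(2) c])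
  also have "mat_adjoint U * (U * V) = V"
    using assoc_mult_mat[OF U(2) U(1) V(1)] U V by simp
  finally have *: "mat_adjoint (U * V) * (U * V) = 1\<^sub>m n" using V by simp
  then show ?thesis
    using mat_mult_left_right_inverse[OF _ c] c by (auto simp: unitary_mat_def)
qed

definition udiag :: "nat \<Rightarrow> complex mat \<Rightarrow> (nat \<Rightarrow> complex) \<Rightarrow> complex mat" where
  "udiag n U d = U * mat_diag n d * mat_adjoint U"

lemma udiag_carrier [simp]: "U \<in> carrier_mat n n \<Longrightarrow> udiag n U d \<in> carrier_mat n n"
  unfolding udiag_def by (intro mult_carrier_mat[of _ n n]) auto

lemma dim_udiag [simp]: "dim_row (udiag n U d) = dim_row U" "dim_col (udiag n U d) = dim_row U"
  by (simp_all add: udiag_def)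

lemma udiag_index:
  assumes U: "U \<in> carrier_mat n n" and ij: "i < n" "j < n"
  shows "udiag n U d $$ (i, j) = (\<Sum>l<n. U $$ (i, l) * d l * cnj (U $$ (j, l)))"
proof -
  have c: "U * mat_diag n d \<in> carrier_mat n n" "mat_adjoint U \<in> carrier_mat n n"
    using U by auto
  show ?thesis
    unfolding udiag_def index_mult_mat_sum[OF c ij]
    using U ij by (intro sum.cong refl) (simp add: mat_diag_mult_right[OF U] mat_adjoint_index[OF U])
qed

lemma unitary_conj_mult:
  assumes "unitary_mat n U" "X \<in> carrier_mat n n" "Y \<in> carrier_mat n n"
  shows "(U * X * mat_adjoint U) * (U * Y * mat_adjoint U) = U * (X * Y) * mat_adjoint U"
proof -
  note U = unitary_matD[OF assms(1)]
  have UY: "U * Y \<in> carrier_mat n n" using U assms by auto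
  have c: "U * X \<in> carrier_mat n n" "Y * mat_adjoint U \<in> carrier_mat n n"
    "U * Y * mat_adjoint U \<in> carrier_mat n n" "X * Y \<in> carrier_mat n n"
    using U assms mult_carrier_mat[OF UY U(2)] by auto
  have "(U * X * mat_adjoint U) * (U * Y * mat_adjoint U) = U * X * (mat_adjoint U * (U * Y * mat_adjoint U))"
    by (rule assoc_mult_mat[OF c(1) U(2) c(3)])
  also have "mat_adjoint U * (U * Y * mat_adjoint U) = Y * mat_adjoint U"
    unfolding assoc_mult_mat[OF U(1) assms(3) U(2)] using assoc_mult_mat[OF U(2) U(1) c(2)] by (simp only: U(3) left_mult_one_mat[OF c(2)])
  also have "U * X * (Y * mat_adjoint U) = U * X * Y * mat_adjoint U"
    by (rule assoc_mult_mat[OF c(1) assms(3) U(2), symmetric])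
  also have "U * X * Y = U * (X * Y)" by (rule assoc_mult_mat[OF U(1) assms(2,3)])
  finally show ?thesis .
qed

lemma udiag_mult:
  assumes "unitary_mat n U"
  shows "udiag n U d * udiag n U e = udiag n U (\<lambda>i. d i * e i)"
  unfolding udiag_def by (subst unitary_conj_mult[OF assms]) auto

lemma udiag_add:
  assumes "U \<in> carrier_mat n n"
  shows "udiag n U d + udiag n U e = udiag n U (\<lambda>i. d i + e i)"
  using assms
  by (intro eq_matI) (auto simp: udiag_index[OF assms] algebra_simps sum.distrib)

lemma udiag_minus:
  assumes "U \<in> carrier_mat n n"
  shows "udiag n U d - udiag n U e = udiag n U (\<lambda>i. d i - e i)"
  using assms
  by (intro eq_matI) (auto simp: udiag_index[OF assms] algebra_simps sum_subtractf)

lemma udiag_adjoint: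
  assumes "U \<in> carrier_mat n n"
  shows "mat_adjoint (udiag n U d) = udiag n U (\<lambda>i. cnj (d i))"
  using assms
  by (intro eq_matI) (auto simp: udiag_index[OF assms] mat_adjoint_index[OF udiag_carrier[OF assms]] mult_ac)

lemma udiag_const:
  assumes "unitary_mat n U"
  shows "udiag n U (\<lambda>_. c) = mat_diag n (\<lambda>_. c)"
proof (rule eq_matI)
  note U = unitary_matD[OF assms]
  fix i j assume "i < dim_row (mat_diag n (\<lambda>_. c))" "j < dim_col (mat_diag n (\<lambda>_. c))"
  then have ij: "i < n" "j < n" by (auto simp: mat_diag_def)
  have "(\<Sum>l<n. U $$ (i, l) * cnj (U $$ (j, l))) = (U * mat_adjoint U) $$ (i, j)"
    unfolding index_mult_mat_sum[OF U(1,2) ij] using U ij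
    by (intro sum.cong) (auto simp: mat_adjoint_index[of _ n n])
  then show "udiag n U (\<lambda>_. c) $$ (i, j) = mat_diag n (\<lambda>_. c) $$ (i, j)"
    using ij unfolding udiag_index[OF U(1) ij] U(4)
    by (simp add: mat_diag_def mult.commute mult.left_commute flip: sum_distrib_left)
next
  show "dim_row (udiag n U (\<lambda>_. c)) = dim_row (mat_diag n (\<lambda>_. c))"
    "dim_col (udiag n U (\<lambda>_. c)) = dim_col (mat_diag n (\<lambda>_. c))"
    using unitary_matD(1)[OF assms] by (auto simp: mat_diag_def)
qed

lemma udiag_conj:
  assumes W: "unitary_mat n W" and V: "unitary_mat n V"
  shows "W * udiag n V d * mat_adjoint W = udiag n (W * V) d"
proof -
  note W = unitary_matD[OF W] and V = unitary_matD[OF V]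
  have d: "mat_diag n d \<in> carrier_mat n n" by simp
  note c = mult_carrier_mat[OF V(1) d] mult_carrier_mat[OF W(1) V(1)]
  have "W * (V * mat_diag n d * mat_adjoint V) * mat_adjoint W
      = (W * (V * mat_diag n d)) * mat_adjoint V * mat_adjoint W"
    by (subst assoc_mult_mat[OF W(1) c(1) V(2)]) simp
  also have "\<dots> = (W * (V * mat_diag n d)) * (mat_adjoint V * mat_adjoint W)"
    by (rule assoc_mult_mat[OF mult_carrier_mat[OF W(1) c(1)] V(2) W(2)])
  also have "W * (V * mat_diag n d) = (W * V) * mat_diag n d"
    by (rule assoc_mult_mat[OF W(1) V(1) d, symmetric])
  finally show ?thesis by (simp add: udiag_def mat_adjoint_mult[OF W(1) V(1)])
qed

lemma unitary_adjoint: "unitary_mat n U \<Longrightarrow> unitary_mat n (mat_adjoint U)"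
  by (auto simp: unitary_mat_def mat_adjoint_adjoint)

text \<open>Complete \<open>v\<close> to a basis and orthogonalize; the Gram-Schmidt process keeps
  its first vector. It does not normalize, so the columns are divided by their norms
  afterwards.\<close>

lemma unitary_with_first_column:
  assumes v: "v \<in> carrier_vec n" "v \<noteq> 0\<^sub>v n"
  obtains W where "unitary_mat n W" "\<And>i. i < n \<Longrightarrow> W $$ (i, 0) = v $ i / cvec_norm v"
proof -
  interpret cof_vec_space n "TYPE(complex)" .
  define b where "b = basis_completion v"
  define ws where "ws = gram_schmidt n b"
  from basis_completion[OF v, folded b_def]
  have dist_b: "distinct b" and indep: "\<not> lin_dep (set b)" and b: "set b \<subseteq> carrier_vec n"
    and hdb: "hd b = v" and len_b: "length b = n" by auto
  have n: "n \<noteq> 0" using v by auto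
  from hdb len_b n obtain vs where bv: "b = v # vs" by (cases b, auto)
  from gram_schmidt_result[OF b dist_b indep refl, folded ws_def]
  have ws: "set ws \<subseteq> carrier_vec n" "corthogonal ws" "length ws = n"
    by (auto simp: len_b)
  from gram_schmidt_hd[OF v(1), of vs, folded bv] have hdws: "hd ws = v" unfolding ws_def .
  have wsn: "ws ! j \<in> carrier_vec n" if "j < n" for j using ws that by auto
  have sp: "(\<Sum>l<n. (ws ! j) $ l * cnj ((ws ! i) $ l)) = ws ! j \<bullet>c ws ! i" if "i < n" "j < n" for i j
    using wsn[OF that(1)] wsn[OF that(2)] by (auto simp: scalar_prod_def atLeast0LessThan intro!: sum.cong)
  define W where "W = Matrix.mat n n (\<lambda>(i, j). (ws ! j) $ i / cvec_norm (ws ! j))"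
  show thesis
  proof
    show "unitary_mat n W"
    proof (rule unitary_matI)
      fix i j assume ij: "i < n" "j < n"
      have "(\<Sum>l<n. cnj (W $$ (l, i)) * W $$ (l, j))
          = (\<Sum>l<n. (ws ! j) $ l * cnj ((ws ! i) $ l)) / (cvec_norm (ws ! i) * cvec_norm (ws ! j))"
        using ij by (simp add: W_def sum_divide_distrib mult.commute)
      also have "\<dots> = (if i = j then 1 else 0)"
      proof (cases "i = j")
        case True
        have *: "(\<Sum>l<n. (ws ! i) $ l * cnj ((ws ! i) $ l)) \<noteq> 0"
          using corthogonalD[OF ws(2), of i i] ij sp[of i i] ws(3) by auto
        have **: "(\<Sum>l<n. (ws ! i) $ l * cnj ((ws ! i) $ l)) = complex_of_real (cvec_norm (ws ! i) * cvec_norm (ws ! i))"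
          using cvec_norm_square[OF wsn[OF ij(1)]] by (simp add: power2_eq_square)
        have "cvec_norm (ws ! i) \<noteq> 0" using * ** by auto
        then show ?thesis unfolding True[symmetric] ** by simp
      next
        case False
        then show ?thesis
          using corthogonalD[OF ws(2), of j i] ij sp[of i j] ws(3) by auto
      qed
      finally show "(\<Sum>l<n. cnj (W $$ (l, i)) * W $$ (l, j)) = (if i = j then 1 else 0)" .
    qed (simp add: W_def)
    show "W $$ (i, 0) = v $ i / cvec_norm v" if "i < n" for i
    proof -
      have "ws ! 0 = v" using hdws ws(3) n hd_conv_nth[of ws] by fastforce
      then show ?thesis using that n by (simp add: W_def)
    qed
  qed
qed

text \<open>The (0,0) entries of the two products are the squared norms of the first row and of the
  first column. The column consists of its top entry alone, so the rest of the row vanishes;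
  \<open>B\<close> is then block diagonal, and normality passes to the lower block.\<close>

lemma normal_block:
  fixes B :: "complex mat"
  assumes B: "B \<in> carrier_mat (Suc m) (Suc m)" "B * mat_adjoint B = mat_adjoint B * B"
    and col: "\<And>i. i < m \<Longrightarrow> B $$ (Suc i, 0) = 0"
  shows "\<And>j. j < m \<Longrightarrow> B $$ (0, Suc j) = 0"
    and "let C = Matrix.mat m m (\<lambda>(i, j). B $$ (Suc i, Suc j)) in C * mat_adjoint C = mat_adjoint C * C"
proof -
  have adj: "mat_adjoint B \<in> carrier_mat (Suc m) (Suc m)" using B by simp
  have eq: "(\<Sum>l<Suc m. B $$ (i, l) * cnj (B $$ (j, l))) = (\<Sum>l<Suc m. cnj (B $$ (l, i)) * B $$ (l, j))"
    if "i < Suc m" "j < Suc m" for i j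
  proof -
    have "(B * mat_adjoint B) $$ (i, j) = (mat_adjoint B * B) $$ (i, j)" using B by simp
    then show ?thesis
      unfolding index_mult_mat_sum[OF B(1) adj that] index_mult_mat_sum[OF adj B(1) that]
      using that by (simp add: mat_adjoint_index[OF B(1)] del: sum.lessThan_Suc)
  qed
  have "(\<Sum>l<m. B $$ (0, Suc l) * cnj (B $$ (0, Suc l))) = 0"
    using eq[of 0 0] col by (simp add: sum.lessThan_Suc_shift mult.commute del: sum.lessThan_Suc)
  then have "complex_of_real (\<Sum>l<m. (cmod (B $$ (0, Suc l)))\<^sup>2) = 0"
    by (simp only: of_real_sum complex_norm_square)
  then have "(\<Sum>l<m. (cmod (B $$ (0, Suc l)))\<^sup>2) = 0" by (simp only: of_real_eq_0_iff)
  then show row: "\<And>j. j < m \<Longrightarrow> B $$ (0, Suc j) = 0"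
    by (subst (asm) sum_nonneg_eq_0_iff) auto
  define C where "C = Matrix.mat m m (\<lambda>(i, j). B $$ (Suc i, Suc j))"
  have C: "C \<in> carrier_mat m m" "mat_adjoint C \<in> carrier_mat m m" by (auto simp: C_def)
  have "C * mat_adjoint C = mat_adjoint C * C"
  proof (rule eq_matI)
    fix i j assume "i < dim_row (mat_adjoint C * C)" "j < dim_col (mat_adjoint C * C)"
    then have ij: "i < m" "j < m" using C by auto
    have "(\<Sum>l<m. B $$ (Suc i, Suc l) * cnj (B $$ (Suc j, Suc l)))
        = (\<Sum>l<m. cnj (B $$ (Suc l, Suc i)) * B $$ (Suc l, Suc j))"
      using eq[of "Suc i" "Suc j"] ij col row
      by (simp add: sum.lessThan_Suc_shift del: sum.lessThan_Suc)
    then show "(C * mat_adjoint C) $$ (i, j) = (mat_adjoint C * C) $$ (i, j)"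
      unfolding index_mult_mat_sum[OF C ij] index_mult_mat_sum[OF C(2,1) ij]
      using ij by (simp add: mat_adjoint_index[OF C(1)]) (simp add: C_def)
  qed (use C in auto)
  then show "let C = Matrix.mat m m (\<lambda>(i, j). B $$ (Suc i, Suc j)) in C * mat_adjoint C = mat_adjoint C * C"
    by (simp add: C_def)
qed

text \<open>Induction on the dimension: an eigenvector becomes, after scaling, the first column of a
  unitary \<open>W\<close>, and in that basis \<open>normal_block\<close> splits off a block of size
  1.\<close>

theorem normal_unitary_diagonalization:
  fixes A :: "complex mat"
  assumes "A \<in> carrier_mat n n" "A * mat_adjoint A = mat_adjoint A * A"
  shows "\<exists>U d. unitary_mat n U \<and> A = udiag n U d"
  using assms
proof (induction n arbitrary: A)
  case 0
  have "unitary_mat 0 (1\<^sub>m 0)" by (auto simp: unitary_mat_def)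
  moreover have "A = udiag 0 (1\<^sub>m 0) (\<lambda>_. 0)"
    using 0 by (intro eq_matI) auto
  ultimately show ?case by blast
next
  case (Suc m)
  note A = Suc.prems(1)
  have Aa: "mat_adjoint A \<in> carrier_mat (Suc m) (Suc m)" using A by simp
  obtain e where "eigenvalue A e"
    using spectrum_non_empty[OF A] by (auto simp: spectrum_def)
  then obtain v where "eigenvector A v e" by (auto simp: eigenvalue_def)
  then have v: "v \<in> carrier_vec (Suc m)" "v \<noteq> 0\<^sub>v (Suc m)" "A *\<^sub>v v = e \<cdot>\<^sub>v v"
    using A by (auto simp: eigenvector_def)
  obtain W where W: "unitary_mat (Suc m) W" "\<And>i. i < Suc m \<Longrightarrow> W $$ (i, 0) = v $ i / cvec_norm v"
    using unitary_with_first_column[OF v(1,2)] by metis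
  note Wc = unitary_matD[OF W(1)]
  define B where "B = mat_adjoint W * A * W"
  have WW: "unitary_mat (Suc m) (mat_adjoint W)" by (rule unitary_adjoint[OF W(1)])
  have Bdef: "B = mat_adjoint W * A * mat_adjoint (mat_adjoint W)"
    unfolding B_def by (simp add: mat_adjoint_adjoint[OF Wc(1)])
  have AW: "A * W \<in> carrier_mat (Suc m) (Suc m)" using A Wc by auto
  have WA: "mat_adjoint W * A \<in> carrier_mat (Suc m) (Suc m)" using A Wc by auto
  have B: "B \<in> carrier_mat (Suc m) (Suc m)" unfolding B_def using mult_carrier_mat[OF WA Wc(1)] .
  have Ba: "mat_adjoint B = mat_adjoint W * mat_adjoint A * mat_adjoint (mat_adjoint W)"
    unfolding B_def mat_adjoint_mult[OF WA Wc(1)] mat_adjoint_mult[OF Wc(2) A]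
    unfolding mat_adjoint_adjoint[OF Wc(1)] by (rule assoc_mult_mat[symmetric, OF Wc(2) Aa Wc(1)])
  have "B * mat_adjoint B = mat_adjoint W * (A * mat_adjoint A) * mat_adjoint (mat_adjoint W)"
    unfolding Bdef[symmetric] Ba unfolding Bdef by (rule unitary_conj_mult[OF WW A Aa])
  also have "\<dots> = mat_adjoint W * (mat_adjoint A * A) * mat_adjoint (mat_adjoint W)"
    using Suc.prems by simp
  also have "\<dots> = mat_adjoint B * B"
    unfolding Ba unfolding Bdef by (rule unitary_conj_mult[OF WW Aa A, symmetric])
  finally have Bn: "B * mat_adjoint B = mat_adjoint B * B" .
  have AWcol: "(A * W) $$ (l, 0) = e * W $$ (l, 0)" if "l < Suc m" for l
  proof -
    have "(A * W) $$ (l, 0) = (\<Sum>j<Suc m. A $$ (l, j) * v $ j) / cvec_norm v"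
      unfolding index_mult_mat_sum[OF A Wc(1) that zero_less_Suc] sum_divide_distrib using W(2) by (intro sum.cong) auto
    also have "(\<Sum>j<Suc m. A $$ (l, j) * v $ j) = e * v $ l"
      unfolding index_mult_mat_vec_sum[OF A v(1) that, symmetric] v(3) using v that by simp
    finally show ?thesis using W(2)[OF that] by simp
  qed
  \<comment> \<open>The first column of \<open>W\<close> is an eigenvector, so the first column of
    \<open>B\<close> is \<open>e\<close> times the first column of the identity.\<close>
  have Bcol: "B $$ (Suc i, 0) = 0" if "i < m" for i
  proof -
    have si: "Suc i < Suc m" using that by simp
    have "B = mat_adjoint W * (A * W)" unfolding B_def by (rule assoc_mult_mat[OF Wc(2) A Wc(1)])
    then have "B $$ (Suc i, 0) = (\<Sum>l<Suc m. mat_adjoint W $$ (Suc i, l) * (e * W $$ (l, 0)))"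
      unfolding index_mult_mat_sum[OF Wc(2) AW si zero_less_Suc] 

      using AWcol by (simp only: index_mult_mat_sum[OF Wc(2) AW si zero_less_Suc]) (intro sum.cong, auto simp del: index_mult_mat)
    also have "\<dots> = e * (mat_adjoint W * W) $$ (Suc i, 0)"
      unfolding index_mult_mat_sum[OF Wc(2) Wc(1) si zero_less_Suc] sum_distrib_left by (simp add: mult_ac del: sum.lessThan_Suc)
    finally show ?thesis unfolding Wc(3) using si by simp
  qed
  define C where "C = Matrix.mat m m (\<lambda>(i, j). B $$ (Suc i, Suc j))"
  have C: "C \<in> carrier_mat m m" by (simp add: C_def)
  note nb = normal_block[OF B Bn Bcol]
  obtain U d where U: "unitary_mat m U" "C = udiag m U d"
    using Suc.IH[OF C] nb(2) unfolding Let_def C_def[symmetric] by blast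
  note Uc = unitary_matD[OF U(1)]
  \<comment> \<open>\<open>V\<close> is the block sum of the number 1 and \<open>U\<close>;
    \<open>d'\<close> puts the split-off entry of \<open>B\<close> in front of
    \<open>d\<close>.\<close>
  define V where "V = Matrix.mat (Suc m) (Suc m) (\<lambda>(i, j). case i of 0 \<Rightarrow> (case j of 0 \<Rightarrow> 1 | Suc _ \<Rightarrow> 0)
      | Suc i' \<Rightarrow> (case j of 0 \<Rightarrow> 0 | Suc j' \<Rightarrow> U $$ (i', j')))"
  define d' where "d' i = (case i of 0 \<Rightarrow> B $$ (0, 0) | Suc i' \<Rightarrow> d i')" for i
  have Vc: "V \<in> carrier_mat (Suc m) (Suc m)" by (simp add: V_def)
  have Vu: "unitary_mat (Suc m) V"
  proof (rule unitary_matI[OF Vc])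
    fix i j assume ij: "i < Suc m" "j < Suc m"
    have "(\<Sum>l<m. cnj (U $$ (l, i')) * U $$ (l, j')) = (if i' = j' then 1 else 0)" if "i' < m" "j' < m" for i' j'
    proof -
      have "(mat_adjoint U * U) $$ (i', j') = (if i' = j' then 1 else 0)" using Uc that by simp
      then show ?thesis unfolding index_mult_mat_sum[OF Uc(2,1) that]
        using that by (simp add: mat_adjoint_index[OF Uc(1)])
    qed
    then show "(\<Sum>l<Suc m. cnj (V $$ (l, i)) * V $$ (l, j)) = (if i = j then 1 else 0)"
      using ij unfolding sum.lessThan_Suc_shift by (cases i; cases j) (simp_all add: V_def del: sum.lessThan_Suc)
  qed
  have "B = udiag (Suc m) V d'"
  proof (rule eq_matI)
    fix i j assume "i < dim_row (udiag (Suc m) V d')" "j < dim_col (udiag (Suc m) V d')"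
    then have ij: "i < Suc m" "j < Suc m" using Vc by auto
    have "B $$ (Suc i', Suc j') = (\<Sum>l<m. U $$ (i', l) * d l * cnj (U $$ (j', l)))" if "i' < m" "j' < m" for i' j'
    proof -
      have "B $$ (Suc i', Suc j') = C $$ (i', j')" using that by (simp add: C_def)
      then show ?thesis unfolding U(2) udiag_index[OF Uc(1) that] .
    qed
    then show "B $$ (i, j) = udiag (Suc m) V d' $$ (i, j)"
      using ij Bcol nb(1) unfolding udiag_index[OF Vc ij] sum.lessThan_Suc_shift
      by (cases i; cases j) (simp_all add: V_def d'_def del: sum.lessThan_Suc)
  qed (use B Vc in auto)
  have "W * B * mat_adjoint W = A"
  proof -
    have "W * B * mat_adjoint W = W * (mat_adjoint W * (A * W)) * mat_adjoint W"
      unfolding B_def assoc_mult_mat[OF Wc(2) A Wc(1)] ..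
    also have "W * (mat_adjoint W * (A * W)) = A * W"
      unfolding assoc_mult_mat[OF Wc(1) Wc(2) AW, symmetric] Wc(4) by (rule left_mult_one_mat[OF AW])
    also have "A * W * mat_adjoint W = A"
      unfolding assoc_mult_mat[OF A Wc(1) Wc(2)] Wc(4) by (rule right_mult_one_mat[OF A])
    finally show ?thesis .
  qed
  then have "A = udiag (Suc m) (W * V) d'"
    unfolding \<open>B = udiag (Suc m) V d'\<close> udiag_conj[OF W(1) Vu] by simp
  then show ?case using unitary_mat_mult[OF W(1) Vu] by blast
qed

section \<open>Size of a normal matrix in terms of its eigenvalues; matrix functions\<close>

lemma op_bound_unitary: "unitary_mat n U \<Longrightarrow> op_bound n 1 U"
  by (rule op_bound_isometry) (auto dest: unitary_matD)

lemma unitary_cvec_norm: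
  assumes "unitary_mat n U" "v \<in> carrier_vec n"
  shows "cvec_norm (U *\<^sub>v v) = cvec_norm v"
proof (rule antisym)
  note U = unitary_matD[OF assms(1)]
  show "cvec_norm (U *\<^sub>v v) \<le> cvec_norm v"
    using op_boundD(3)[OF op_bound_unitary[OF assms(1)] assms(2)] by simp
  have "mat_adjoint U *\<^sub>v (U *\<^sub>v v) = v"
    unfolding assoc_mult_mat_vec[OF U(2) U(1) assms(2), symmetric] U(3) by (rule one_mult_mat_vec[OF assms(2)])
  then show "cvec_norm v \<le> cvec_norm (U *\<^sub>v v)"
    using op_boundD(3)[OF op_bound_unitary[OF unitary_adjoint[OF assms(1)]], of "U *\<^sub>v v"] U(1) assms(2) by simp
qed

lemma mat_diag_carrier_dim [simp]: "dim_row (mat_diag n d) = n" "dim_col (mat_diag n d) = n"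
  by (simp_all add: mat_diag_def)

text \<open>Entries above \<beta> occupy few columns and form the low-rank part; the remaining ones
  form a diagonal matrix of norm at most \<beta>.\<close>

lemma mat_split_diag:
  assumes "finite {i. i < n \<and> cmod (d i) > \<beta>}" "0 \<le> \<beta>"
    and card: "real (card {i. i < n \<and> cmod (d i) > \<beta>}) \<le> \<alpha> * real n"
  shows "mat_split n \<alpha> \<beta> (mat_diag n d)"
proof (rule mat_splitI)
  show "lowrank n (\<alpha> * real n) (mat_diag n (\<lambda>i. if cmod (d i) > \<beta> then d i else 0))"
    by (rule lowrank_columns[OF _ assms(1) _ card]) (auto simp: mat_diag_def)
  show "op_bound n \<beta> (mat_diag n (\<lambda>i. if cmod (d i) > \<beta> then 0 else d i))"
    by (rule op_bound_partial_perm[where k = 0]) (use assms in \<open>auto simp: mat_diag_def\<close>)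
qed (auto simp: mat_diag_def)

lemma mat_split_udiag:
  assumes U: "unitary_mat n U" and "0 \<le> \<beta>"
    and card: "real (card {i. i < n \<and> cmod (d i) > \<beta>}) \<le> \<alpha> * real n"
  shows "mat_split n \<alpha> \<beta> (udiag n U d)"
proof -
  have "mat_split n (0 + \<alpha> + 0) (1 * \<beta> * 1) (udiag n U d)"
    unfolding udiag_def
    by (intro mat_split_mult mat_split_diag mat_split_op_bound op_bound_unitary unitary_adjoint) (use assms in auto)
  then show ?thesis by simp
qed

text \<open>Converse of \<open>mat_split_udiag\<close>. If the number of eigenvalues above \<beta>
  exceeded the length \<open>k\<close> of the factorization of \<open>R\<close>, the span of their
  eigenvectors would contain a nonzero \<open>v\<close> with Rv = 0. On \<open>v\<close> the matrix
  acts as \<open>N\<close> and stretches by at most \<beta>, whereas on that span it stretches by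
  strictly more.\<close>

lemma mat_split_udiag_card:
  assumes U: "unitary_mat n U" and split: "mat_split n \<alpha> \<beta> (udiag n U d)"
  shows "real (card {i. i < n \<and> cmod (d i) > \<beta>}) \<le> \<alpha> * real n"
proof -
  define J where "J = {i. i < n \<and> cmod (d i) > \<beta>}"
  note Uc = unitary_matD[OF U]
  obtain R N where RN: "lowrank n (\<alpha> * real n) R" "op_bound n \<beta> N" "udiag n U d = R + N"
    using split by (auto simp: mat_split_def)
  obtain k p q where R: "R \<in> carrier_mat n n" "real k \<le> \<alpha> * real n"
    and fac: "\<And>i j. i < n \<Longrightarrow> j < n \<Longrightarrow> R $$ (i, j) = (\<Sum>t<k. p t i * q t j)"
    using RN(1) unfolding lowrank_def by blast
  note N = op_boundD[OF RN(2)]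
  have J: "finite J" by (simp add: J_def)
  have "card J \<le> k"
  proof (rule ccontr)
    assume "\<not> card J \<le> k"
    then have "card {..<k} < card J" by simp
    \<comment> \<open>The unknowns are the coordinates of \<open>v\<close> along the eigenvectors
      with index in \<open>J\<close>; equation \<open>t\<close> says that the row factor
      \<open>q t\<close> of \<open>R\<close> annihilates \<open>v\<close>.\<close>
    from homogeneous_system_nontrivial[OF _ J this, of "\<lambda>t j. \<Sum>m<n. q t m * U $$ (m, j)"]
    obtain c j0 where c: "j0 \<in> J" "c j0 \<noteq> 0"
      "\<And>t. t < k \<Longrightarrow> (\<Sum>j\<in>J. (\<Sum>m<n. q t m * U $$ (m, j)) * c j) = 0" by auto
    define x where "x = Matrix.vec n (\<lambda>j. if j \<in> J then c j else 0)"
    define v where "v = U *\<^sub>v x"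
    have x: "x \<in> carrier_vec n" by (simp add: x_def)
    have v: "v \<in> carrier_vec n" using x Uc by (auto simp: v_def)
    have vi: "v $ m = (\<Sum>j\<in>J. U $$ (m, j) * c j)" if "m < n" for m
      unfolding v_def index_mult_mat_vec_sum[OF Uc(1) x that]
      by (intro sum.mono_neutral_cong_right) (auto simp: x_def J_def)
    have qv: "(\<Sum>m<n. q t m * v $ m) = 0" if "t < k" for t
    proof -
      have "(\<Sum>m<n. q t m * v $ m) = (\<Sum>m<n. \<Sum>j\<in>J. q t m * U $$ (m, j) * c j)"
        using vi by (intro sum.cong) (auto simp: sum_distrib_left mult.assoc)
      also have "\<dots> = (\<Sum>j\<in>J. \<Sum>m<n. q t m * U $$ (m, j) * c j)" by (rule sum.swap)
      finally show ?thesis using c(3)[OF that] by (simp add: sum_distrib_right)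
    qed
    have Rv: "R *\<^sub>v v = 0\<^sub>v n"
    proof (rule eq_vecI)
      fix i assume "i < dim_vec (0\<^sub>v n :: complex vec)"
      then have i: "i < n" by simp
      have "(R *\<^sub>v v) $ i = (\<Sum>m<n. \<Sum>t<k. p t i * (q t m * v $ m))"
        unfolding index_mult_mat_vec_sum[OF R(1) v i] using i
        by (intro sum.cong) (auto simp: fac sum_distrib_right mult.assoc)
      also have "\<dots> = (\<Sum>t<k. \<Sum>m<n. p t i * (q t m * v $ m))" by (rule sum.swap)
      also have "\<dots> = 0" using qv by (simp flip: sum_distrib_left)
      finally show "(R *\<^sub>v v) $ i = 0\<^sub>v n $ i" using i by simp
    qed (use R in auto)
    have "(R + N) *\<^sub>v v = N *\<^sub>v v"
      unfolding add_mult_distrib_mat_vec[OF R(1) N(1) v] Rv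
      by (rule left_zero_vec) (rule mult_mat_vec_carrier[OF N(1) v])
    then have "cvec_norm (udiag n U d *\<^sub>v v) \<le> \<beta> * cvec_norm v"
      using N(3)[OF v] by (simp add: RN(3))
    also have "cvec_norm v = cvec_norm x"
      unfolding v_def by (rule unitary_cvec_norm[OF U x])
    also have "udiag n U d *\<^sub>v v = U *\<^sub>v (mat_diag n d *\<^sub>v x)"
    proof -
      have d: "mat_diag n d \<in> carrier_mat n n" by simp
      have "mat_adjoint U *\<^sub>v v = x"
        unfolding v_def assoc_mult_mat_vec[OF Uc(2) Uc(1) x, symmetric] Uc(3) by (rule one_mult_mat_vec[OF x])
      then have "udiag n U d *\<^sub>v v = (U * mat_diag n d) *\<^sub>v x"
        unfolding udiag_def assoc_mult_mat_vec[OF mult_carrier_mat[OF Uc(1) d] Uc(2) v] by simp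
      then show ?thesis unfolding assoc_mult_mat_vec[OF Uc(1) d x] .
    qed
    also have "cvec_norm \<dots> = cvec_norm (mat_diag n d *\<^sub>v x)"
      by (rule unitary_cvec_norm[OF U]) (rule mult_mat_vec_carrier[OF mat_diag_dim x])
    finally have le: "cvec_norm (mat_diag n d *\<^sub>v x) \<le> \<beta> * cvec_norm x" .
    have dx: "(mat_diag n d *\<^sub>v x) $ i = d i * x $ i" if "i < n" for i
      unfolding index_mult_mat_vec_sum[OF mat_diag_dim x that] using that
      by (simp add: mat_diag_def if_distrib[of "\<lambda>z. z * _"] cong: if_cong)
    have dxc: "mat_diag n d *\<^sub>v x \<in> carrier_vec n" by (rule mult_mat_vec_carrier[OF mat_diag_dim x])
    have sq: "(cvec_norm (mat_diag n d *\<^sub>v x))\<^sup>2 = (\<Sum>i<n. (cmod (d i) * cmod (x $ i))\<^sup>2)"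
      using dx by (simp add: cvec_norm_carrier[OF dxc] L2_set_def sum_nonneg norm_mult del: index_mult_mat_vec)
    have sqx: "(\<beta> * cvec_norm x)\<^sup>2 = (\<Sum>i<n. (\<beta> * cmod (x $ i))\<^sup>2)"
      by (simp add: cvec_norm_carrier[OF x] L2_set_def sum_nonneg power_mult_distrib sum_distrib_left)
    \<comment> \<open>Coordinates outside \<open>J\<close> are zero and contribute nothing to either
      side; strictness comes from \<open>j0\<close>, whose coordinate is nonzero.\<close>
    have "(\<Sum>i<n. (\<beta> * cmod (x $ i))\<^sup>2) < (\<Sum>i<n. (cmod (d i) * cmod (x $ i))\<^sup>2)"
    proof (rule sum_strict_mono_ex1)
      show "\<forall>i\<in>{..<n}. (\<beta> * cmod (x $ i))\<^sup>2 \<le> (cmod (d i) * cmod (x $ i))\<^sup>2"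
        using N(2) by (auto simp: x_def J_def intro!: power_mono mult_right_mono)
      have "\<beta> * cmod (x $ j0) < cmod (d j0) * cmod (x $ j0)"
        using c(1,2) by (auto simp: x_def J_def)
      then have "(\<beta> * cmod (x $ j0))\<^sup>2 < (cmod (d j0) * cmod (x $ j0))\<^sup>2"
        using N(2) by (intro power_strict_mono) auto
      then show "\<exists>i\<in>{..<n}. (\<beta> * cmod (x $ i))\<^sup>2 < (cmod (d i) * cmod (x $ i))\<^sup>2"
        using c(1) by (auto simp: J_def)
    qed simp
    then have "(\<beta> * cvec_norm x)\<^sup>2 < (cvec_norm (mat_diag n d *\<^sub>v x))\<^sup>2"
      unfolding sq sqx .
    then show False using le power_mono[OF le] by (simp add: not_le[symmetric])
  qed
  then show ?thesis using R(2) by (simp add: J_def)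
qed

text \<open>\<open>mat_fun\<close> is a definite description ranging over all diagonalizations, also
  nonunitary ones, so every other choice of \<open>X\<close> and \<open>l\<close> has to give the
  same matrix. The change of basis \<open>Z\<close> intertwines the diagonal matrices of
  \<open>d\<close> and \<open>l\<close>, hence also their images under \<open>f\<close>.\<close>

lemma mat_fun_udiag:
  assumes U: "unitary_mat n U"
  shows "mat_fun f (udiag n U d) = udiag n U (\<lambda>i. f (d i))"
proof -
  note Uc = unitary_matD[OF U]
  have dim: "dim_row (udiag n U d) = n" using Uc by auto
  have wit: "similar_mat_wit (udiag n U d) (mat_diag n d) U (mat_adjoint U)"
    unfolding similar_mat_wit_def Let_def dim using Uc by (auto simp: udiag_def intro: udiag_carrier[unfolded udiag_def])
  show ?thesis
    unfolding mat_fun_def dim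
  proof (rule the_equality)
    show "\<exists>X Y l. similar_mat_wit (udiag n U d) (mat_diag n l) X Y \<and>
        udiag n U (\<lambda>i. f (d i)) = X * mat_diag n (\<lambda>i. f (l i)) * Y"
      using wit unfolding udiag_def by blast
    fix B assume "\<exists>X Y l. similar_mat_wit (udiag n U d) (mat_diag n l) X Y \<and> B = X * mat_diag n (\<lambda>i. f (l i)) * Y"
    then obtain X Y l where XY: "similar_mat_wit (udiag n U d) (mat_diag n l) X Y"
      and B: "B = X * mat_diag n (\<lambda>i. f (l i)) * Y" by blast
    note w = similar_mat_witD2[OF udiag_carrier[OF Uc(1)] XY]
    have X: "X \<in> carrier_mat n n" and Y: "Y \<in> carrier_mat n n" and XYone: "X * Y = 1\<^sub>m n" and YX: "Y * X = 1\<^sub>m n"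
      and eq: "udiag n U d = X * mat_diag n l * Y" using w by blast+
    define Z where "Z = mat_adjoint U * X"
    have Z: "Z \<in> carrier_mat n n" using Uc X by (auto simp: Z_def)
    have UZ: "U * Z = X" unfolding Z_def assoc_mult_mat[OF Uc(1,2) X, symmetric] Uc(4) by (rule left_mult_one_mat[OF X])
    have UUX: "mat_adjoint U * (U * M) = M" if "M \<in> carrier_mat n n" for M
      unfolding assoc_mult_mat[OF Uc(2,1) that, symmetric] Uc(3) by (rule left_mult_one_mat[OF that])
    have intertwine: "mat_diag n d * Z = Z * mat_diag n l"
    proof -
      have dU: "mat_diag n d * mat_adjoint U \<in> carrier_mat n n" using Uc by (auto intro: mult_carrier_mat)
      have lX: "X * mat_diag n l \<in> carrier_mat n n" using X by (auto intro: mult_carrier_mat)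
      have "udiag n U d * X = X * mat_diag n l"
        unfolding eq assoc_mult_mat[OF lX Y X] YX by (rule right_mult_one_mat[OF lX])
      moreover have "udiag n U d * X = U * (mat_diag n d * Z)"
        unfolding udiag_def Z_def assoc_mult_mat[OF Uc(1) mat_diag_dim Uc(2)] assoc_mult_mat[OF Uc(1) dU X]
          assoc_mult_mat[OF mat_diag_dim Uc(2) X] ..
      ultimately have "U * (mat_diag n d * Z) = X * mat_diag n l" by simp
      then have "mat_adjoint U * (U * (mat_diag n d * Z)) = mat_adjoint U * (X * mat_diag n l)" by simp
      then show ?thesis
        unfolding UUX[OF mult_carrier_mat[OF mat_diag_dim Z]] unfolding Z_def assoc_mult_mat[OF Uc(2) X mat_diag_dim] .
    qed
    have "mat_diag n (\<lambda>i. f (d i)) * Z = Z * mat_diag n (\<lambda>i. f (l i))"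
    proof (rule eq_matI)
      fix i j assume "i < dim_row (Z * mat_diag n (\<lambda>i. f (l i)))" "j < dim_col (Z * mat_diag n (\<lambda>i. f (l i)))"
      then have ij: "i < n" "j < n" using Z by auto
      have "(mat_diag n d * Z) $$ (i, j) = (Z * mat_diag n l) $$ (i, j)" using intertwine by simp
      then have "d i * Z $$ (i, j) = Z $$ (i, j) * l j"
        using ij unfolding mat_diag_mult_left[OF Z] mat_diag_mult_right[OF Z] by simp
      \<comment> \<open>A nonzero entry of \<open>Z\<close> forces \<open>d i\<close> and
        \<open>l j\<close> to be equal.\<close>
      then have "f (d i) * Z $$ (i, j) = Z $$ (i, j) * f (l j)" by (cases "Z $$ (i, j) = 0") auto
      then show "(mat_diag n (\<lambda>i. f (d i)) * Z) $$ (i, j) = (Z * mat_diag n (\<lambda>i. f (l i))) $$ (i, j)"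
        using ij unfolding mat_diag_mult_left[OF Z] mat_diag_mult_right[OF Z] by simp
    qed (use Z in auto)
    then have "X * mat_diag n (\<lambda>i. f (l i)) = U * (mat_diag n (\<lambda>i. f (d i)) * Z)"
      unfolding UZ[symmetric] assoc_mult_mat[OF Uc(1) Z mat_diag_dim] by simp
    also have "\<dots> = U * mat_diag n (\<lambda>i. f (d i)) * Z" by (rule assoc_mult_mat[OF Uc(1) mat_diag_dim Z, symmetric])
    finally have "B = U * mat_diag n (\<lambda>i. f (d i)) * Z * Y" unfolding B by simp
    also have "\<dots> = U * mat_diag n (\<lambda>i. f (d i)) * (Z * Y)"
      by (rule assoc_mult_mat[OF mult_carrier_mat[OF Uc(1) mat_diag_dim] Z Y])
    also have "Z * Y = mat_adjoint U"
      unfolding Z_def assoc_mult_mat[OF Uc(2) X Y] XYone by (rule right_mult_one_mat[OF Uc(2)])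
    finally show "B = udiag n U (\<lambda>i. f (d i))" by (simp add: udiag_def)
  qed
qed

section \<open>Simultaneous approximation of matrix-sequences and symbols\<close>

text \<open>The points of size above \<beta> are only required to lie in a measurable set
  \<open>E\<close> of small measure. Sums and products are then handled by unions of exceptional
  sets, and measurability of the symbol itself enters only on the return to
  \<open>glt\<close>.\<close>

definition symbol_split :: "real \<Rightarrow> real \<Rightarrow> (real \<times> real \<Rightarrow> complex) \<Rightarrow> bool" where
  "symbol_split \<alpha> \<beta> \<phi> \<longleftrightarrow> 0 \<le> \<alpha> \<and> 0 \<le> \<beta> \<and> (\<exists>E\<in>sets lebesgue. emeasure lebesgue E \<le> ennreal \<alpha> \<and>
     (\<forall>z\<in>{0..1} \<times> {-pi..pi} - E. cmod (\<phi> z) \<le> \<beta>))"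

lemma symbol_split_mono: "symbol_split \<alpha> \<beta> \<phi> \<Longrightarrow> \<alpha> \<le> \<alpha>' \<Longrightarrow> \<beta> \<le> \<beta>' \<Longrightarrow> symbol_split \<alpha>' \<beta>' \<phi>"
  unfolding symbol_split_def by (meson ennreal_leI order_trans)

text \<open>Common core of sums and products: outside the union of the two exceptional sets both
  pointwise bounds hold.\<close>

lemma symbol_split_combine:
  assumes "symbol_split \<alpha> \<beta> \<phi>" "symbol_split \<alpha>' \<beta>' \<psi>" "0 \<le> \<gamma>"
    and "\<And>z. cmod (\<phi> z) \<le> \<beta> \<Longrightarrow> cmod (\<psi> z) \<le> \<beta>' \<Longrightarrow> cmod (\<chi> z) \<le> \<gamma>"
  shows "symbol_split (\<alpha> + \<alpha>') \<gamma> \<chi>"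
proof -
  obtain E where E: "0 \<le> \<alpha>" "E \<in> sets lebesgue" "emeasure lebesgue E \<le> ennreal \<alpha>"
    "\<forall>z\<in>{0..1} \<times> {-pi..pi} - E. cmod (\<phi> z) \<le> \<beta>" using assms(1) by (auto simp: symbol_split_def)
  obtain F where F: "0 \<le> \<alpha>'" "F \<in> sets lebesgue" "emeasure lebesgue F \<le> ennreal \<alpha>'"
    "\<forall>z\<in>{0..1} \<times> {-pi..pi} - F. cmod (\<psi> z) \<le> \<beta>'" using assms(2) by (auto simp: symbol_split_def)
  have "emeasure lebesgue (E \<union> F) \<le> ennreal (\<alpha> + \<alpha>')"
    using emeasure_subadditive[OF E(2) F(2)] add_mono[OF E(3) F(3)] E(1) F(1)
    by (simp add: ennreal_plus)
  then show ?thesis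
    unfolding symbol_split_def using E F assms(3,4) by (intro conjI bexI[of _ "E \<union> F"]) auto
qed

lemma symbol_split_add:
  assumes "symbol_split \<alpha> \<beta> \<phi>" "symbol_split \<alpha>' \<beta>' \<psi>"
  shows "symbol_split (\<alpha> + \<alpha>') (\<beta> + \<beta>') (\<lambda>z. \<phi> z + \<psi> z)"
  by (rule symbol_split_combine[OF assms]) (use assms norm_triangle_mono in \<open>auto simp: symbol_split_def\<close>)

lemma symbol_split_mult:
  assumes "symbol_split \<alpha> \<beta> \<phi>" "symbol_split \<alpha>' \<beta>' \<psi>"
  shows "symbol_split (\<alpha> + \<alpha>') (\<beta> * \<beta>') (\<lambda>z. \<phi> z * \<psi> z)"
  by (rule symbol_split_combine[OF assms]) (use assms in \<open>auto simp: symbol_split_def norm_mult intro!: mult_mono\<close>)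

lemma symbol_split_cnj: "symbol_split \<alpha> \<beta> (\<lambda>z. cnj (\<phi> z)) \<longleftrightarrow> symbol_split \<alpha> \<beta> \<phi>"
  by (simp add: symbol_split_def)

lemma symbol_split_bounded:
  assumes "0 \<le> \<alpha>" "0 \<le> \<beta>" "\<And>x \<theta>. x \<in> {0..1} \<Longrightarrow> \<theta> \<in> {-pi..pi} \<Longrightarrow> cmod (\<phi> (x, \<theta>)) \<le> \<beta>"
  shows "symbol_split \<alpha> \<beta> \<phi>"
  unfolding symbol_split_def using assms by (intro conjI bexI[of _ "{}"]) auto

text \<open>The same size condition is imposed on a matrix-sequence, where rank relative to dimension plays
  the role of measure, and on a symbol, so that sequences and symbols can be approximated in parallel.\<close>

definition pair_split :: "real \<Rightarrow> real \<Rightarrow> (nat \<Rightarrow> complex mat) \<Rightarrow> (real \<times> real \<Rightarrow> complex) \<Rightarrow> bool" where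
  "pair_split \<alpha> \<beta> X \<phi> \<longleftrightarrow> eventually (\<lambda>n. mat_split n \<alpha> \<beta> (X n)) sequentially \<and> symbol_split \<alpha> \<beta> \<phi>"

lemma pair_split_nonneg: "pair_split \<alpha> \<beta> X \<phi> \<Longrightarrow> 0 \<le> \<alpha> \<and> 0 \<le> \<beta>"
  by (simp add: pair_split_def symbol_split_def)

lemma pair_split_mono: "pair_split \<alpha> \<beta> X \<phi> \<Longrightarrow> \<alpha> \<le> \<alpha>' \<Longrightarrow> \<beta> \<le> \<beta>' \<Longrightarrow> pair_split \<alpha>' \<beta>' X \<phi>"
  unfolding pair_split_def by (auto elim!: eventually_mono symbol_split_mono mat_split_mono)

lemma pair_split_add:
  assumes "pair_split \<alpha> \<beta> X \<phi>" "pair_split \<alpha>' \<beta>' Y \<psi>"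
  shows "pair_split (\<alpha> + \<alpha>') (\<beta> + \<beta>') (\<lambda>n. X n + Y n) (\<lambda>z. \<phi> z + \<psi> z)"
  using assms unfolding pair_split_def by (auto elim: eventually_elim2 intro: mat_split_add symbol_split_add)

lemma pair_split_mult:
  assumes "pair_split \<alpha> \<beta> X \<phi>" "pair_split \<alpha>' \<beta>' Y \<psi>"
  shows "pair_split (\<alpha> + \<alpha>') (\<beta> * \<beta>') (\<lambda>n. X n * Y n) (\<lambda>z. \<phi> z * \<psi> z)"
  using assms unfolding pair_split_def by (auto elim: eventually_elim2 intro: mat_split_mult symbol_split_mult)

lemma pair_split_adjoint:
  assumes "pair_split \<alpha> \<beta> X \<phi>"
  shows "pair_split \<alpha> \<beta> (\<lambda>n. mat_adjoint (X n)) (\<lambda>z. cnj (\<phi> z))"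
  using assms unfolding pair_split_def by (auto elim: eventually_mono intro: mat_split_adjoint simp: symbol_split_cnj)

lemma matrix_seqD: "matrix_seq A \<Longrightarrow> A n \<in> carrier_mat n n"
  by (simp add: matrix_seq_def)

section \<open>Weighted shifts and their finite sums\<close>

definition trig :: "int \<Rightarrow> real \<Rightarrow> complex" where
  "trig k \<theta> = exp (\<i> * of_int k * of_real \<theta>)"

lemma norm_trig [simp]: "cmod (trig k \<theta>) = 1"
  by (simp add: trig_def)

lemma trig_add: "trig (k + l) \<theta> = trig k \<theta> * trig l \<theta>"
  by (simp add: trig_def algebra_simps exp_add)

lemma trig_uminus: "trig (- k) \<theta> = cnj (trig k \<theta>)"
  by (simp add: trig_def exp_cnj)

lemma trig_0 [simp]: "trig 0 \<theta> = 1"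
  by (simp add: trig_def)

lemma continuous_on_trig [continuous_intros]: "continuous_on S (trig k)"
  unfolding trig_def by (intro continuous_intros)

lemma integrable_trig: "integrable (lebesgue_on {-pi..pi}) (trig k)"
  by (rule continuous_imp_integrable_real) (intro continuous_intros)

lemma integral_trig: "(\<integral>\<theta>. trig k \<theta> \<partial>lebesgue_on {-pi..pi}) = (if k = 0 then 2 * pi else 0)"
proof (cases "k = 0")
  case True
  then show ?thesis by (simp add: trig_def[abs_def] measure_restrict_space scaleR_conv_of_real)
next
  case False
  let ?F = "\<lambda>\<theta>. trig k \<theta> / (\<i> * of_int k)"
  have "(trig k has_integral (?F pi - ?F (-pi))) {-pi..pi}"
  proof (rule fundamental_theorem_of_calculus)
    fix x assume "x \<in> {-pi..pi}"
    have "((\<lambda>z. exp (\<i> * of_int k * z) / (\<i> * of_int k)) has_field_derivative exp (\<i> * of_int k * of_real x))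
        (at (complex_of_real x))"
      using False by (auto intro!: derivative_eq_intros)
    from has_vector_derivative_real_field[OF this]
    show "(?F has_vector_derivative trig k x) (at x within {-pi..pi})"
      by (simp add: trig_def has_vector_derivative_at_within)
  qed simp
  moreover have "trig k pi = trig k (-pi)"
  proof -
    \<comment> \<open>The two exponents differ by \<open>k\<close> full periods of the exponential
      function, hence the witness.\<close>
    show ?thesis
      unfolding trig_def exp_eq by (rule exI[of _ k]) (simp add: algebra_simps)
  qed
  ultimately have "(trig k has_integral 0) {-pi..pi}" by simp
  then show ?thesis
    using False lebesgue_integral_eq_integral[OF integrable_trig] by (simp add: integral_unique)
qed

lemma fourier_coeff_trig: "fourier_coeff (trig k) l = (if k = l then 1 else 0)"
proof -
  have "trig k \<theta> * exp (- \<i> * of_int l * of_real \<theta>) = trig (k - l) \<theta>" for \<theta>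
    by (simp add: trig_def mult_exp_exp algebra_simps)
  then show ?thesis by (simp add: fourier_coeff_def integral_trig)
qed

lemma toeplitz_carrier [simp]: "toeplitz n g \<in> carrier_mat n n"
  by (simp add: toeplitz_def)

lemma diag_sampling_carrier [simp]: "diag_sampling n a \<in> carrier_mat n n"
  by (simp add: diag_sampling_def)

text \<open>The Toeplitz matrix of \<open>trig k\<close> is the shift with ones on the diagonal i -
  j = k. So this is a weighted shift, whose norm, adjoint and products can be read off from its
  entries.\<close>

definition basic_seq :: "(real \<Rightarrow> complex) \<Rightarrow> int \<Rightarrow> nat \<Rightarrow> complex mat" where
  "basic_seq a k n = diag_sampling n a * toeplitz n (trig k)"

lemma basic_seq_carrier [simp]: "basic_seq a k n \<in> carrier_mat n n"
  unfolding basic_seq_def by (rule mult_carrier_mat[OF diag_sampling_carrier toeplitz_carrier])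

lemma dim_basic_seq [simp]: "dim_row (basic_seq a k n) = n" "dim_col (basic_seq a k n) = n"
  using basic_seq_carrier[of a k n] by (auto simp del: basic_seq_carrier)

lemma basic_seq_index:
  assumes "i < n" "j < n"
  shows "basic_seq a k n $$ (i, j) = (if int i - int j = k then a (real (i + 1) / real n) else 0)"
  unfolding basic_seq_def diag_sampling_def mat_diag_mult_left[OF toeplitz_carrier]
  using assms by (auto simp: toeplitz_def fourier_coeff_trig)

text \<open>Sequence and symbol are generated in parallel as a relation, so the symbol does not have
  to be shown to be determined by the sequence. The weights are continuous on a compact interval,
  hence bounded and uniformly continuous; both facts are used.\<close>

inductive basic_sum :: "(nat \<Rightarrow> complex mat) \<Rightarrow> (real \<times> real \<Rightarrow> complex) \<Rightarrow> bool" where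
  basic_sum_zero: "basic_sum (\<lambda>n. 0\<^sub>m n n) (\<lambda>_. 0)"
| basic_sum_step: "basic_sum S s \<Longrightarrow> continuous_on {0..1} a \<Longrightarrow>
    basic_sum (\<lambda>n. S n + basic_seq a k n) (\<lambda>z. s z + a (fst z) * trig k (snd z))"

lemma basic_sum_carrier: "basic_sum S s \<Longrightarrow> S n \<in> carrier_mat n n"
  by (induction rule: basic_sum.induct) auto

lemma basic_sum_matrix_seq: "basic_sum S s \<Longrightarrow> matrix_seq S"
  by (simp add: matrix_seq_def basic_sum_carrier)

lemma basic_sum_add:
  assumes "basic_sum T t" "basic_sum S s"
  shows "basic_sum (\<lambda>n. S n + T n) (\<lambda>z. s z + t z)"
  using assms
proof (induction rule: basic_sum.induct)
  case basic_sum_zero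
  have "(\<lambda>n. S n + 0\<^sub>m n n) = S" using basic_sum_carrier[OF basic_sum_zero] by (intro ext right_add_zero_mat) auto
  then show ?case using basic_sum_zero by simp
next
  case (basic_sum_step T t a k)
  have "basic_sum (\<lambda>n. S n + T n + basic_seq a k n) (\<lambda>z. s z + t z + a (fst z) * trig k (snd z))"
    by (rule basic_sum.basic_sum_step) (use basic_sum_step in auto)
  also have "(\<lambda>n. S n + T n + basic_seq a k n) = (\<lambda>n. S n + (T n + basic_seq a k n))"
    using assoc_add_mat[OF basic_sum_carrier[OF basic_sum_step(4)] basic_sum_carrier[OF basic_sum_step(1)] basic_seq_carrier] by auto
  finally show ?case by (simp add: add.assoc)
qed

lemma basic_sum_basic_seq:
  assumes "continuous_on {0..1} a"
  shows "basic_sum (basic_seq a k) (\<lambda>z. a (fst z) * trig k (snd z))"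
proof -
  have "(\<lambda>n. 0\<^sub>m n n + basic_seq a k n) = basic_seq a k" by (intro ext left_add_zero_mat) auto
  then show ?thesis using basic_sum_step[OF basic_sum_zero assms, of k] by simp
qed

lemma basic_seq_pair_split:
  assumes "continuous_on {0..1} a"
  shows "\<exists>M. pair_split 0 M (basic_seq a k) (\<lambda>z. a (fst z) * trig k (snd z))"
proof -
  have "compact (a ` {0..1})" using assms by (intro compact_continuous_image) auto
  then obtain M where M: "0 \<le> M" "\<And>x. x \<in> {0..1} \<Longrightarrow> cmod (a x) \<le> M"
    using bounded_pos[of "a ` {0..1}"] compact_imp_bounded by (metis imageI less_imp_le)
  have "mat_split n 0 M (basic_seq a k n)" for n
    by (rule mat_split_op_bound, rule op_bound_partial_perm[where k = k]) (use M in \<open>auto simp: basic_seq_index\<close>)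
  moreover have "symbol_split 0 M (\<lambda>z. a (fst z) * trig k (snd z))"
    by (rule symbol_split_bounded) (use M in \<open>auto simp: norm_mult\<close>)
  ultimately show ?thesis unfolding pair_split_def by (intro exI[of _ M]) simp
qed

lemma basic_sum_pair_split: "basic_sum S s \<Longrightarrow> \<exists>M. pair_split 0 M S s"
proof (induction rule: basic_sum.induct)
  case basic_sum_zero
  have "pair_split 0 0 (\<lambda>n. 0\<^sub>m n n) (\<lambda>_. 0)"
    unfolding pair_split_def using mat_split_op_bound[OF op_bound_zero] by (auto intro!: symbol_split_bounded)
  then show ?case by blast
next
  case (basic_sum_step S s a k)
  obtain M where "pair_split 0 M S s" using basic_sum_step by blast
  moreover obtain M' where "pair_split 0 M' (basic_seq a k) (\<lambda>z. a (fst z) * trig k (snd z))"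
    using basic_seq_pair_split[OF basic_sum_step(2)] by blast
  ultimately show ?case using pair_split_add by fastforce
qed

text \<open>In \<open>glt\<close> the approximations form a sequence in \<open>m\<close>; here they
  are quantified over \<epsilon>, and one basic sum must approximate matrices and symbol at the same
  time. Closure under limits is then a triangle inequality, and the sequence is recovered in
  \<open>gclass_imp_glt\<close>.\<close>

definition gclass :: "(nat \<Rightarrow> complex mat) \<Rightarrow> (real \<times> real \<Rightarrow> complex) \<Rightarrow> bool" where
  "gclass A \<kappa> \<longleftrightarrow> matrix_seq A \<and>
     (\<forall>\<epsilon>>0. \<exists>S s. basic_sum S s \<and> pair_split \<epsilon> \<epsilon> (\<lambda>n. A n - S n) (\<lambda>z. \<kappa> z - s z))"

lemma minus_plus_minus_mat:
  fixes A B C :: "complex mat"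
  assumes "A \<in> carrier_mat n m" "B \<in> carrier_mat n m" "C \<in> carrier_mat n m"
  shows "(A - B) + (B - C) = A - C"
  using assms by (intro eq_matI) auto

lemma pair_split_trans:
  assumes "pair_split \<alpha> \<beta> (\<lambda>n. A n - B n) (\<lambda>z. \<kappa> z - \<xi> z)" "pair_split \<alpha>' \<beta>' (\<lambda>n. B n - C n) (\<lambda>z. \<xi> z - \<eta> z)"
    and "matrix_seq A" "matrix_seq B" "matrix_seq C"
  shows "pair_split (\<alpha> + \<alpha>') (\<beta> + \<beta>') (\<lambda>n. A n - C n) (\<lambda>z. \<kappa> z - \<eta> z)"
proof -
  have "(\<lambda>n. (A n - B n) + (B n - C n)) = (\<lambda>n. A n - C n)"
  proof
    fix n
    show "(A n - B n) + (B n - C n) = A n - C n"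
      using assms(3-5)[THEN matrix_seqD, of n] by (rule minus_plus_minus_mat)
  qed
  then show ?thesis using pair_split_add[OF assms(1,2)] by simp
qed

text \<open>Closedness of the class, by splitting \<epsilon> into halves. Later membership proofs
  only have to approximate by members already known, not by basic sums.\<close>

lemma gclass_approx:
  assumes A: "matrix_seq A"
    and "\<And>\<epsilon>. 0 < \<epsilon> \<Longrightarrow> \<exists>B \<xi>. gclass B \<xi> \<and> pair_split \<epsilon> \<epsilon> (\<lambda>n. A n - B n) (\<lambda>z. \<kappa> z - \<xi> z)"
  shows "gclass A \<kappa>"
  unfolding gclass_def
proof (intro conjI allI impI A)
  fix \<epsilon> :: real assume "0 < \<epsilon>"
  then have e: "0 < \<epsilon> / 2" by simp
  obtain B \<xi> where B: "gclass B \<xi>" "pair_split (\<epsilon>/2) (\<epsilon>/2) (\<lambda>n. A n - B n) (\<lambda>z. \<kappa> z - \<xi> z)"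
    using assms(2)[OF e] by blast
  obtain S s where S: "basic_sum S s" "pair_split (\<epsilon>/2) (\<epsilon>/2) (\<lambda>n. B n - S n) (\<lambda>z. \<xi> z - s z)"
    using B(1) e unfolding gclass_def by blast
  have "pair_split \<epsilon> \<epsilon> (\<lambda>n. A n - S n) (\<lambda>z. \<kappa> z - s z)"
    using pair_split_trans[OF B(2) S(2) A _ basic_sum_matrix_seq[OF S(1)]] B(1) by (simp add: gclass_def)
  then show "\<exists>S s. basic_sum S s \<and> pair_split \<epsilon> \<epsilon> (\<lambda>n. A n - S n) (\<lambda>z. \<kappa> z - s z)" using S(1) by blast
qed

lemma pair_split_refl:
  assumes "matrix_seq A" "0 \<le> \<epsilon>"
  shows "pair_split \<epsilon> \<epsilon> (\<lambda>n. A n - A n) (\<lambda>z. \<kappa> z - \<kappa> z)"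
proof -
  have "A n - A n = 0\<^sub>m n n" for n using matrix_seqD[OF assms(1), of n] by (intro eq_matI) auto
  then have "pair_split 0 0 (\<lambda>n. A n - A n) (\<lambda>z. \<kappa> z - \<kappa> z)"
    unfolding pair_split_def using mat_split_op_bound[OF op_bound_zero] by (auto intro!: symbol_split_bounded)
  then show ?thesis using assms(2) assms(2) by (rule pair_split_mono)
qed

lemma gclass_basic_sum: "basic_sum S s \<Longrightarrow> gclass S s"
  unfolding gclass_def using pair_split_refl[OF basic_sum_matrix_seq[of S s]] basic_sum_matrix_seq less_imp_le by blast

lemma gclass_matrix_seq: "gclass A \<kappa> \<Longrightarrow> matrix_seq A"
  by (simp add: gclass_def)

lemma gclass_carrier: "gclass A \<kappa> \<Longrightarrow> A n \<in> carrier_mat n n"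
  by (simp add: gclass_def matrix_seq_def)

section \<open>Sums, products and adjoints in the class\<close>

lemma gclass_add:
  assumes "gclass A \<kappa>" "gclass B \<xi>"
  shows "gclass (\<lambda>n. A n + B n) (\<lambda>z. \<kappa> z + \<xi> z)"
  unfolding gclass_def
proof (intro conjI allI impI)
  note c = gclass_carrier[OF assms(1)] gclass_carrier[OF assms(2)]
  show "matrix_seq (\<lambda>n. A n + B n)" using c by (simp add: matrix_seq_def)
  fix \<epsilon> :: real assume "0 < \<epsilon>"
  then have e: "0 < \<epsilon> / 2" by simp
  obtain S s where S: "basic_sum S s" "pair_split (\<epsilon>/2) (\<epsilon>/2) (\<lambda>n. A n - S n) (\<lambda>z. \<kappa> z - s z)"
    using assms(1) e unfolding gclass_def by blast
  obtain T t where T: "basic_sum T t" "pair_split (\<epsilon>/2) (\<epsilon>/2) (\<lambda>n. B n - T n) (\<lambda>z. \<xi> z - t z)"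
    using assms(2) e unfolding gclass_def by blast
  have "(\<lambda>n. (A n - S n) + (B n - T n)) = (\<lambda>n. (A n + B n) - (S n + T n))"
  proof
    fix n
    show "(A n - S n) + (B n - T n) = (A n + B n) - (S n + T n)"
      using c[of n] basic_sum_carrier[OF S(1), of n] basic_sum_carrier[OF T(1), of n] by (intro eq_matI) auto
  qed
  moreover have "(\<lambda>z. (\<kappa> z - s z) + (\<xi> z - t z)) = (\<lambda>z. (\<kappa> z + \<xi> z) - (s z + t z))" by auto
  ultimately have "pair_split \<epsilon> \<epsilon> (\<lambda>n. (A n + B n) - (S n + T n)) (\<lambda>z. (\<kappa> z + \<xi> z) - (s z + t z))"
    using pair_split_add[OF S(2) T(2)] by simp
  then show "\<exists>S s. basic_sum S s \<and> pair_split \<epsilon> \<epsilon> (\<lambda>n. (A n + B n) - S n) (\<lambda>z. (\<kappa> z + \<xi> z) - s z)"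
    using basic_sum_add[OF T(1) S(1)] by blast
qed

text \<open>Indices at distance at most \<open>k\<close> give sampling points at distance at most
  k/n, which uniform continuity controls once \<open>n\<close> is large. This is what lets a shift
  pass a sampling matrix up to a small error.\<close>

lemma sampling_close:
  assumes a: "continuous_on {0..1} a" and "0 < \<epsilon>"
  shows "eventually (\<lambda>n. \<forall>i<n. \<forall>j<n. \<bar>int i - int j\<bar> \<le> k \<longrightarrow>
    cmod (a (real (i + 1) / real n) - a (real (j + 1) / real n)) \<le> \<epsilon>) sequentially"
proof -
  have "uniformly_continuous_on {0..1} a" by (rule compact_uniformly_continuous[OF a]) simp
  then obtain d where d: "0 < d" "\<And>x y. x \<in> {0..1} \<Longrightarrow> y \<in> {0..1} \<Longrightarrow> dist y x < d \<Longrightarrow> dist (a y) (a x) < \<epsilon>"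
    using \<open>0 < \<epsilon>\<close> unfolding uniformly_continuous_on_def by metis
  have "eventually (\<lambda>n::nat. real_of_int k / d < real n) sequentially"
    using filterlim_at_top_dense[of real sequentially] filterlim_real_sequentially by blast
  then show ?thesis
  proof (rule eventually_mono, intro allI impI)
    fix n i j :: nat assume n: "real_of_int k / d < real n" and ij: "i < n" "j < n" "\<bar>int i - int j\<bar> \<le> k"
    have n0: "0 < real n" using ij by simp
    have "\<bar>real i - real j\<bar> \<le> real_of_int k" using ij(3) by linarith
    then have "\<bar>real i - real j\<bar> < d * real n" using n d(1) by (simp add: field_simps)
    moreover have "dist (real (i + 1) / real n) (real (j + 1) / real n) = \<bar>real i - real j\<bar> / real n"
      using ij by (simp add: dist_real_def flip: diff_divide_distrib)
    ultimately have "dist (real (i + 1) / real n) (real (j + 1) / real n) < d"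
      using n0 by (simp only: divide_less_eq if_True)
    then have "dist (a (real (i + 1) / real n)) (a (real (j + 1) / real n)) < \<epsilon>"
      using ij by (intro d(2)) auto
    then show "cmod (a (real (i + 1) / real n) - a (real (j + 1) / real n)) \<le> \<epsilon>" by (simp add: dist_norm)
  qed
qed

text \<open>Column \<open>j\<close> of the second factor has its only possible entry in row j + l,
  so at most one term of the product survives, and none if that row falls outside the
  matrix.\<close>

lemma basic_seq_mult_index:
  assumes ij: "i < n" "j < n"
  shows "(basic_seq a k n * basic_seq b l n) $$ (i, j) =
    (if int i - int j = k + l \<and> 0 \<le> int j + l \<and> int j + l < int n
     then a (real (i + 1) / real n) * b (real (nat (int j + l) + 1) / real n) else 0)"
proof -
  have "(basic_seq a k n * basic_seq b l n) $$ (i, j) = (\<Sum>m<n. basic_seq a k n $$ (i, m) * basic_seq b l n $$ (m, j))"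
    by (rule index_mult_mat_sum[OF basic_seq_carrier basic_seq_carrier ij])
  also have "\<dots> = (\<Sum>m<n. if m = nat (int j + l) then
      (if int i - int j = k + l \<and> 0 \<le> int j + l then a (real (i + 1) / real n) * b (real (m + 1) / real n) else 0) else 0)"
    using ij by (intro sum.cong refl) (auto simp: basic_seq_index)
  also have "\<dots> = (if nat (int j + l) < n then
      (if int i - int j = k + l \<and> 0 \<le> int j + l then a (real (i + 1) / real n) * b (real (nat (int j + l) + 1) / real n) else 0) else 0)"
    by (subst sum.delta) auto
  finally show ?thesis by auto
qed

lemma const_frac_eventually:
  assumes "0 < \<epsilon>"
  shows "eventually (\<lambda>n. c \<le> \<epsilon> * real n) sequentially"
proof -
  have "eventually (\<lambda>n::nat. c / \<epsilon> < real n) sequentially"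
    using filterlim_at_top_dense[of real sequentially] filterlim_real_sequentially by blast
  then show ?thesis by (rule eventually_mono) (use assms in \<open>simp add: field_simps\<close>)
qed

text \<open>The product is compared with the weighted shift of weight a b and offset k + l. Two
  errors occur: \<open>b\<close> is sampled at row j + l in place of row \<open>i\<close>, a
  displacement of |k| and hence small in norm (\<open>N\<close>); and entries are lost where j + l
  leaves the matrix, in at most |l| columns, a fraction of \<open>n\<close> that tends to 0
  (\<open>R\<close>).\<close>

lemma gclass_basic_seq_mult:
  assumes a: "continuous_on {0..1} a" and b: "continuous_on {0..1} b"
  shows "gclass (\<lambda>n. basic_seq a k n * basic_seq b l n) (\<lambda>z. (a (fst z) * trig k (snd z)) * (b (fst z) * trig l (snd z)))"
    (is "gclass ?X ?\<phi>")
  unfolding gclass_def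
proof (intro conjI allI impI)
  have c: "basic_seq a k n * basic_seq b l n \<in> carrier_mat n n" for n by (rule mult_carrier_mat[OF basic_seq_carrier basic_seq_carrier])
  then show "matrix_seq ?X" by (simp add: matrix_seq_def)
  fix \<epsilon> :: real assume "0 < \<epsilon>"
  let ?ab = "\<lambda>x. a x * b x"
  have ab: "continuous_on {0..1} ?ab" by (intro continuous_intros a b)
  obtain M where M: "0 < M" "\<And>x. x \<in> {0..1} \<Longrightarrow> cmod (a x) \<le> M"
    using bounded_pos[of "a ` {0..1}"] compact_imp_bounded[OF compact_continuous_image[OF a]] by auto
  have symb: "?\<phi> = (\<lambda>z. ?ab (fst z) * trig (k + l) (snd z))"
    by (auto simp: trig_add)
  define P where "P n i j \<longleftrightarrow> 0 \<le> int j + l \<and> int j + l < int n" for n i j :: nat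
  define N where "N n = Matrix.mat n n (\<lambda>(i, j). if int i - int j = k + l \<and> P n i j then a (real (i + 1) / real n) *
      (b (real (nat (int j + l) + 1) / real n) - b (real (i + 1) / real n)) else 0)" for n
  define R where "R n = Matrix.mat n n (\<lambda>(i, j). if int i - int j = k + l \<and> \<not> P n i j then
      - ?ab (real (i + 1) / real n) else 0)" for n
  have eq: "?X n - basic_seq ?ab (k + l) n = R n + N n" for n
  proof (rule eq_matI)
    fix i j assume "i < dim_row (R n + N n)" "j < dim_col (R n + N n)"
    then have ij: "i < n" "j < n" by (auto simp: R_def N_def)
    then have "(?X n - basic_seq ?ab (k + l) n) $$ (i, j) = ?X n $$ (i, j) - basic_seq ?ab (k + l) n $$ (i, j)"
      using c by simp
    then show "(?X n - basic_seq ?ab (k + l) n) $$ (i, j) = (R n + N n) $$ (i, j)"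
      unfolding basic_seq_mult_index[OF ij] basic_seq_index[OF ij] using ij by (auto simp: R_def N_def P_def algebra_simps)
  qed (use c in \<open>auto simp: R_def N_def\<close>)
  have "eventually (\<lambda>n. op_bound n \<epsilon> (N n)) sequentially"
    using sampling_close[OF b, of "\<epsilon> / M" "\<bar>k\<bar>"]
  proof (rule eventually_mono)
    show "0 < \<epsilon> / M" using \<open>0 < \<epsilon>\<close> M by simp
    fix n assume cl: "\<forall>i<n. \<forall>j<n. \<bar>int i - int j\<bar> \<le> \<bar>k\<bar> \<longrightarrow>
      cmod (b (real (i + 1) / real n) - b (real (j + 1) / real n)) \<le> \<epsilon> / M"
    show "op_bound n \<epsilon> (N n)"
    proof (rule op_bound_partial_perm[where k = "k + l"])
      fix i j assume ij: "i < n" "j < n"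
      show "cmod (N n $$ (i, j)) \<le> \<epsilon>"
      proof (cases "int i - int j = k + l \<and> P n i j")
        case True
        then have "cmod (N n $$ (i, j)) = cmod (a (real (i + 1) / real n)) *
          cmod (b (real (nat (int j + l) + 1) / real n) - b (real (i + 1) / real n))"
          using ij by (simp add: N_def norm_mult)
        also have "\<dots> \<le> M * (\<epsilon> / M)"
        proof (rule mult_mono)
          show "cmod (a (real (i + 1) / real n)) \<le> M" using ij by (intro M) auto
          show "cmod (b (real (nat (int j + l) + 1) / real n) - b (real (i + 1) / real n)) \<le> \<epsilon> / M"
            using True ij by (intro cl[rule_format]) (auto simp: P_def)
        qed (use M in auto)
        finally show ?thesis using M by simp
      qed (use ij \<open>0 < \<epsilon>\<close> in \<open>auto simp: N_def\<close>)
    qed (use \<open>0 < \<epsilon>\<close> in \<open>auto simp: N_def\<close>)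
  qed
  moreover have "eventually (\<lambda>n. lowrank n (\<epsilon> * real n) (R n)) sequentially"
    using const_frac_eventually[OF \<open>0 < \<epsilon>\<close>, of "real (nat \<bar>l\<bar>)"]
  proof (rule eventually_mono)
    fix n assume n: "real (nat \<bar>l\<bar>) \<le> \<epsilon> * real n"
    define J where "J = {j. j < n \<and> \<not> (0 \<le> int j + l \<and> int j + l < int n)}"
    \<comment> \<open>For negative \<open>l\<close> the lost columns are the first |l| ones,
      otherwise the last ones.\<close>
    have "J \<subseteq> (if l < 0 then {..<nat \<bar>l\<bar>} else {n - nat \<bar>l\<bar>..<n})" by (auto simp: J_def)
    then have "card J \<le> card (if l < 0 then {..<nat \<bar>l\<bar>} else {n - nat \<bar>l\<bar>..<n})"
      by (intro card_mono) auto
    also have "\<dots> \<le> nat \<bar>l\<bar>" by auto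
    finally have "real (card J) \<le> \<epsilon> * real n" using n by linarith
    then show "lowrank n (\<epsilon> * real n) (R n)"
      by (intro lowrank_columns[where J = J]) (auto simp: R_def J_def P_def)
  qed
  ultimately have "eventually (\<lambda>n. mat_split n \<epsilon> \<epsilon> (?X n - basic_seq ?ab (k + l) n)) sequentially"
    by (rule eventually_elim2) (auto intro: mat_splitI simp: eq)
  moreover have "symbol_split \<epsilon> \<epsilon> (\<lambda>z. ?\<phi> z - ?ab (fst z) * trig (k + l) (snd z))"
    using \<open>0 < \<epsilon>\<close> by (intro symbol_split_bounded) (auto simp: trig_add)
  ultimately show "\<exists>S s. basic_sum S s \<and> pair_split \<epsilon> \<epsilon> (\<lambda>n. ?X n - S n) (\<lambda>z. ?\<phi> z - s z)"
    using basic_sum_basic_seq[OF ab, of "k + l"] unfolding pair_split_def by blast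
qed

text \<open>The adjoint lies on the diagonal of offset -k, with the conjugate weight sampled at the
  column index instead of the row index. The displacement |k| costs a small norm and no
  rank.\<close>

lemma gclass_basic_seq_adjoint:
  assumes a: "continuous_on {0..1} a"
  shows "gclass (\<lambda>n. mat_adjoint (basic_seq a k n)) (\<lambda>z. cnj (a (fst z) * trig k (snd z)))"
    (is "gclass ?X ?\<phi>")
  unfolding gclass_def
proof (intro conjI allI impI)
  have c: "mat_adjoint (basic_seq a k n) \<in> carrier_mat n n" for n by simp
  then show "matrix_seq ?X" by (simp add: matrix_seq_def)
  fix \<epsilon> :: real assume "0 < \<epsilon>"
  let ?a = "\<lambda>x. cnj (a x)"
  have ac: "continuous_on {0..1} ?a" by (intro continuous_intros a)
  have "eventually (\<lambda>n. mat_split n \<epsilon> \<epsilon> (?X n - basic_seq ?a (- k) n)) sequentially"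
    using sampling_close[OF a \<open>0 < \<epsilon>\<close>, of "\<bar>k\<bar>"]
  proof (rule eventually_mono)
    fix n assume cl: "\<forall>i<n. \<forall>j<n. \<bar>int i - int j\<bar> \<le> \<bar>k\<bar> \<longrightarrow>
      cmod (a (real (i + 1) / real n) - a (real (j + 1) / real n)) \<le> \<epsilon>"
    have idx: "(?X n - basic_seq ?a (- k) n) $$ (i, j) = (if int i - int j = - k then
        cnj (a (real (j + 1) / real n) - a (real (i + 1) / real n)) else 0)" if "i < n" "j < n" for i j
      using that by (auto simp: mat_adjoint_index[OF basic_seq_carrier] basic_seq_index)
    have "op_bound n \<epsilon> (?X n - basic_seq ?a (- k) n)"
    proof (rule op_bound_partial_perm[where k = "- k"])
      fix i j assume ij: "i < n" "j < n"
      show "cmod ((?X n - basic_seq ?a (- k) n) $$ (i, j)) \<le> \<epsilon>"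
        unfolding idx[OF ij] using cl[rule_format, OF ij(2,1)] \<open>0 < \<epsilon>\<close> by (auto simp del: complex_cnj_diff)
      show "int i - int j \<noteq> - k \<Longrightarrow> (?X n - basic_seq ?a (- k) n) $$ (i, j) = 0"
        unfolding idx[OF ij] by simp
    qed (use \<open>0 < \<epsilon>\<close> in auto)
    then have "mat_split n 0 \<epsilon> (?X n - basic_seq ?a (- k) n)" by (rule mat_split_op_bound)
    then show "mat_split n \<epsilon> \<epsilon> (?X n - basic_seq ?a (- k) n)" by (rule mat_split_mono) (use \<open>0 < \<epsilon>\<close> in auto)
  qed
  moreover have "symbol_split \<epsilon> \<epsilon> (\<lambda>z. ?\<phi> z - ?a (fst z) * trig (- k) (snd z))"
    using \<open>0 < \<epsilon>\<close> by (intro symbol_split_bounded) (auto simp: trig_uminus)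
  ultimately show "\<exists>S s. basic_sum S s \<and> pair_split \<epsilon> \<epsilon> (\<lambda>n. ?X n - S n) (\<lambda>z. ?\<phi> z - s z)"
    using basic_sum_basic_seq[OF ac, of "- k"] unfolding pair_split_def by blast
qed

lemma gclass_zero: "gclass (\<lambda>n. 0\<^sub>m n n) (\<lambda>_. 0)"
  by (rule gclass_basic_sum) (rule basic_sum_zero)

lemma gclass_basic_sum_mult:
  assumes "basic_sum S s" "basic_sum T t"
  shows "gclass (\<lambda>n. S n * T n) (\<lambda>z. s z * t z)"
  using assms(1)
proof (induction rule: basic_sum.induct)
  case basic_sum_zero
  have "0\<^sub>m n n * T n = 0\<^sub>m n n" for n using basic_sum_carrier[OF assms(2), of n] by simp
  then show ?case using gclass_zero by simp
next
  case (basic_sum_step S s a k)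
  have basic_seq: "gclass (\<lambda>n. basic_seq a k n * T n) (\<lambda>z. a (fst z) * trig k (snd z) * t z)"
    using assms(2)
  proof (induction rule: basic_sum.induct)
    case basic_sum_zero
    have "basic_seq a k n * 0\<^sub>m n n = 0\<^sub>m n n" for n by (rule right_mult_zero_mat[OF basic_seq_carrier])
    then show ?case using gclass_zero by simp
  next
    case (basic_sum_step T t b l)
    have "basic_seq a k n * (T n + basic_seq b l n) = basic_seq a k n * T n + basic_seq a k n * basic_seq b l n" for n
      by (rule mult_add_distrib_mat[OF basic_seq_carrier basic_sum_carrier[OF basic_sum_step(1)] basic_seq_carrier])
    then show ?case
      using gclass_add[OF basic_sum_step(3) gclass_basic_seq_mult[OF \<open>continuous_on {0..1} a\<close> basic_sum_step(2), of k l]]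
      by (simp add: distrib_left)
  qed
  have "(S n + basic_seq a k n) * T n = S n * T n + basic_seq a k n * T n" for n
    by (rule add_mult_distrib_mat[OF basic_sum_carrier[OF basic_sum_step(1)] basic_seq_carrier basic_sum_carrier[OF assms(2)]])
  then show ?case using gclass_add[OF basic_sum_step(3) basic_seq] by (simp add: distrib_right)
qed

text \<open>The approximating basic sum is bounded outright, so the only exceptions are those of the
  approximation error. One \<open>M\<close> serves matrices and symbol; it may grow as \<epsilon>
  shrinks.\<close>

lemma gclass_pair_split:
  assumes "gclass A \<kappa>" "0 < \<epsilon>"
  shows "\<exists>M>0. pair_split \<epsilon> M A \<kappa>"
proof -
  obtain S s where S: "basic_sum S s" "pair_split \<epsilon> \<epsilon> (\<lambda>n. A n - S n) (\<lambda>z. \<kappa> z - s z)"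
    using assms unfolding gclass_def by blast
  obtain M where M: "pair_split 0 M S s" using basic_sum_pair_split[OF S(1)] by blast
  have "(A n - S n) + S n = A n" for n
    using gclass_carrier[OF assms(1), of n] basic_sum_carrier[OF S(1), of n] by (intro eq_matI) auto
  then have "pair_split \<epsilon> (\<epsilon> + M) A \<kappa>" using pair_split_add[OF S(2) M] by simp
  moreover have "0 < \<epsilon> + M" using pair_split_nonneg[OF M] assms by simp
  ultimately show ?thesis by blast
qed

text \<open>AB - ST = (A - S) B + S (B - T). The order of choices matters: \<open>M\<close> bounds
  \<open>B\<close> up to a small fraction, then \<open>S\<close> is chosen close enough to
  \<open>A\<close> relative to \<open>M\<close>, then \<open>L\<close> bounds \<open>S\<close>, and
  only then \<open>T\<close> is chosen close enough to \<open>B\<close> relative to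
  \<open>L\<close>.\<close>

lemma gclass_mult:
  assumes A: "gclass A \<kappa>" and B: "gclass B \<xi>"
  shows "gclass (\<lambda>n. A n * B n) (\<lambda>z. \<kappa> z * \<xi> z)"
proof (rule gclass_approx)
  note c = gclass_carrier[OF A] gclass_carrier[OF B]
  show "matrix_seq (\<lambda>n. A n * B n)" using c by (auto simp: matrix_seq_def intro: mult_carrier_mat)
  fix \<epsilon> :: real assume "0 < \<epsilon>"
  then have e: "0 < \<epsilon> / 4" by simp
  obtain M where M: "0 < M" "pair_split (\<epsilon>/4) M B \<xi>" using gclass_pair_split[OF B e] by blast
  \<comment> \<open>The first bound keeps the rank and measure fractions, which add up, below
    \<epsilon>; the second keeps the norm of the first error term below \<epsilon>/2.\<close>
  define \<delta> where "\<delta> = min (\<epsilon>/4) (\<epsilon>/2/M)"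
  have \<delta>: "0 < \<delta>" "\<delta> \<le> \<epsilon>/4" "\<delta> * M \<le> \<epsilon>/2"
    using \<open>0 < \<epsilon>\<close> M(1) mult_right_mono[OF min.cobounded2[of "\<epsilon>/4" "\<epsilon>/2/M"], of M] by (auto simp: \<delta>_def)
  obtain S s where S: "basic_sum S s" "pair_split \<delta> \<delta> (\<lambda>n. A n - S n) (\<lambda>z. \<kappa> z - s z)"
    using A \<delta>(1) unfolding gclass_def by blast
  obtain L where L: "pair_split 0 L S s" using basic_sum_pair_split[OF S(1)] by blast
  have L0: "0 \<le> L" using pair_split_nonneg[OF L] by simp
  \<comment> \<open>L + 1 avoids a division by zero when \<open>L\<close> is 0.\<close>
  define \<eta> where "\<eta> = min (\<epsilon>/4) (\<epsilon>/2/(L + 1))"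
  have "\<eta> \<le> \<epsilon>/4" unfolding \<eta>_def by (rule min.cobounded1)
  moreover have "0 < \<eta>" using \<open>0 < \<epsilon>\<close> L0 by (simp add: \<eta>_def)
  ultimately have \<eta>: "0 < \<eta>" "\<eta> \<le> \<epsilon>/4" by auto
  have "L * \<eta> \<le> (L + 1) * (\<epsilon>/2/(L + 1))" using L0 \<eta> by (intro mult_mono) (auto simp: \<eta>_def)
  also have "\<dots> = \<epsilon>/2" using L0 by (subst times_divide_eq_right, subst nonzero_mult_div_cancel_left) auto
  finally have L\<eta>: "L * \<eta> \<le> \<epsilon>/2" .
  obtain T t where T: "basic_sum T t" "pair_split \<eta> \<eta> (\<lambda>n. B n - T n) (\<lambda>z. \<xi> z - t z)"
    using B \<eta>(1) unfolding gclass_def by blast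
  note cc = basic_sum_carrier[OF S(1)] basic_sum_carrier[OF T(1)]
  have "(A n - S n) * B n + S n * (B n - T n) = A n * B n - S n * T n" for n
  proof -
    have p: "A n * B n \<in> carrier_mat n n" "S n * B n \<in> carrier_mat n n" "S n * T n \<in> carrier_mat n n"
      using c cc by (blast intro: mult_carrier_mat)+
    show ?thesis
      unfolding minus_mult_distrib_mat[OF c(1) cc(1) c(2)] mult_minus_distrib_mat[OF cc(1) c(2) cc(2)]
      by (rule minus_plus_minus_mat[OF p])
  qed
  moreover have "(\<lambda>z. (\<kappa> z - s z) * \<xi> z + s z * (\<xi> z - t z)) = (\<lambda>z. \<kappa> z * \<xi> z - s z * t z)"
    by (auto simp: algebra_simps)
  ultimately have "pair_split (\<delta> + \<epsilon>/4 + (0 + \<eta>)) (\<delta> * M + L * \<eta>) (\<lambda>n. A n * B n - S n * T n) (\<lambda>z. \<kappa> z * \<xi> z - s z * t z)"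
    using pair_split_add[OF pair_split_mult[OF S(2) M(2)] pair_split_mult[OF L T(2)]] by simp
  then have "pair_split \<epsilon> \<epsilon> (\<lambda>n. A n * B n - S n * T n) (\<lambda>z. \<kappa> z * \<xi> z - s z * t z)"
    by (rule pair_split_mono) (use \<delta> \<eta> L\<eta> \<open>0 < \<epsilon>\<close> in linarith)+
  then show "\<exists>C \<zeta>. gclass C \<zeta> \<and> pair_split \<epsilon> \<epsilon> (\<lambda>n. A n * B n - C n) (\<lambda>z. \<kappa> z * \<xi> z - \<zeta> z)"
    using gclass_basic_sum_mult[OF S(1) T(1)] by blast
qed

lemma gclass_basic_sum_adjoint:
  assumes "basic_sum S s"
  shows "gclass (\<lambda>n. mat_adjoint (S n)) (\<lambda>z. cnj (s z))"
  using assms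
proof (induction rule: basic_sum.induct)
  case basic_sum_zero
  have "mat_adjoint (0\<^sub>m n n) = (0\<^sub>m n n :: complex mat)" for n
    by (intro eq_matI) (auto simp: mat_adjoint_index[of _ n n])
  then show ?case using gclass_zero by simp
next
  case (basic_sum_step S s a k)
  then show ?case
    using gclass_add[OF basic_sum_step(3) gclass_basic_seq_adjoint[OF basic_sum_step(2), of k]]
    by (simp add: mat_adjoint_add[OF basic_sum_carrier[OF basic_sum_step(1)] basic_seq_carrier])
qed

lemma gclass_adjoint:
  assumes A: "gclass A \<kappa>"
  shows "gclass (\<lambda>n. mat_adjoint (A n)) (\<lambda>z. cnj (\<kappa> z))"
proof (rule gclass_approx)
  note c = gclass_carrier[OF A]
  show "matrix_seq (\<lambda>n. mat_adjoint (A n))" using c by (simp add: matrix_seq_def)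
  fix \<epsilon> :: real assume "0 < \<epsilon>"
  then obtain S s where S: "basic_sum S s" "pair_split \<epsilon> \<epsilon> (\<lambda>n. A n - S n) (\<lambda>z. \<kappa> z - s z)"
    using A unfolding gclass_def by blast
  have "pair_split \<epsilon> \<epsilon> (\<lambda>n. mat_adjoint (A n) - mat_adjoint (S n)) (\<lambda>z. cnj (\<kappa> z) - cnj (s z))"
    using pair_split_adjoint[OF S(2)] by (simp add: mat_adjoint_minus[OF c basic_sum_carrier[OF S(1)]])
  then show "\<exists>B \<xi>. gclass B \<xi> \<and> pair_split \<epsilon> \<epsilon> (\<lambda>n. mat_adjoint (A n) - B n) (\<lambda>z. cnj (\<kappa> z) - \<xi> z)"
    using gclass_basic_sum_adjoint[OF S(1)] by blast
qed

section \<open>Sampling matrices and Toeplitz matrices\<close>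

text \<open>On Borel sets Lebesgue measure agrees with \<open>lborel\<close>, which is a product
  measure. This is one reason why exceptional sets in one variable are taken compact or open
  below.\<close>

lemma emeasure_lebesgue_Times:
  fixes A B :: "real set"
  assumes "A \<in> sets borel" "B \<in> sets borel"
  shows "emeasure lebesgue (A \<times> B) = emeasure lebesgue A * emeasure lebesgue B"
proof -
  have "A \<times> B \<in> sets (borel :: (real \<times> real) measure)" using assms by (simp add: borel_Times)
  then have "emeasure lebesgue (A \<times> B) = emeasure (lborel \<Otimes>\<^sub>M lborel) (A \<times> B)"
    by (simp add: lborel_prod)
  also have "\<dots> = emeasure lborel A * emeasure lborel B"
    using assms by (intro lborel.emeasure_pair_measure_Times) auto
  finally show ?thesis using assms by simp
qed

text \<open>Outer regularity; the gap between \<alpha> and the measure of \<open>S\<close> is spent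
  on the open superset, so the strict bound survives.\<close>

lemma outer_open_emeasure:
  fixes S :: "real set"
  assumes S: "S \<in> sets lebesgue" "emeasure lebesgue S < ennreal \<alpha>"
  obtains T where "open T" "S \<subseteq> T" "emeasure lebesgue T < ennreal \<alpha>"
proof -
  have fin: "emeasure lebesgue S \<noteq> \<infinity>" using S(2) by auto
  define s where "s = measure lebesgue S"
  have s: "emeasure lebesgue S = ennreal s" "0 \<le> s" using fin by (auto simp: s_def emeasure_eq_ennreal_measure)
  then have "s < \<alpha>" using S(2) by (simp add: ennreal_less_iff)
  then have "0 < \<alpha> - s" by simp
  from sets_lebesgue_outer_open[OF S(1) this]
  obtain T where T: "open T" "S \<subseteq> T" "T - S \<in> lmeasurable" "emeasure lebesgue (T - S) < ennreal (\<alpha> - s)" by blast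
  have "emeasure lebesgue T = emeasure lebesgue S + emeasure lebesgue (T - S)"
    using T S by (subst plus_emeasure) (auto intro: fmeasurableD simp: Un_absorb1)
  also have "\<dots> < ennreal s + ennreal (\<alpha> - s)"
    using T(4) s by (simp add: ennreal_add_left_cancel_less)
  also have "\<dots> = ennreal \<alpha>" using s \<open>s < \<alpha>\<close> by (simp flip: ennreal_plus)
  finally show thesis using T that by blast
qed

text \<open>Each sampling point in \<open>C\<close> is the right end of a cell of length 1/n. By
  compactness the cells eventually lie inside \<open>T\<close>; being disjoint, they bound the
  fraction of such points by the measure of \<open>T\<close>. For a mere null set this fails: the
  rationals contain every sampling point.\<close>

lemma eventually_card_sampling:
  fixes C T :: "real set"
  assumes C: "compact C" and T: "open T" "C \<subseteq> T" "emeasure lebesgue T \<le> ennreal \<delta>" and "0 \<le> \<delta>"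
  shows "eventually (\<lambda>n. real (card {i. i < n \<and> real (i + 1) / real n \<in> C}) \<le> \<delta> * real n) sequentially"
proof -
  obtain e where e: "0 < e" "(\<Union>x\<in>C. ball x e) \<subseteq> T"
    using compact_subset_open_imp_ball_epsilon_subset[OF C T(1,2)] by blast
  have "eventually (\<lambda>n. 1 < e * real n) sequentially"
    using const_frac_eventually[OF e(1), of 2] by (rule eventually_mono) auto
  then show ?thesis
  proof (rule eventually_mono)
    fix n assume n: "1 < e * real n"
    then have n0: "0 < real n" using e(1) by (cases n) auto
    define J where "J = {i. i < n \<and> real (i + 1) / real n \<in> C}"
    \<comment> \<open>Half-open cells are disjoint, and the cell of the zero-based index
      \<open>i\<close> ends at its sampling point (i + 1)/n.\<close>
    define K where "K i = {real i / real n <.. real (i + 1) / real n}" for i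
    have "K i \<subseteq> T" if "i \<in> J" for i
    proof -
      have "K i \<subseteq> ball (real (i + 1) / real n) e"
      proof
        fix x assume "x \<in> K i"
        then have "real i / real n < x" "x \<le> real (i + 1) / real n" by (auto simp: K_def)
        moreover have "real (i + 1) / real n - real i / real n = 1 / real n"
          by (simp flip: diff_divide_distrib)
        moreover have "1 / real n < e" using n n0 by (simp add: divide_less_eq)
        ultimately show "x \<in> ball (real (i + 1) / real n) e" by (simp add: dist_real_def)
      qed
      then show ?thesis using e(2) that by (auto simp: J_def)
    qed
    then have sub: "(\<Union>i\<in>J. K i) \<subseteq> T" by blast
    have disj: "disjoint_family_on K J"
    proof (unfold disjoint_family_on_def, intro ballI impI)
      fix i j :: nat assume "i \<noteq> j"
      show "K i \<inter> K j = {}"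
      proof (rule ccontr)
        assume "K i \<inter> K j \<noteq> {}"
        then obtain x where x: "x \<in> K i" "x \<in> K j" by blast
        have "real i < x * real n" "x * real n \<le> real (i + 1)" "real j < x * real n" "x * real n \<le> real (j + 1)"
          using x n0 by (simp_all add: K_def field_simps)
        then have "real i < real (j + 1)" "real j < real (i + 1)" by linarith+
        then show False using \<open>i \<noteq> j\<close> by linarith
      qed
    qed
    have "ennreal (real (card J) / real n) = (\<Sum>i\<in>J. ennreal (1 / real n))"
      using n0 by (simp add: ennreal_of_nat_eq_real_of_nat flip: ennreal_mult)
    also have "\<dots> = (\<Sum>i\<in>J. emeasure lebesgue (K i))"
      by (intro sum.cong) (auto simp: K_def divide_right_mono simp flip: diff_divide_distrib)
    also have "\<dots> = emeasure lebesgue (\<Union>i\<in>J. K i)"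
      by (intro sum_emeasure disj) (auto simp: J_def K_def)
    also have "\<dots> \<le> emeasure lebesgue T"
      using sub T(1) by (intro emeasure_mono) auto
    also have "\<dots> \<le> ennreal \<delta>" by (rule T)
    finally have "real (card J) / real n \<le> \<delta>" using \<open>0 \<le> \<delta>\<close> by simp
    then show "real (card {i. i < n \<and> real (i + 1) / real n \<in> C}) \<le> \<delta> * real n"
      using n0 by (simp add: J_def divide_le_eq)
  qed
qed

lemma basic_seq_0_eq: "basic_seq b 0 n = diag_sampling n b"
  by (intro eq_matI) (auto simp: basic_seq_index diag_sampling_def mat_diag_def)

text \<open>Cover the discontinuities by a small open \<open>T\<close> and extend \<open>a\<close>
  from the compact rest \<open>K\<close> to a continuous \<open>b\<close>. Agreement on
  \<open>K\<close> alone would leave an exceptional set that is not closed; the a.e. continuity of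
  \<open>a\<close> improves it to closeness near \<open>K\<close>, so that the remaining set
  \<open>C\<close> is compact and lies in \<open>T\<close>.\<close>

lemma continuous_ae_approx:
  assumes a: "continuous_ae_01 a" and "0 < \<delta>" "0 < \<epsilon>"
  obtains b C T where "continuous_on {0..1} b" "compact C" "open T" "C \<subseteq> T" "emeasure lebesgue T < ennreal \<delta>"
    "\<And>x. x \<in> {0..1} \<Longrightarrow> x \<notin> C \<Longrightarrow> cmod (a x - b x) < \<epsilon>"
proof -
  obtain N where N: "{x \<in> space (lebesgue_on {0..1}). \<not> continuous (at x within {0..1}) a} \<subseteq> N"
      "N \<in> null_sets (lebesgue_on {0..1})"
    using a unfolding continuous_ae_01_def eventually_ae_filter by blast
  then have N0: "N \<in> null_sets lebesgue" by (simp add: null_sets_restrict_space)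
  then have "N \<in> sets lebesgue" "emeasure lebesgue N < ennreal \<delta>" using \<open>0 < \<delta>\<close> by auto
  then obtain T where T: "open T" "N \<subseteq> T" "emeasure lebesgue T < ennreal \<delta>"
    by (rule outer_open_emeasure)
  define K where "K = {0..1} - T"
  have cont: "continuous (at x within {0..1}) a" if "x \<in> K" for x
    using that N(1) T(2) by (auto simp: K_def space_restrict_space)
  have "closed K" using T(1) by (auto simp: K_def intro: closed_Diff)
  moreover have "continuous_on K a"
    unfolding continuous_on_eq_continuous_within
    using continuous_within_subset[OF cont] by (auto simp: K_def)
  ultimately obtain b where b: "continuous_on UNIV b" "\<And>x. x \<in> K \<Longrightarrow> b x = a x"
    using Tietze_unbounded[of K a UNIV] by auto
  \<comment> \<open>At a point of \<open>K\<close> the function \<open>a\<close> is continuous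
    relative to the whole interval, not only to \<open>K\<close>; so a - b, which vanishes there,
    stays small on a full relative neighbourhood.\<close>
  have "\<exists>V. open V \<and> x \<in> V \<and> (\<forall>y\<in>{0..1} \<inter> V. cmod (a y - b y) < \<epsilon>)" if "x \<in> K" for x
  proof -
    have "continuous (at x within {0..1}) b"
      using b(1) by (meson UNIV_I continuous_on_eq_continuous_at continuous_at_imp_continuous_within open_UNIV)
    then have "continuous (at x within {0..1}) (\<lambda>y. a y - b y)"
      using cont[OF that] by (intro continuous_intros)
    then obtain d where "0 < d" "\<forall>y\<in>{0..1}. dist y x < d \<longrightarrow> dist (a y - b y) (a x - b x) < \<epsilon>"
      using \<open>0 < \<epsilon>\<close> unfolding continuous_within_eps_delta by blast
    then show ?thesis using b(2)[OF that] by (intro exI[of _ "ball x d"]) (auto simp: dist_commute)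
  qed
  then obtain V where V: "\<And>x. x \<in> K \<Longrightarrow> open (V x) \<and> x \<in> V x \<and> (\<forall>y\<in>{0..1} \<inter> V x. cmod (a y - b y) < \<epsilon>)" by metis
  define C where "C = {0..1} - (\<Union>x\<in>K. V x)"
  show thesis
  proof
    show "continuous_on {0..1} b" using b(1) continuous_on_subset by blast
    show "compact C" unfolding C_def using V by (intro compact_diff) auto
    show "C \<subseteq> T" using V by (auto simp: C_def K_def)
    show "cmod (a x - b x) < \<epsilon>" if "x \<in> {0..1}" "x \<notin> C" for x using that V by (auto simp: C_def)
  qed (use T in auto)
qed

lemma gclass_diag_sampling:
  assumes "continuous_ae_01 a"
  shows "gclass (\<lambda>n. diag_sampling n a) (\<lambda>z. a (fst z))"
proof (rule gclass_approx)
  show "matrix_seq (\<lambda>n. diag_sampling n a)" by (simp add: matrix_seq_def)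
  fix \<epsilon> :: real assume "0 < \<epsilon>"
  \<comment> \<open>The exceptional set is the strip over \<open>C\<close>, whose height 2 pi is
    below 8.\<close>
  then have "0 < \<epsilon> / 8" by simp
  from continuous_ae_approx[OF assms this \<open>0 < \<epsilon>\<close>]
  obtain b C T where b: "continuous_on {0..1} b" and C: "compact C" "open T" "C \<subseteq> T" "emeasure lebesgue T < ennreal (\<epsilon> / 8)"
    and ab: "\<And>x. x \<in> {0..1} \<Longrightarrow> x \<notin> C \<Longrightarrow> cmod (a x - b x) < \<epsilon>" by metis
  have "eventually (\<lambda>n. mat_split n \<epsilon> \<epsilon> (diag_sampling n a - basic_seq b 0 n)) sequentially"
    using eventually_card_sampling[OF C(1,2,3) less_imp_le[OF C(4)]]
  proof (rule eventually_mono)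
    show "0 \<le> \<epsilon> / 8" using \<open>0 < \<epsilon>\<close> by simp
    fix n assume n: "real (card {i. i < n \<and> real (i + 1) / real n \<in> C}) \<le> \<epsilon> / 8 * real n"
    let ?d = "\<lambda>i. a (real (i + 1) / real n) - b (real (i + 1) / real n)"
    have eq: "diag_sampling n a - basic_seq b 0 n = mat_diag n ?d"
      unfolding basic_seq_0_eq by (intro eq_matI) (auto simp: diag_sampling_def mat_diag_def)
    have "{i. i < n \<and> cmod (?d i) > \<epsilon>} \<subseteq> {i. i < n \<and> real (i + 1) / real n \<in> C}"
    proof safe
      fix i assume i: "i < n" "cmod (?d i) > \<epsilon>"
      show "real (i + 1) / real n \<in> C"
      proof (rule ccontr)
        assume "real (i + 1) / real n \<notin> C"
        then have "cmod (?d i) < \<epsilon>" using i(1) by (intro ab) auto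
        then show False using i(2) by simp
      qed
    qed
    then have "card {i. i < n \<and> cmod (?d i) > \<epsilon>} \<le> card {i. i < n \<and> real (i + 1) / real n \<in> C}"
      by (intro card_mono) auto
    also have "real \<dots> \<le> \<epsilon> * real n" using n \<open>0 < \<epsilon>\<close> by (simp add: order_trans[OF n] mult_right_mono)
    finally show "mat_split n \<epsilon> \<epsilon> (diag_sampling n a - basic_seq b 0 n)"
      unfolding eq using \<open>0 < \<epsilon>\<close> by (intro mat_split_diag) auto
  qed
  moreover have "symbol_split \<epsilon> \<epsilon> (\<lambda>z. a (fst z) - b (fst z) * trig 0 (snd z))"
    unfolding symbol_split_def
  proof (intro conjI bexI[of _ "C \<times> {-pi..pi}"])
    have Cb: "C \<in> sets borel" using C(1) by (simp add: borel_compact)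
    then show "C \<times> {-pi..pi} \<in> sets lebesgue" by (simp add: borel_Times)
    have "emeasure lebesgue (C \<times> {-pi..pi}) = emeasure lebesgue C * emeasure lebesgue {-pi..pi}"
      using Cb by (intro emeasure_lebesgue_Times) auto
    also have "\<dots> \<le> ennreal (\<epsilon> / 8) * ennreal 8"
    proof (intro mult_mono)
      show "emeasure lebesgue C \<le> ennreal (\<epsilon> / 8)"
        using emeasure_mono[OF C(3), of lebesgue] C(2,4) by auto
      show "emeasure lebesgue {-pi..pi} \<le> ennreal 8" using pi_less_4 ennreal_leI[of "2 * pi" 8] by simp
    qed auto
    also have "\<dots> = ennreal \<epsilon>" using \<open>0 < \<epsilon>\<close> by (subst ennreal_mult[symmetric]) auto
    finally show "emeasure lebesgue (C \<times> {-pi..pi}) \<le> ennreal \<epsilon>" .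
    show "\<forall>z\<in>{0..1} \<times> {-pi..pi} - C \<times> {-pi..pi}. cmod (a (fst z) - b (fst z) * trig 0 (snd z)) \<le> \<epsilon>"
      using ab by (auto intro: less_imp_le)
  qed (use \<open>0 < \<epsilon>\<close> in auto)
  ultimately show "\<exists>B \<xi>. gclass B \<xi> \<and> pair_split \<epsilon> \<epsilon> (\<lambda>n. diag_sampling n a - B n) (\<lambda>z. a (fst z) - \<xi> z)"
    using gclass_basic_sum[OF basic_sum_basic_seq[OF b, of 0]] unfolding pair_split_def by blast
qed

section \<open>Toeplitz matrices with small integrable symbol\<close>

abbreviation lebpi :: "real measure" where "lebpi \<equiv> lebesgue_on {-pi..pi}"

lemma borel_measurable_continuous_lebpi:
  "continuous_on {-pi..pi} f \<Longrightarrow> f \<in> borel_measurable lebpi"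
  by (rule continuous_imp_measurable_on_sets_lebesgue) auto

lemma integrable_mult_trig:
  assumes "integrable lebpi g"
  shows "integrable lebpi (\<lambda>\<theta>. g \<theta> * trig k \<theta>)"
proof (rule Bochner_Integration.integrable_bound[OF assms])
  show "(\<lambda>\<theta>. g \<theta> * trig k \<theta>) \<in> borel_measurable lebpi"
    by (intro borel_measurable_times borel_measurable_integrable[OF assms]
      borel_measurable_continuous_lebpi continuous_on_trig)
qed (simp add: norm_mult)

lemma fourier_coeff_alt: "fourier_coeff g k = 1 / (2 * pi) * (\<integral>\<theta>. g \<theta> * trig (- k) \<theta> \<partial>lebpi)"
  by (simp add: fourier_coeff_def trig_def)

lemma fourier_coeff_add:
  assumes "integrable lebpi f" "integrable lebpi g"
  shows "fourier_coeff (\<lambda>\<theta>. f \<theta> + g \<theta>) k = fourier_coeff f k + fourier_coeff g k"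
  using integrable_mult_trig[OF assms(1)] integrable_mult_trig[OF assms(2)]
  by (simp add: fourier_coeff_alt distrib_right distrib_left add_divide_distrib)

lemma fourier_coeff_cmult: "fourier_coeff (\<lambda>\<theta>. c * g \<theta>) k = c * fourier_coeff g k"
  by (simp add: fourier_coeff_alt mult.assoc)

lemma toeplitz_add:
  assumes "integrable lebpi f" "integrable lebpi g"
  shows "toeplitz n (\<lambda>\<theta>. f \<theta> + g \<theta>) = toeplitz n f + toeplitz n g"
  by (intro eq_matI) (auto simp: toeplitz_def fourier_coeff_add[OF assms])

text \<open>Scaling is written as multiplication by a constant diagonal matrix so that
  \<open>mat_split_mult\<close> covers it.\<close>

lemma toeplitz_cmult: "toeplitz n (\<lambda>\<theta>. c * g \<theta>) = mat_diag n (\<lambda>_. c) * toeplitz n g"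
  unfolding mat_diag_mult_left[OF toeplitz_carrier]
  by (intro eq_matI) (auto simp: toeplitz_def fourier_coeff_cmult)

lemma op_bound_const_diag: "op_bound n (cmod c) (mat_diag n (\<lambda>_. c))"
  by (rule op_bound_partial_perm[where k = 0]) (auto simp: mat_diag_def)

lemma trig_diff: "trig (k - l) \<theta> = trig k \<theta> * cnj (trig l \<theta>)"
  using trig_add[of k "- l" \<theta>] by (simp add: trig_uminus)

text \<open>The matrix is Hermitian with nonnegative eigenvalues, and its trace is n/(2 pi) times
  the integral of \<open>r\<close>, at most n \<epsilon>^2. So at most n \<epsilon> eigenvalues
  exceed \<epsilon>; this is where the square in the hypothesis comes from.\<close>

lemma mat_split_nonneg_toeplitz:
  fixes r :: "real \<Rightarrow> real"
  assumes r: "integrable lebpi r" "\<And>\<theta>. 0 \<le> r \<theta>" and small: "(\<integral>\<theta>. r \<theta> \<partial>lebpi) \<le> \<epsilon>\<^sup>2" and "0 < \<epsilon>"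
  shows "mat_split n \<epsilon> \<epsilon> (toeplitz n (\<lambda>\<theta>. complex_of_real (r \<theta>)))"
proof -
  let ?g = "\<lambda>\<theta>. complex_of_real (r \<theta>)"
  define T where "T = toeplitz n ?g"
  have g: "integrable lebpi ?g" using r by simp
  have T: "T \<in> carrier_mat n n" by (simp add: T_def)
  have Tidx: "T $$ (j, k) = 1 / (2 * pi) * (\<integral>\<theta>. ?g \<theta> * trig (int k - int j) \<theta> \<partial>lebpi)" if "j < n" "k < n" for j k
    using that by (simp add: T_def toeplitz_def fourier_coeff_alt)
  have "mat_adjoint T = T"
  proof (rule eq_matI)
    fix i j assume "i < dim_row T" "j < dim_col T"
    then have ij: "i < n" "j < n" using T by auto
    have "cnj (\<integral>\<theta>. ?g \<theta> * trig (int i - int j) \<theta> \<partial>lebpi) = (\<integral>\<theta>. cnj (?g \<theta> * trig (int i - int j) \<theta>) \<partial>lebpi)"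
      by (rule Bochner_Integration.integral_cnj[symmetric])
    also have "\<dots> = (\<integral>\<theta>. ?g \<theta> * trig (int j - int i) \<theta> \<partial>lebpi)"
      by (simp add: trig_diff mult.commute)
    finally show "mat_adjoint T $$ (i, j) = T $$ (i, j)"
      using ij by (simp add: mat_adjoint_index[OF T] Tidx)
  qed (use T in auto)
  then obtain U d where U: "unitary_mat n U" "T = udiag n U d"
    using normal_unitary_diagonalization[OF T] by auto
  note Uc = unitary_matD[OF U(1)]
  \<comment> \<open>\<open>d i\<close> is the quadratic form of \<open>T\<close> at column
    \<open>i\<close> of \<open>U\<close>. For a Toeplitz matrix it is the integral of
    \<open>r\<close> against the squared modulus of a trigonometric polynomial, which shows the
    sign.\<close>
  have dval: "d i = complex_of_real (1 / (2 * pi) * (\<integral>\<theta>. r \<theta> * (cmod (\<Sum>k<n. U $$ (k, i) * trig (int k) \<theta>))\<^sup>2 \<partial>lebpi))"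
    if i: "i < n" for i
  proof -
    have TU: "T * U \<in> carrier_mat n n" using T Uc by auto
    have "mat_adjoint U * (T * U) = mat_diag n d"
    proof -
      have "udiag n U d * U = U * mat_diag n d"
        unfolding udiag_def assoc_mult_mat[OF mult_carrier_mat[OF Uc(1) mat_diag_dim] Uc(2) Uc(1)] Uc(3)
        by (rule right_mult_one_mat[OF mult_carrier_mat[OF Uc(1) mat_diag_dim]])
      then show ?thesis
        unfolding U(2) by (simp only: assoc_mult_mat[OF Uc(2) Uc(1) mat_diag_dim, symmetric] Uc(3)) simp
    qed
    then have "d i = (mat_adjoint U * (T * U)) $$ (i, i)" using i by (simp add: mat_diag_def)
    also have "\<dots> = (\<Sum>j<n. cnj (U $$ (j, i)) * (\<Sum>k<n. T $$ (j, k) * U $$ (k, i)))"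
      unfolding index_mult_mat_sum[OF Uc(2) TU i i]
      by (intro sum.cong refl) (simp only: lessThan_iff index_mult_mat_sum[OF T Uc(1) _ i] mat_adjoint_index[OF Uc(1) i])
    also have "\<dots> = (\<Sum>j<n. \<Sum>k<n. 1 / (2 * pi) * (\<integral>\<theta>. (cnj (U $$ (j, i)) * U $$ (k, i)) * (?g \<theta> * trig (int k - int j) \<theta>) \<partial>lebpi))"
      unfolding sum_distrib_left by (intro sum.cong refl) (simp add: Tidx)
    also have "\<dots> = 1 / (2 * pi) * (\<integral>\<theta>. (\<Sum>j<n. \<Sum>k<n. (cnj (U $$ (j, i)) * U $$ (k, i)) * (?g \<theta> * trig (int k - int j) \<theta>)) \<partial>lebpi)"
      by (simp add: Bochner_Integration.integral_sum integrable_mult_trig[OF g] sum_distrib_left del: integral_mult_right_zero integral_mult_left_zero)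
    also have "(\<lambda>\<theta>. \<Sum>j<n. \<Sum>k<n. (cnj (U $$ (j, i)) * U $$ (k, i)) * (?g \<theta> * trig (int k - int j) \<theta>))
        = (\<lambda>\<theta>. complex_of_real (r \<theta> * (cmod (\<Sum>k<n. U $$ (k, i) * trig (int k) \<theta>))\<^sup>2))"
    proof
      fix \<theta>
      have "complex_of_real ((cmod (\<Sum>k<n. U $$ (k, i) * trig (int k) \<theta>))\<^sup>2)
          = (\<Sum>k<n. U $$ (k, i) * trig (int k) \<theta>) * cnj (\<Sum>k<n. U $$ (k, i) * trig (int k) \<theta>)"
        by (rule complex_norm_square)
      also have "\<dots> = (\<Sum>j<n. cnj (U $$ (j, i) * trig (int j) \<theta>)) * (\<Sum>k<n. U $$ (k, i) * trig (int k) \<theta>)"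
        by (simp add: mult.commute)
      also have "\<dots> = (\<Sum>j<n. \<Sum>k<n. cnj (U $$ (j, i)) * U $$ (k, i) * trig (int k - int j) \<theta>)"
        unfolding sum_product by (intro sum.cong refl) (simp add: trig_diff mult_ac)
      finally show "(\<Sum>j<n. \<Sum>k<n. (cnj (U $$ (j, i)) * U $$ (k, i)) * (?g \<theta> * trig (int k - int j) \<theta>))
        = complex_of_real (r \<theta> * (cmod (\<Sum>k<n. U $$ (k, i) * trig (int k) \<theta>))\<^sup>2)"
        by (simp add: sum_distrib_left mult_ac)
    qed
    finally show ?thesis unfolding integral_complex_of_real by (simp only: of_real_mult)
  qed
  define ev where "ev i = Re (d i)" for i
  have ev: "0 \<le> ev i" "d i = complex_of_real (ev i)" if "i < n" for i
    using dval[OF that] r(2) by (auto simp: ev_def intro!: divide_nonneg_pos integral_nonneg_AE)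
  \<comment> \<open>The sum of the eigenvalues becomes the trace of \<open>T\<close> because the
    columns of \<open>U\<close> are unit vectors; each diagonal entry of \<open>T\<close> is the
    mean of \<open>r\<close>.\<close>
  have "complex_of_real (\<Sum>l<n. ev l) = (\<Sum>l<n. d l * (\<Sum>j<n. cnj (U $$ (j, l)) * U $$ (j, l)))"
  proof -
    have "(\<Sum>j<n. cnj (U $$ (j, l)) * U $$ (j, l)) = 1" if l: "l < n" for l
    proof -
      have "(mat_adjoint U * U) $$ (l, l) = 1" using Uc(3) l by simp
      then show ?thesis unfolding index_mult_mat_sum[OF Uc(2,1) l l]
        using l by (simp add: mat_adjoint_index[OF Uc(1)])
    qed
    then show ?thesis using ev by simp
  qed
  also have "\<dots> = (\<Sum>l<n. \<Sum>j<n. U $$ (j, l) * d l * cnj (U $$ (j, l)))"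
    by (simp add: sum_distrib_left mult_ac)
  also have "\<dots> = (\<Sum>j<n. \<Sum>l<n. U $$ (j, l) * d l * cnj (U $$ (j, l)))" by (rule sum.swap)
  also have "\<dots> = (\<Sum>j<n. T $$ (j, j))" unfolding U(2) by (simp add: udiag_index[OF Uc(1)])
  also have "\<dots> = complex_of_real (real n * (1 / (2 * pi) * (\<integral>\<theta>. r \<theta> \<partial>lebpi)))"
    by (simp add: Tidx)
  finally have "(\<Sum>l<n. ev l) = real n * (1 / (2 * pi) * (\<integral>\<theta>. r \<theta> \<partial>lebpi))"
    by (simp only: of_real_eq_iff)
  also have "\<dots> \<le> real n * (1 * \<epsilon>\<^sup>2)"
    using small r(2) pi_gt3 by (intro mult_left_mono mult_mono) (auto intro: integral_nonneg_AE)
  finally have trace: "(\<Sum>l<n. ev l) \<le> real n * \<epsilon>\<^sup>2" by simp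
  define J where "J = {i. i < n \<and> cmod (d i) > \<epsilon>}"
  have "real (card J) * \<epsilon> \<le> (\<Sum>l\<in>J. ev l)"
    using ev by (intro sum_bounded_below) (auto simp: J_def)
  also have "\<dots> \<le> (\<Sum>l<n. ev l)" using ev by (intro sum_mono2) (auto simp: J_def)
  also note trace
  finally have "real (card J) \<le> \<epsilon> * real n" using \<open>0 < \<epsilon>\<close> by (simp add: power2_eq_square mult_ac)
  then show ?thesis
    using mat_split_udiag[OF U(1), of \<epsilon> d \<epsilon>] \<open>0 < \<epsilon>\<close> unfolding J_def by (simp add: U(2)[symmetric] T_def)
qed

text \<open>Split \<open>g\<close> into the positive and negative parts of its real and imaginary
  parts. Each has integral at most that of |g|, and each of the four Toeplitz matrices receives a
  quarter of \<epsilon>.\<close>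

lemma mat_split_small_toeplitz:
  assumes g: "integrable lebpi g" and small: "(\<integral>\<theta>. cmod (g \<theta>) \<partial>lebpi) \<le> (\<epsilon> / 4)\<^sup>2" and "0 < \<epsilon>"
  shows "mat_split n \<epsilon> \<epsilon> (toeplitz n g)"
proof -
  \<comment> \<open>\<open>h\<close> will be Re, -Re, Im and -Im, with \<open>c\<close> the matching
    factor 1, -1, \<i> and -\<i>.\<close>
  have part: "integrable lebpi (\<lambda>\<theta>. max 0 (h (g \<theta>)))"
    "\<And>c. cmod c = 1 \<Longrightarrow> mat_split n (\<epsilon>/4) (\<epsilon>/4) (toeplitz n (\<lambda>\<theta>. c * complex_of_real (max 0 (h (g \<theta>)))))"
    if h: "\<And>z. \<bar>h z\<bar> \<le> cmod z" "h \<in> borel_measurable borel" for h :: "complex \<Rightarrow> real"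
  proof -
    have meas: "(\<lambda>\<theta>. max 0 (h (g \<theta>))) \<in> borel_measurable lebpi"
      using h(2) g by (intro borel_measurable_max measurable_compose[OF borel_measurable_integrable[OF g] h(2)]) auto
    show int: "integrable lebpi (\<lambda>\<theta>. max 0 (h (g \<theta>)))"
      by (rule Bochner_Integration.integrable_bound[OF g meas]) (use h(1) in \<open>auto simp: max_def intro: order_trans[OF abs_ge_self]\<close>)
    have "(\<integral>\<theta>. max 0 (h (g \<theta>)) \<partial>lebpi) \<le> (\<integral>\<theta>. cmod (g \<theta>) \<partial>lebpi)"
      by (rule integral_mono[OF int]) (use g h(1) in \<open>auto intro: order_trans[OF abs_ge_self]\<close>)
    then have "mat_split n (\<epsilon>/4) (\<epsilon>/4) (toeplitz n (\<lambda>\<theta>. complex_of_real (max 0 (h (g \<theta>)))))"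
      using small \<open>0 < \<epsilon>\<close> by (intro mat_split_nonneg_toeplitz[OF int]) auto
    then have "mat_split n (0 + \<epsilon>/4) (cmod c * (\<epsilon>/4)) (toeplitz n (\<lambda>\<theta>. c * complex_of_real (max 0 (h (g \<theta>)))))" for c
      unfolding toeplitz_cmult by (intro mat_split_mult mat_split_op_bound op_bound_const_diag)
    then show "mat_split n (\<epsilon>/4) (\<epsilon>/4) (toeplitz n (\<lambda>\<theta>. c * complex_of_real (max 0 (h (g \<theta>)))))" if "cmod c = 1" for c
      using that by (metis add_0 mult_1)
  qed
  define p where "p h c \<theta> = c * complex_of_real (max 0 (h (g \<theta>)))" for h :: "complex \<Rightarrow> real" and c \<theta>
  note p1 = part[of Re, OF abs_Re_le_cmod] and p2 = part[of "\<lambda>z. - Re z"] and p3 = part[of Im, OF abs_Im_le_cmod] and p4 = part[of "\<lambda>z. - Im z"]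
  have i: "integrable lebpi (p Re 1)" "integrable lebpi (p (\<lambda>z. - Re z) (-1))"
    "integrable lebpi (p Im \<i>)" "integrable lebpi (p (\<lambda>z. - Im z) (-\<i>))"
    unfolding p_def using p1(1) p2(1) p3(1) p4(1) by (auto simp: abs_Re_le_cmod abs_Im_le_cmod)
  have m: "mat_split n (\<epsilon>/4) (\<epsilon>/4) (toeplitz n (p Re 1))" "mat_split n (\<epsilon>/4) (\<epsilon>/4) (toeplitz n (p (\<lambda>z. - Re z) (-1)))"
    "mat_split n (\<epsilon>/4) (\<epsilon>/4) (toeplitz n (p Im \<i>))" "mat_split n (\<epsilon>/4) (\<epsilon>/4) (toeplitz n (p (\<lambda>z. - Im z) (-\<i>)))"
    unfolding p_def[abs_def] by (rule p1(2) p2(2) p3(2) p4(2); simp add: abs_Re_le_cmod abs_Im_le_cmod)+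
  have "g = (\<lambda>\<theta>. (p Re 1 \<theta> + p (\<lambda>z. - Re z) (-1) \<theta>) + (p Im \<i> \<theta> + p (\<lambda>z. - Im z) (-\<i>) \<theta>))"
    by (rule ext, rule complex_eqI) (auto simp: p_def max_def)
  then have "toeplitz n g = (toeplitz n (p Re 1) + toeplitz n (p (\<lambda>z. - Re z) (-1))) +
      (toeplitz n (p Im \<i>) + toeplitz n (p (\<lambda>z. - Im z) (-\<i>)))"
    using toeplitz_add[OF Bochner_Integration.integrable_add[OF i(1,2)] Bochner_Integration.integrable_add[OF i(3,4)], of n]
      toeplitz_add[OF i(1,2), of n] toeplitz_add[OF i(3,4), of n] by metis
  then show ?thesis
    using mat_split_add[OF mat_split_add[OF m(1,2)] mat_split_add[OF m(3,4)]] by simp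
qed

section \<open>Density of trigonometric polynomials\<close>

inductive trig_poly :: "(real \<Rightarrow> complex) \<Rightarrow> bool" where
  trig_poly_zero: "trig_poly (\<lambda>_. 0)"
| trig_poly_step: "trig_poly p \<Longrightarrow> trig_poly (\<lambda>\<theta>. p \<theta> + c * trig k \<theta>)"

lemma trig_poly_trig: "trig_poly (\<lambda>\<theta>. c * trig k \<theta>)"
  using trig_poly_step[OF trig_poly_zero, of c k] by simp

lemma trig_poly_const: "trig_poly (\<lambda>_. c)"
  using trig_poly_trig[of c 0] by simp

lemma trig_poly_add:
  assumes "trig_poly q" "trig_poly p"
  shows "trig_poly (\<lambda>\<theta>. p \<theta> + q \<theta>)"
  using assms by (induction rule: trig_poly.induct) (auto simp flip: add.assoc intro: trig_poly_step)

lemma trig_poly_mult_trig: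
  assumes "trig_poly p"
  shows "trig_poly (\<lambda>\<theta>. (c * trig k \<theta>) * p \<theta>)"
  using assms
proof (induction rule: trig_poly.induct)
  case (trig_poly_step p d l)
  have "trig_poly (\<lambda>\<theta>. (c * trig k \<theta>) * p \<theta> + (c * d) * trig (k + l) \<theta>)"
    by (rule trig_poly.trig_poly_step) fact
  then show ?case by (simp add: trig_add algebra_simps)
qed (simp add: trig_poly_zero)

lemma trig_poly_mult:
  assumes "trig_poly q" "trig_poly p"
  shows "trig_poly (\<lambda>\<theta>. q \<theta> * p \<theta>)"
  using assms
proof (induction rule: trig_poly.induct)
  case (trig_poly_step q c k)
  have "trig_poly (\<lambda>\<theta>. q \<theta> * p \<theta> + (c * trig k \<theta>) * p \<theta>)"
    by (rule trig_poly_add[OF trig_poly_mult_trig]) (use trig_poly_step in auto)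
  then show ?case by (simp add: distrib_right)
qed (simp add: trig_poly_zero)

lemma trig_poly_cmult: "trig_poly p \<Longrightarrow> trig_poly (\<lambda>\<theta>. c * p \<theta>)"
  using trig_poly_mult_trig[of p c 0] by simp

lemma trig_poly_continuous: "trig_poly p \<Longrightarrow> continuous_on S p"
  by (induction rule: trig_poly.induct) (auto intro!: continuous_intros)

lemma trig_poly_integrable: "trig_poly p \<Longrightarrow> integrable lebpi p"
  by (rule continuous_imp_integrable_real) (rule trig_poly_continuous)

lemma basic_sum_toeplitz:
  assumes "trig_poly p"
  shows "basic_sum (\<lambda>n. toeplitz n p) (\<lambda>z. p (snd z))"
  using assms
proof (induction rule: trig_poly.induct)
  case trig_poly_zero
  have "toeplitz n (\<lambda>_. 0) = 0\<^sub>m n n" for n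
    by (intro eq_matI) (auto simp: toeplitz_def fourier_coeff_def)
  then show ?case using basic_sum_zero by simp
next
  case (trig_poly_step p c k)
  have "integrable lebpi (\<lambda>\<theta>. c * trig k \<theta>)" using integrable_trig[of k] by simp
  then have "toeplitz n (\<lambda>\<theta>. p \<theta> + c * trig k \<theta>) = toeplitz n p + basic_seq (\<lambda>_. c) k n" for n
    unfolding toeplitz_add[OF trig_poly_integrable[OF trig_poly_step(1)] \<open>integrable lebpi (\<lambda>\<theta>. c * trig k \<theta>)\<close>]
    by (simp add: toeplitz_cmult basic_seq_def diag_sampling_def)
  moreover have "basic_sum (\<lambda>n. toeplitz n p + basic_seq (\<lambda>_. c) k n) (\<lambda>z. p (snd z) + c * trig k (snd z))"
    using basic_sum_step[OF trig_poly_step(2), of "\<lambda>_. c" k] by simp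
  ultimately show ?case by simp
qed

text \<open>The base case is a real-linear functional on the plane, which on the unit circle is a
  combination of cosine and sine; the other cases follow because trigonometric polynomials form an
  algebra.\<close>

lemma trig_poly_real_polynomial:
  fixes q :: "complex \<Rightarrow> real"
  assumes "real_polynomial_function q"
  shows "trig_poly (\<lambda>\<theta>. complex_of_real (q (cis \<theta>)))"
  using assms
proof (induction rule: real_polynomial_function.induct)
  case (linear f)
  then interpret bounded_linear f .
  \<comment> \<open>The coefficients come from writing cosine and sine through \<open>trig 1\<close>
    and \<open>trig (-1)\<close>.\<close>
  have eq: "complex_of_real (f (cis \<theta>)) = ((f 1 - \<i> * f \<i>) / 2) * trig 1 \<theta> + ((f 1 + \<i> * f \<i>) / 2) * trig (-1) \<theta>" for \<theta>
  proof -
    have "f (cis \<theta>) = f (cos \<theta> *\<^sub>R 1 + sin \<theta> *\<^sub>R \<i>)"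
      by (rule arg_cong[of _ _ f]) (simp add: complex_eq_iff)
    also have "\<dots> = cos \<theta> * f 1 + sin \<theta> * f \<i>" by (simp add: add scale)
    finally have "f (cis \<theta>) = cos \<theta> * f 1 + sin \<theta> * f \<i>" .
    moreover have t: "trig 1 \<theta> = cos \<theta> + \<i> * sin \<theta>" "trig (-1) \<theta> = cos \<theta> - \<i> * sin \<theta>"
      by (simp_all add: trig_def cis_conv_exp[symmetric] complex_eq_iff flip: cis_cnj)
        (simp_all add: complex_eq_iff exp_cnj cis_conv_exp[symmetric] Re_exp Im_exp)
    ultimately show ?thesis unfolding t by (simp add: field_simps)
  qed
  show ?case unfolding eq by (intro trig_poly_add trig_poly_trig)
next
  case (const c)
  then show ?case by (rule trig_poly_const)
next
  case (add f g)
  then show ?case by (simp add: trig_poly_add)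
next
  case (mult f g)
  then show ?case by (simp add: trig_poly_mult)
qed

text \<open>Equal end values make \<open>h\<close> a continuous function on the unit circle, where
  the Stone-Weierstrass theorem for polynomials in two real variables applies.\<close>

lemma trig_poly_uniform_approx:
  fixes h :: "real \<Rightarrow> real"
  assumes h: "continuous_on {-pi..pi} h" "h pi = h (- pi)" and "0 < \<eta>"
  obtains p where "trig_poly p" "\<And>\<theta>. \<theta> \<in> {-pi..pi} \<Longrightarrow> cmod (of_real (h \<theta>) - p \<theta>) < \<eta>"
proof -
  let ?S = "sphere (0::complex) 1"
  \<comment> \<open>The angle is recovered by arccos on the upper half circle and by its negative on
    the lower one. The two formulas meet at 1, where the angle is 0, and at -1, where they give
    h(pi) and h(-pi).\<close>
  define H where "H z = (if 0 \<le> Im z then h (arccos (Re z)) else h (- arccos (Re z)))" for z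
  have re: "-1 \<le> Re z" "Re z \<le> 1" if "z \<in> ?S" for z
    using abs_Re_le_cmod[of z] that by auto
  have cont: "continuous_on ?S (\<lambda>z. arccos (Re z))"
    by (intro continuous_on_arccos' continuous_intros) (use re in auto)
  have "continuous_on (?S \<inter> {z. 0 \<le> Im z} \<union> ?S \<inter> {z. Im z \<le> 0}) H"
    unfolding H_def
  proof (rule continuous_on_cases)
    show "closed (?S \<inter> {z. 0 \<le> Im z})" "closed (?S \<inter> {z. Im z \<le> 0})"
      by (intro closed_Int closed_sphere closed_halfspace_Im_ge closed_halfspace_Im_le)+
    show "continuous_on (?S \<inter> {z. 0 \<le> Im z}) (\<lambda>z. h (arccos (Re z)))"
      by (rule continuous_on_compose2[OF h(1)] continuous_on_subset[OF cont])+
        (use re arccos_bounded in \<open>force intro: order_trans[of _ 0]\<close>)+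
    show "continuous_on (?S \<inter> {z. Im z \<le> 0}) (\<lambda>z. h (- arccos (Re z)))"
      by (rule continuous_on_compose2[OF h(1)] continuous_on_minus continuous_on_subset[OF cont])+
        (use re arccos_bounded in \<open>force intro: order_trans[of _ 0]\<close>)+
    show "\<forall>z. z \<in> ?S \<inter> {z. 0 \<le> Im z} \<and> \<not> 0 \<le> Im z \<or> z \<in> ?S \<inter> {z. Im z \<le> 0} \<and> 0 \<le> Im z \<longrightarrow>
      h (arccos (Re z)) = h (- arccos (Re z))"
    proof (intro allI impI)
      fix z assume "z \<in> ?S \<inter> {z. 0 \<le> Im z} \<and> \<not> 0 \<le> Im z \<or> z \<in> ?S \<inter> {z. Im z \<le> 0} \<and> 0 \<le> Im z"
      then have "Im z = 0" "z \<in> ?S" by auto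
      then have "\<bar>Re z\<bar> = 1" by (simp add: cmod_eq_Re)
      then have "Re z = 1 \<or> Re z = -1" by auto
      then show "h (arccos (Re z)) = h (- arccos (Re z))" using h(2) by auto
    qed
  qed
  moreover have "?S \<inter> {z. 0 \<le> Im z} \<union> ?S \<inter> {z. Im z \<le> 0} = ?S" by auto
  ultimately have "continuous_on ?S H" by simp
  then obtain q where q: "real_polynomial_function q" "\<And>z. z \<in> ?S \<Longrightarrow> \<bar>H z - q z\<bar> < \<eta>"
    using Stone_Weierstrass_real_polynomial_function[of ?S H \<eta>] \<open>0 < \<eta>\<close> by auto
  have H: "H (cis \<theta>) = h \<theta>" if "\<theta> \<in> {-pi..pi}" for \<theta>
  proof (cases "0 \<le> \<theta>")
    case True
    then show ?thesis using that sin_ge_zero[of \<theta>] by (simp add: H_def arccos_cos)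
  next
    case False
    show ?thesis
    \<comment> \<open>The angle -pi corresponds to the point -1, which \<open>H\<close> counts to
      the upper half; there the equality of the end values is used.\<close>
    proof (cases "\<theta> = - pi")
      case True then show ?thesis using h(2) by (simp add: H_def)
    next
      case nb: False
      have "0 < sin (- \<theta>)" using that nb False by (intro sin_gt_zero) auto
      moreover have "arccos (cos \<theta>) = - \<theta>" using arccos_cos[of "- \<theta>"] that False by simp
      ultimately show ?thesis by (simp add: H_def)
    qed
  qed
  show thesis
  proof
    show "trig_poly (\<lambda>\<theta>. complex_of_real (q (cis \<theta>)))" by (rule trig_poly_real_polynomial[OF q(1)])
    show "cmod (of_real (h \<theta>) - complex_of_real (q (cis \<theta>))) < \<eta>" if "\<theta> \<in> {-pi..pi}" for \<theta>
      using q(2)[of "cis \<theta>"] H[OF that] by (simp flip: of_real_diff)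
  qed
qed

lemma integral_dist_triangle:
  fixes f g h :: "real \<Rightarrow> 'b :: {banach, second_countable_topology}"
  assumes "integrable M f" "integrable M g" "integrable M h"
  shows "(\<integral>x. norm (f x - h x) \<partial>M) \<le> (\<integral>x. norm (f x - g x) \<partial>M) + (\<integral>x. norm (g x - h x) \<partial>M)"
proof -
  have le: "norm (f x - h x) \<le> norm (f x - g x) + norm (g x - h x)" for x
    using norm_triangle_ineq[of "f x - g x" "g x - h x"] by simp
  have "(\<integral>x. norm (f x - h x) \<partial>M) \<le> (\<integral>x. norm (f x - g x) + norm (g x - h x) \<partial>M)"
    using assms by (intro integral_mono le) auto
  also have "\<dots> = (\<integral>x. norm (f x - g x) \<partial>M) + (\<integral>x. norm (g x - h x) \<partial>M)"
    using assms by (intro Bochner_Integration.integral_add) auto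
  finally show ?thesis .
qed

lemma finite_measure_lebpi: "finite_measure lebpi"
  by (intro finite_measure_lebesgue_on) auto

text \<open>A measurable function is an a.e. limit of continuous ones. After modification these are
  dominated and equal at both ends of the interval, so that dominated convergence and then uniform
  approximation apply.\<close>

lemma trig_poly_dense_bounded:
  fixes u :: "real \<Rightarrow> real"
  assumes u: "u \<in> borel_measurable lebpi" "\<And>\<theta>. \<bar>u \<theta>\<bar> \<le> M" and "0 < \<delta>"
  obtains p where "trig_poly p" "(\<integral>\<theta>. cmod (of_real (u \<theta>) - p \<theta>) \<partial>lebpi) < \<delta>"
proof -
  interpret finite_measure lebpi by (rule finite_measure_lebpi)
  define u' where "u' \<theta> = (if \<theta> \<in> {-pi..pi} then u \<theta> else 0)" for \<theta>
  have "u' \<in> borel_measurable lebesgue"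
    unfolding u'_def using u(1) by (subst borel_measurable_if) auto
  then have "u' measurable_on UNIV" by (intro lebesgue_measurable_imp_measurable_on_real) auto
  then obtain N g where N: "negligible N" "\<And>n. continuous_on UNIV (g n)"
    "\<And>x. x \<notin> N \<Longrightarrow> (\<lambda>n. g n x) \<longlonglongrightarrow> u' x"
    unfolding measurable_on_def by auto
  have M0: "0 \<le> M" using u(2)[of 0] by linarith
  \<comment> \<open>Clipping at height \<open>M\<close> gives the dominating constant. The second
    factor vanishes at both end points and tends to 1 in between, which yields equal end values at
    the cost of two points.\<close>
  define h where "h n \<theta> = max (-M) (min M (g n \<theta>)) * min 1 (real n * max 0 (pi - \<bar>\<theta>\<bar>))" for n \<theta>
  have h_cont: "continuous_on S (h n)" for S n
    unfolding h_def by (intro continuous_intros continuous_on_subset[OF N(2)]) auto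
  have h_bound: "\<bar>h n \<theta>\<bar> \<le> M" for n \<theta>
  proof -
    have "\<bar>h n \<theta>\<bar> \<le> M * 1"
      unfolding h_def abs_mult using M0 by (intro mult_mono) auto
    then show ?thesis by simp
  qed
  have "N \<union> {-pi, pi} \<in> null_sets lebesgue"
    using N(1) by (simp add: negligible_iff_null_sets[symmetric])
  have lim: "(\<lambda>n. h n \<theta>) \<longlonglongrightarrow> u \<theta>" if "\<theta> \<notin> N" "\<theta> \<in> {-pi<..<pi}" for \<theta>
  proof -
    have "(\<lambda>n. g n \<theta>) \<longlonglongrightarrow> u \<theta>" using N(3)[OF that(1)] that(2) by (simp add: u'_def)
    then have "(\<lambda>n. max (-M) (min M (g n \<theta>))) \<longlonglongrightarrow> max (-M) (min M (u \<theta>))"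
      by (intro tendsto_intros)
    also have "max (-M) (min M (u \<theta>)) = u \<theta>" using u(2)[of \<theta>] by auto
    finally have a: "(\<lambda>n. max (-M) (min M (g n \<theta>))) \<longlonglongrightarrow> u \<theta>" .
    have pos: "0 < pi - \<bar>\<theta>\<bar>" using that(2) by auto
    have "eventually (\<lambda>n. min 1 (real n * max 0 (pi - \<bar>\<theta>\<bar>)) = 1) sequentially"
      using const_frac_eventually[OF pos, of 1] by (rule eventually_mono) (use pos in \<open>auto simp: mult.commute\<close>)
    then have b: "(\<lambda>n. min 1 (real n * max 0 (pi - \<bar>\<theta>\<bar>))) \<longlonglongrightarrow> 1"
      by (rule tendsto_eventually)
    show ?thesis using tendsto_mult[OF a b] by (simp add: h_def)
  qed
  have ae: "AE \<theta> in lebpi. (\<lambda>n. \<bar>u \<theta> - h n \<theta>\<bar>) \<longlonglongrightarrow> 0"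
  proof -
    have "AE \<theta> in lebesgue. \<theta> \<notin> N \<union> {-pi, pi}"
      by (rule AE_not_in) fact
    then have "AE \<theta> in lebpi. \<theta> \<notin> N \<union> {-pi, pi}"
      by (subst AE_restrict_space_iff) auto
    then show ?thesis
    proof (rule AE_mp, intro AE_I2 impI)
      fix \<theta> assume "\<theta> \<in> space lebpi" "\<theta> \<notin> N \<union> {-pi, pi}"
      then have "(\<lambda>n. h n \<theta>) \<longlonglongrightarrow> u \<theta>" by (intro lim) (auto simp: space_restrict_space)
      then show "(\<lambda>n. \<bar>u \<theta> - h n \<theta>\<bar>) \<longlonglongrightarrow> 0"
        using tendsto_rabs[OF tendsto_diff[OF tendsto_const[of "u \<theta>"]]] by fastforce
    qed
  qed
  have hm: "h n \<in> borel_measurable lebpi" for n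
    by (rule borel_measurable_continuous_lebpi[OF h_cont])
  have "(\<lambda>n. \<integral>\<theta>. \<bar>u \<theta> - h n \<theta>\<bar> \<partial>lebpi) \<longlonglongrightarrow> (\<integral>\<theta>. 0 \<partial>lebpi)"
  proof (rule integral_dominated_convergence[where w = "\<lambda>_. 2 * M"])
    show "AE \<theta> in lebpi. norm \<bar>u \<theta> - h n \<theta>\<bar> \<le> 2 * M" for n
    proof (rule AE_I2)
      fix \<theta> show "norm \<bar>u \<theta> - h n \<theta>\<bar> \<le> 2 * M" using u(2)[of \<theta>] h_bound[of n \<theta>] by simp
    qed
  qed (use u(1) hm ae in \<open>auto intro!: borel_measurable_abs borel_measurable_diff\<close>)
  then have "eventually (\<lambda>n. (\<integral>\<theta>. \<bar>u \<theta> - h n \<theta>\<bar> \<partial>lebpi) < \<delta> / 2) sequentially"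
    using \<open>0 < \<delta>\<close> by (intro order_tendstoD(2)) auto
  then obtain n where n: "(\<integral>\<theta>. \<bar>u \<theta> - h n \<theta>\<bar> \<partial>lebpi) < \<delta> / 2"
    using eventually_happens'[OF sequentially_bot] by blast
  have "h n pi = h n (-pi)" by (simp add: h_def)
  \<comment> \<open>Integrating a uniform error \<delta>/16 over an interval of length below 8
    leaves at most \<delta>/2.\<close>
  then obtain p where p: "trig_poly p" "\<And>\<theta>. \<theta> \<in> {-pi..pi} \<Longrightarrow> cmod (of_real (h n \<theta>) - p \<theta>) < \<delta> / 16"
    using trig_poly_uniform_approx[OF h_cont, of n "\<delta>/16"] \<open>0 < \<delta>\<close> by auto
  have ui: "integrable lebpi (\<lambda>\<theta>. complex_of_real (u \<theta>))"
    using u by (intro integrable_const_bound[where B = M]) auto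
  have hi: "integrable lebpi (\<lambda>\<theta>. complex_of_real (h n \<theta>))"
    using hm h_bound by (intro integrable_const_bound[where B = M]) auto
  have pi: "integrable lebpi p" by (rule trig_poly_integrable[OF p(1)])
  have "(\<integral>\<theta>. cmod (of_real (h n \<theta>) - p \<theta>) \<partial>lebpi) \<le> (\<integral>\<theta>. \<delta> / 16 \<partial>lebpi)"
    using hi pi p(2) by (intro integral_mono) (auto simp: space_restrict_space less_imp_le)
  also have "\<dots> = \<delta> / 16 * (2 * pi)" by (simp add: measure_restrict_space)
  also have "\<dots> \<le> \<delta> / 16 * 8" using pi_less_4 \<open>0 < \<delta>\<close> by (intro mult_left_mono) auto
  finally have "(\<integral>\<theta>. cmod (of_real (h n \<theta>) - p \<theta>) \<partial>lebpi) \<le> \<delta> / 2" by simp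
  moreover have "(\<integral>\<theta>. cmod (of_real (u \<theta>) - of_real (h n \<theta>)) \<partial>lebpi) < \<delta> / 2"
    using n by (simp flip: of_real_diff)
  ultimately have "(\<integral>\<theta>. cmod (of_real (u \<theta>) - p \<theta>) \<partial>lebpi) < \<delta>"
    using integral_dist_triangle[OF ui hi pi] by linarith
  then show thesis using p(1) that by blast
qed

text \<open>Clipping \<open>u\<close> at height \<open>n\<close> reduces to the bounded case; the
  clipping error is dominated by |u| and is 0 at each point for large \<open>n\<close>.\<close>

lemma trig_poly_dense_real:
  fixes u :: "real \<Rightarrow> real"
  assumes u: "integrable lebpi u" and "0 < \<delta>"
  obtains p where "trig_poly p" "(\<integral>\<theta>. cmod (of_real (u \<theta>) - p \<theta>) \<partial>lebpi) < \<delta>"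
proof -
  define t where "t n \<theta> = max (- real n) (min (real n) (u \<theta>))" for n \<theta>
  have tm: "t n \<in> borel_measurable lebpi" for n
    unfolding t_def using borel_measurable_integrable[OF u] by (intro borel_measurable_max borel_measurable_min) auto
  have tb: "\<bar>u \<theta> - t n \<theta>\<bar> \<le> \<bar>u \<theta>\<bar>" "\<bar>t n \<theta>\<bar> \<le> \<bar>u \<theta>\<bar>" for n \<theta> by (auto simp: t_def)
  have "(\<lambda>n. \<integral>\<theta>. \<bar>u \<theta> - t n \<theta>\<bar> \<partial>lebpi) \<longlonglongrightarrow> (\<integral>\<theta>. 0 \<partial>lebpi)"
  proof (rule integral_dominated_convergence[where w = "\<lambda>\<theta>. \<bar>u \<theta>\<bar>"])
    show "AE \<theta> in lebpi. (\<lambda>n. \<bar>u \<theta> - t n \<theta>\<bar>) \<longlonglongrightarrow> 0"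
    proof (rule AE_I2)
      fix \<theta>
      have "eventually (\<lambda>n. \<bar>u \<theta> - t n \<theta>\<bar> = 0) sequentially"
        using const_frac_eventually[of 1 "\<bar>u \<theta>\<bar>"] by (auto elim!: eventually_mono simp: t_def)
      then show "(\<lambda>n. \<bar>u \<theta> - t n \<theta>\<bar>) \<longlonglongrightarrow> 0" by (rule tendsto_eventually)
    qed
  qed (use u tm tb in \<open>auto intro!: borel_measurable_abs borel_measurable_diff\<close>)
  then have "eventually (\<lambda>n. (\<integral>\<theta>. \<bar>u \<theta> - t n \<theta>\<bar> \<partial>lebpi) < \<delta> / 2) sequentially"
    using \<open>0 < \<delta>\<close> by (intro order_tendstoD(2)) auto
  then obtain n where n: "(\<integral>\<theta>. \<bar>u \<theta> - t n \<theta>\<bar> \<partial>lebpi) < \<delta> / 2"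
    using eventually_happens'[OF sequentially_bot] by blast
  have "\<bar>t n \<theta>\<bar> \<le> real n" for \<theta> by (auto simp: t_def)
  then obtain p where p: "trig_poly p" "(\<integral>\<theta>. cmod (of_real (t n \<theta>) - p \<theta>) \<partial>lebpi) < \<delta> / 2"
    using trig_poly_dense_bounded[OF tm, of n "real n" "\<delta>/2"] \<open>0 < \<delta>\<close> by auto
  have ti: "integrable lebpi (t n)"
    by (rule Bochner_Integration.integrable_bound[OF u tm]) (use tb in auto)
  have "(\<integral>\<theta>. cmod (of_real (u \<theta>) - of_real (t n \<theta>)) \<partial>lebpi) < \<delta> / 2"
    using n by (simp flip: of_real_diff)
  then have "(\<integral>\<theta>. cmod (of_real (u \<theta>) - p \<theta>) \<partial>lebpi) < \<delta>"
    using integral_dist_triangle[of lebpi "\<lambda>\<theta>. complex_of_real (u \<theta>)" "\<lambda>\<theta>. complex_of_real (t n \<theta>)" p] p u ti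
      trig_poly_integrable[OF p(1)] by simp
  then show thesis using p(1) that by blast
qed

lemma trig_poly_dense:
  assumes g: "integrable lebpi g" and "0 < \<delta>"
  obtains p where "trig_poly p" "(\<integral>\<theta>. cmod (g \<theta> - p \<theta>) \<partial>lebpi) < \<delta>"
proof -
  have d: "0 < \<delta> / 2" using \<open>0 < \<delta>\<close> by simp
  have re: "integrable lebpi (\<lambda>\<theta>. Re (g \<theta>))" and im: "integrable lebpi (\<lambda>\<theta>. Im (g \<theta>))" using g by auto
  obtain p where p: "trig_poly p" "(\<integral>\<theta>. cmod (of_real (Re (g \<theta>)) - p \<theta>) \<partial>lebpi) < \<delta> / 2"
    by (rule trig_poly_dense_real[OF re d])
  obtain q where q: "trig_poly q" "(\<integral>\<theta>. cmod (of_real (Im (g \<theta>)) - q \<theta>) \<partial>lebpi) < \<delta> / 2"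
    by (rule trig_poly_dense_real[OF im d])
  note pi = trig_poly_integrable[OF p(1)] and qi = trig_poly_integrable[OF q(1)]
  show thesis
  proof
    show "trig_poly (\<lambda>\<theta>. p \<theta> + \<i> * q \<theta>)"
      by (rule trig_poly_add[OF trig_poly_cmult[OF q(1)] p(1)])
    have le: "cmod (g \<theta> - (p \<theta> + \<i> * q \<theta>)) \<le> cmod (of_real (Re (g \<theta>)) - p \<theta>) + cmod (of_real (Im (g \<theta>)) - q \<theta>)" for \<theta>
    proof -
      have "g \<theta> - (p \<theta> + \<i> * q \<theta>) = (of_real (Re (g \<theta>)) - p \<theta>) + \<i> * (of_real (Im (g \<theta>)) - q \<theta>)"
        by (subst complex_eq[of "g \<theta>"]) (simp add: algebra_simps)
      then show ?thesis by (metis norm_triangle_ineq norm_mult norm_ii mult_1)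
    qed
    have "(\<integral>\<theta>. cmod (g \<theta> - (p \<theta> + \<i> * q \<theta>)) \<partial>lebpi)
        \<le> (\<integral>\<theta>. cmod (of_real (Re (g \<theta>)) - p \<theta>) + cmod (of_real (Im (g \<theta>)) - q \<theta>) \<partial>lebpi)"
      using g re im pi qi by (intro integral_mono le) auto
    also have "\<dots> = (\<integral>\<theta>. cmod (of_real (Re (g \<theta>)) - p \<theta>) \<partial>lebpi) + (\<integral>\<theta>. cmod (of_real (Im (g \<theta>)) - q \<theta>) \<partial>lebpi)"
      using re im pi qi by (intro Bochner_Integration.integral_add) auto
    finally show "(\<integral>\<theta>. cmod (g \<theta> - (p \<theta> + \<i> * q \<theta>)) \<partial>lebpi) < \<delta>" using p(2) q(2) by linarith
  qed
qed

text \<open>By Markov's inequality the set where |r| is at least \<epsilon> has measure below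
  \<epsilon>. An open superset \<open>T\<close> turns the exceptional strip into a Borel rectangle,
  whose other side has length 1.\<close>

lemma symbol_split_small_integral:
  assumes r: "integrable lebpi r" and small: "(\<integral>\<theta>. cmod (r \<theta>) \<partial>lebpi) < \<epsilon>\<^sup>2" and "0 < \<epsilon>"
  shows "symbol_split \<epsilon> \<epsilon> (\<lambda>z. r (snd z))"
proof -
  define E where "E = {\<theta> \<in> {-pi..pi}. \<epsilon> \<le> cmod (r \<theta>)}"
  have "E = {\<theta> \<in> space lebpi. \<epsilon> \<le> cmod (r \<theta>)}" by (simp add: E_def space_restrict_space)
  also have "\<dots> \<in> sets lebpi" using borel_measurable_integrable[OF r] by measurable
  finally have E: "E \<in> sets lebpi" .
  then have EL: "E \<in> sets lebesgue" "E \<subseteq> {-pi..pi}" by (auto simp: sets_restrict_space_iff E_def)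
  have "emeasure lebesgue E = emeasure lebpi E"
    using EL by (simp add: emeasure_restrict_space)
  also have "\<dots> \<le> ennreal ((\<integral>\<theta>. cmod (r \<theta>) \<partial>lebpi) / \<epsilon>)"
    using integral_Markov_inequality[of lebpi "\<lambda>\<theta>. cmod (r \<theta>)" \<epsilon>] r \<open>0 < \<epsilon>\<close>
    by (simp add: E_def space_restrict_space)
  also have "\<dots> < ennreal \<epsilon>"
    using small \<open>0 < \<epsilon>\<close> by (intro ennreal_lessI) (auto simp: divide_less_eq power2_eq_square)
  finally obtain T where T: "open T" "E \<subseteq> T" "emeasure lebesgue T < ennreal \<epsilon>"
    using outer_open_emeasure[OF EL(1)] by blast
  show ?thesis
    unfolding symbol_split_def
  proof (intro conjI bexI[of _ "{0..1::real} \<times> T"])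
    have Tb: "T \<in> sets borel" using T by simp
    then show "{0..1::real} \<times> T \<in> sets lebesgue" by (simp add: borel_Times)
    show "emeasure lebesgue ({0..1::real} \<times> T) \<le> ennreal \<epsilon>"
      using T(3) Tb by (subst emeasure_lebesgue_Times) auto
    show "\<forall>z\<in>{0..1} \<times> {-pi..pi} - {0..1} \<times> T. cmod (r (snd z)) \<le> \<epsilon>"
      using T(2) by (auto simp: E_def)
  qed (use \<open>0 < \<epsilon>\<close> in auto)
qed

lemma gclass_toeplitz:
  assumes g: "integrable lebpi g"
  shows "gclass (\<lambda>n. toeplitz n g) (\<lambda>z. g (snd z))"
proof (rule gclass_approx)
  show "matrix_seq (\<lambda>n. toeplitz n g)" by (simp add: matrix_seq_def)
  fix \<epsilon> :: real assume "0 < \<epsilon>"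
  \<comment> \<open>This accuracy is what the matrix estimate requires; the symbol estimate asks
    only for \<epsilon>^2.\<close>
  then have "0 < (\<epsilon> / 4)\<^sup>2" by simp
  from trig_poly_dense[OF g this]
  obtain p where p: "trig_poly p" "(\<integral>\<theta>. cmod (g \<theta> - p \<theta>) \<partial>lebpi) < (\<epsilon> / 4)\<^sup>2" by blast
  note pi = trig_poly_integrable[OF p(1)]
  have r: "integrable lebpi (\<lambda>\<theta>. g \<theta> - p \<theta>)" using g pi by auto
  have "toeplitz n (\<lambda>\<theta>. g \<theta> - p \<theta>) = toeplitz n g - toeplitz n p" for n
  proof -
    have "toeplitz n g = toeplitz n (\<lambda>\<theta>. (g \<theta> - p \<theta>) + p \<theta>)" by simp
    also have "\<dots> = toeplitz n (\<lambda>\<theta>. g \<theta> - p \<theta>) + toeplitz n p" by (rule toeplitz_add[OF r pi])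
    finally have *: "toeplitz n g = toeplitz n (\<lambda>\<theta>. g \<theta> - p \<theta>) + toeplitz n p" .
    show ?thesis unfolding * by (intro eq_matI) (auto simp: toeplitz_def)
  qed
  moreover have "mat_split n \<epsilon> \<epsilon> (toeplitz n (\<lambda>\<theta>. g \<theta> - p \<theta>))" for n
    by (rule mat_split_small_toeplitz[OF r less_imp_le[OF p(2)] \<open>0 < \<epsilon>\<close>])
  moreover have "symbol_split \<epsilon> \<epsilon> (\<lambda>z. g (snd z) - p (snd z))"
  proof (rule symbol_split_small_integral[OF r _ \<open>0 < \<epsilon>\<close>])
    have "(\<epsilon> / 4)\<^sup>2 \<le> \<epsilon>\<^sup>2" using \<open>0 < \<epsilon>\<close> by (intro power_mono) auto
    then show "(\<integral>\<theta>. cmod (g \<theta> - p \<theta>) \<partial>lebpi) < \<epsilon>\<^sup>2" using p(2) by linarith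
  qed
  ultimately have "pair_split \<epsilon> \<epsilon> (\<lambda>n. toeplitz n g - toeplitz n p) (\<lambda>z. g (snd z) - p (snd z))"
    by (simp add: pair_split_def)
  then show "\<exists>B \<xi>. gclass B \<xi> \<and> pair_split \<epsilon> \<epsilon> (\<lambda>n. toeplitz n g - B n) (\<lambda>z. g (snd z) - \<xi> z)"
    using gclass_basic_sum[OF basic_sum_toeplitz[OF p(1)]] by blast
qed

section \<open>GLT sequences and functional calculus\<close>

lemma DT_sum_carrier [simp]: "DT_sum K a g n \<in> carrier_mat n n"
  by (simp add: DT_sum_def)

lemma dim_DT_sum [simp]: "dim_row (DT_sum K a g n) = n" "dim_col (DT_sum K a g n) = n"
  by (simp_all add: DT_sum_def)

lemma DT_sum_Suc:
  "DT_sum (Suc K) a g n = DT_sum K a g n + diag_sampling n (a (Suc K)) * toeplitz n (g (Suc K))"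
proof -
  define P where "P = diag_sampling n (a (Suc K)) * toeplitz n (g (Suc K))"
  have P: "P \<in> carrier_mat n n"
    unfolding P_def by (rule mult_carrier_mat[OF diag_sampling_carrier toeplitz_carrier])
  have "DT_sum (Suc K) a g n = DT_sum K a g n + P"
    by (rule eq_matI) (use P in \<open>auto simp: DT_sum_def simp flip: P_def\<close>)
  then show ?thesis by (simp add: P_def)
qed

lemma add_minus_cancel_mat:
  fixes X R N :: "complex mat"
  assumes "X \<in> carrier_mat n m" "R \<in> carrier_mat n m" "N \<in> carrier_mat n m"
  shows "X + R + N - X = R + N"
  using assms by (intro eq_matI) auto

lemma eq_add_of_minus_eq_mat:
  fixes A X R N :: "complex mat"
  assumes "A - X = R + N" "A \<in> carrier_mat n m" "X \<in> carrier_mat n m" "R \<in> carrier_mat n m" "N \<in> carrier_mat n m"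
  shows "A = X + R + N"
proof (rule eq_matI)
  fix i j assume ij: "i < dim_row (X + R + N)" "j < dim_col (X + R + N)"
  have "(A - X) $$ (i, j) = (R + N) $$ (i, j)" using assms(1) by simp
  then show "A $$ (i, j) = (X + R + N) $$ (i, j)" using ij assms(2-5) by (simp add: algebra_simps)
qed (use assms in auto)

lemma DT_sum_cong:
  assumes "\<And>i. i \<in> {1..K} \<Longrightarrow> a i = a' i" "\<And>i. i \<in> {1..K} \<Longrightarrow> g i = g' i"
  shows "DT_sum K a g = DT_sum K a' g'"
  unfolding DT_sum_def using assms by (intro ext cong_mat refl) (auto intro!: sum.cong)

lemma gclass_DT_sum:
  assumes "\<And>i. i \<in> {1..K} \<Longrightarrow> continuous_ae_01 (a i) \<and> integrable lebpi (g i)"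
  shows "gclass (DT_sum K a g) (\<lambda>z. \<Sum>i = 1..K. a i (fst z) * g i (snd z))"
  using assms
proof (induction K)
  case 0
  have "DT_sum 0 a g = (\<lambda>n. 0\<^sub>m n n)" by (intro ext eq_matI) (auto simp: DT_sum_def)
  then show ?case using gclass_zero by simp
next
  case (Suc K)
  have "gclass (\<lambda>n. diag_sampling n (a (Suc K)) * toeplitz n (g (Suc K))) (\<lambda>z. a (Suc K) (fst z) * g (Suc K) (snd z))"
    using Suc.prems by (intro gclass_mult gclass_diag_sampling gclass_toeplitz) auto
  moreover have "gclass (DT_sum K a g) (\<lambda>z. \<Sum>i = 1..K. a i (fst z) * g i (snd z))"
    using Suc by auto
  ultimately have "gclass (\<lambda>n. DT_sum (Suc K) a g n) (\<lambda>z. (\<Sum>i = 1..K. a i (fst z) * g i (snd z)) + a (Suc K) (fst z) * g (Suc K) (snd z))"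
    unfolding DT_sum_Suc by (intro gclass_add)
  then show ?case by simp
qed

text \<open>Translation into the shape demanded by \<open>glt\<close>: each generation step appends
  one term, and overwriting the families at index Suc K leaves the first K terms unchanged.\<close>

lemma basic_sum_DT_sum:
  assumes "basic_sum S s"
  shows "\<exists>K a k. (\<forall>i. continuous_on {0..1} (a i)) \<and> S = DT_sum K a (\<lambda>i. trig (k i)) \<and>
    s = (\<lambda>z. \<Sum>i = 1..K. a i (fst z) * trig (k i) (snd z))"
  using assms
proof (induction rule: basic_sum.induct)
  case basic_sum_zero
  have "DT_sum 0 (\<lambda>_ _. 0) (\<lambda>i. trig 1) = (\<lambda>n. 0\<^sub>m n n)" by (intro ext eq_matI) (auto simp: DT_sum_def)
  then show ?case by (intro exI[of _ 0] exI[of _ "\<lambda>_ _. 0"] exI[of _ "\<lambda>_. 1"]) auto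
next
  case (basic_sum_step S s a k)
  then obtain K b l where IH: "\<And>i. continuous_on {0..1} (b i)" "S = DT_sum K b (\<lambda>i. trig (l i))"
    "s = (\<lambda>z. \<Sum>i = 1..K. b i (fst z) * trig (l i) (snd z))" by auto
  define b' where "b' = b(Suc K := a)"
  define l' where "l' = l(Suc K := k)"
  have old: "DT_sum K b' (\<lambda>i. trig (l' i)) = DT_sum K b (\<lambda>i. trig (l i))"
    by (rule DT_sum_cong) (auto simp: b'_def l'_def)
  have "(\<lambda>n. S n + basic_seq a k n) = DT_sum (Suc K) b' (\<lambda>i. trig (l' i))"
    by (rule ext) (simp add: DT_sum_Suc old IH(2), simp add: b'_def l'_def basic_seq_def)
  moreover have "(\<lambda>z. s z + a (fst z) * trig k (snd z)) = (\<lambda>z. \<Sum>i = 1..Suc K. b' i (fst z) * trig (l' i) (snd z))"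
    by (auto simp: IH(3) b'_def l'_def intro!: ext sum.cong)
  moreover have "continuous_on {0..1} (b' i)" for i using IH(1) basic_sum_step(2) by (simp add: b'_def)
  ultimately show ?case by (intro exI[of _ "Suc K"] exI[of _ b'] exI[of _ l']) auto
qed

lemma basic_sum_continuous:
  assumes "basic_sum S s"
  shows "continuous_on ({0..1} \<times> {-pi..pi}) s"
  using assms
proof (induction rule: basic_sum.induct)
  case (basic_sum_step S s a k)
  have "continuous_on ({0..1} \<times> {-pi..pi}) (\<lambda>z. a (fst z))"
    by (rule continuous_on_compose2[OF basic_sum_step(2) continuous_on_fst[OF continuous_on_id]]) auto
  moreover have "continuous_on ({0..1} \<times> {-pi..pi}) (\<lambda>z. trig k (snd z))"
    by (rule continuous_on_compose2[OF continuous_on_trig[of UNIV] continuous_on_snd[OF continuous_on_id]]) auto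
  ultimately show ?case using basic_sum_step(3) by (intro continuous_intros) auto
qed simp

lemma domain_sets: "{0..1::real} \<times> {-pi..pi} \<in> sets lebesgue"
  by (intro lmeasurable_compact[THEN fmeasurableD] compact_Times) auto

text \<open>A single \<open>m\<close> with \<open>c m\<close>, the norm bound and the exceptional
  measure all below \<epsilon> suffices: the sum with that index belongs to the class, and the class
  is closed.\<close>

lemma glt_imp_gclass:
  assumes "A \<sim>\<^sub>G\<^sub>L\<^sub>T \<kappa>"
  shows "gclass A \<kappa>"
proof (rule gclass_approx)
  obtain K a g where A: "matrix_seq A"
    and ag: "\<And>m i. i \<in> {1..K m} \<Longrightarrow> continuous_ae_01 (a m i) \<and> integrable lebpi (g m i)"
    and tim: "tendsto_in_measure glt_measure (\<lambda>m (x, \<theta>). \<Sum>i = 1..K m. a m i x * g m i \<theta>) \<kappa>"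
    and acs: "acs (\<lambda>m. DT_sum (K m) (a m) (g m)) A"
    using assms unfolding glt_def by blast
  show "matrix_seq A" by fact
  obtain n0 c w where c: "c \<longlonglongrightarrow> 0" and w: "w \<longlonglongrightarrow> 0"
    and dec: "\<And>m n. n0 m \<le> n \<Longrightarrow> \<exists>R\<in>carrier_mat n n. \<exists>N\<in>carrier_mat n n.
       A n = DT_sum (K m) (a m) (g m) n + R + N \<and> real (vec_space.rank n R) \<le> c m * real n \<and> spectral_norm N \<le> w m"
    using acs unfolding acs_def by blast
  fix \<epsilon> :: real assume "0 < \<epsilon>"
  let ?\<phi> = "\<lambda>m z. \<Sum>i = 1..K m. a m i (fst z) * g m i (snd z)"
  let ?E = "\<lambda>m. {z \<in> space glt_measure. cmod (?\<phi> m z - \<kappa> z) > \<epsilon>}"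
  have tim': "tendsto_in_measure glt_measure ?\<phi> \<kappa>" using tim by (simp add: case_prod_unfold)
  have meas: "?\<phi> m \<in> borel_measurable glt_measure" "\<kappa> \<in> borel_measurable glt_measure" for m
    using tim' unfolding tendsto_in_measure_def by blast+
  have lim: "(\<lambda>m. emeasure glt_measure (?E m)) \<longlonglongrightarrow> 0"
    using tim' \<open>0 < \<epsilon>\<close> unfolding tendsto_in_measure_def by blast
  have "eventually (\<lambda>m. c m < \<epsilon> \<and> w m < \<epsilon> \<and> emeasure glt_measure (?E m) < ennreal \<epsilon>) sequentially"
    using \<open>0 < \<epsilon>\<close> by (intro eventually_conj order_tendstoD(2)[OF c] order_tendstoD(2)[OF w] order_tendstoD(2)[OF lim])
      (simp_all)
  then obtain m where m: "c m < \<epsilon>" "w m < \<epsilon>" "emeasure glt_measure (?E m) < ennreal \<epsilon>"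
    using eventually_happens'[OF sequentially_bot] by blast
  let ?B = "DT_sum (K m) (a m) (g m)"
  have "mat_split n \<epsilon> \<epsilon> (A n - ?B n)" if n: "n0 m \<le> n" for n
  proof -
    obtain R N where RN: "R \<in> carrier_mat n n" "N \<in> carrier_mat n n" "A n = ?B n + R + N"
      "real (vec_space.rank n R) \<le> c m * real n" "spectral_norm N \<le> w m" using dec[OF n] by blast
    have "lowrank n (\<epsilon> * real n) R"
      by (rule lowrank_mono[OF lowrank_rank[OF RN(1)]])
        (rule order_trans[OF RN(4)], use m(1) in \<open>auto intro: mult_right_mono\<close>)
    moreover have "op_bound n \<epsilon> N"
      by (rule op_bound_mono[OF op_bound_spectral_norm[OF RN(2)]]) (use RN(5) m(2) in linarith)
    moreover have "A n - ?B n = R + N"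
      unfolding RN(3) by (rule add_minus_cancel_mat[OF DT_sum_carrier RN(1,2)])
    ultimately show ?thesis by (rule mat_splitI)
  qed
  then have "eventually (\<lambda>n. mat_split n \<epsilon> \<epsilon> (A n - ?B n)) sequentially"
    unfolding eventually_sequentially by blast
  moreover have "symbol_split \<epsilon> \<epsilon> (\<lambda>z. \<kappa> z - ?\<phi> m z)"
    unfolding symbol_split_def
  proof (intro conjI bexI[of _ "?E m"])
    have "(\<lambda>z. cmod (?\<phi> m z - \<kappa> z)) \<in> borel_measurable glt_measure"
      by (rule measurable_compose[OF borel_measurable_diff[OF meas] borel_measurable_norm])
    then have "?E m \<in> sets glt_measure" by (rule borel_measurable_less[OF borel_measurable_const])
    then show E: "?E m \<in> sets lebesgue" using domain_sets by (auto simp: sets_restrict_space_iff)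
    have "?E m \<subseteq> {0..1} \<times> {-pi..pi}" by (auto simp: space_restrict_space)
    then have "emeasure glt_measure (?E m) = emeasure lebesgue (?E m)"
      using domain_sets by (intro emeasure_restrict_space) auto
    then show "emeasure lebesgue (?E m) \<le> ennreal \<epsilon>" using m(3) by simp
    show "\<forall>z\<in>{0..1} \<times> {-pi..pi} - ?E m. cmod (\<kappa> z - ?\<phi> m z) \<le> \<epsilon>"
      by (auto simp: space_restrict_space norm_minus_commute)
  qed (use \<open>0 < \<epsilon>\<close> in auto)
  ultimately show "\<exists>B \<xi>. gclass B \<xi> \<and> pair_split \<epsilon> \<epsilon> (\<lambda>n. A n - B n) (\<lambda>z. \<kappa> z - \<xi> z)"
    using gclass_DT_sum[of "K m" "a m" "g m"] ag unfolding pair_split_def by blast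
qed

text \<open>Choosing \<epsilon> = 1/(m + 1) yields the sequence of approximations, with the same
  null sequence as rank fraction and norm bound. Measurability of \<kappa> is assumed because
  \<open>gclass\<close> does not record it.\<close>

lemma gclass_imp_glt:
  assumes A: "gclass A \<kappa>" and \<kappa>: "\<kappa> \<in> borel_measurable glt_measure"
  shows "A \<sim>\<^sub>G\<^sub>L\<^sub>T \<kappa>"
proof -
  define e where "e m = inverse (real (Suc m))" for m
  have e0: "0 < e m" for m by (simp add: e_def)
  have elim: "e \<longlonglongrightarrow> 0" unfolding e_def[abs_def] by (rule LIMSEQ_inverse_real_of_nat)
  have "\<forall>m. \<exists>S s. basic_sum S s \<and> pair_split (e m) (e m) (\<lambda>n. A n - S n) (\<lambda>z. \<kappa> z - s z)"
    using A e0 unfolding gclass_def by blast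
  from choice[OF this] obtain S where
    "\<forall>m. \<exists>s. basic_sum (S m) s \<and> pair_split (e m) (e m) (\<lambda>n. A n - S m n) (\<lambda>z. \<kappa> z - s z)" ..
  from choice[OF this] obtain s where
    "\<forall>m. basic_sum (S m) (s m) \<and> pair_split (e m) (e m) (\<lambda>n. A n - S m n) (\<lambda>z. \<kappa> z - s m z)" ..
  then have S: "\<And>m. basic_sum (S m) (s m)" "\<And>m. pair_split (e m) (e m) (\<lambda>n. A n - S m n) (\<lambda>z. \<kappa> z - s m z)"
    by simp_all
  have "\<forall>m. \<exists>K a k. (\<forall>i. continuous_on {0..1} (a i)) \<and> S m = DT_sum K a (\<lambda>i. trig (k i)) \<and>
    s m = (\<lambda>z. \<Sum>i = 1..K. a i (fst z) * trig (k i) (snd z))"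
    using basic_sum_DT_sum[OF S(1)] by blast
  from choice[OF this] obtain K where "\<forall>m. \<exists>a k. (\<forall>i. continuous_on {0..1} (a i)) \<and>
    S m = DT_sum (K m) a (\<lambda>i. trig (k i)) \<and> s m = (\<lambda>z. \<Sum>i = 1..K m. a i (fst z) * trig (k i) (snd z))" ..
  from choice[OF this] obtain a where "\<forall>m. \<exists>k. (\<forall>i. continuous_on {0..1} (a m i)) \<and>
    S m = DT_sum (K m) (a m) (\<lambda>i. trig (k i)) \<and> s m = (\<lambda>z. \<Sum>i = 1..K m. a m i (fst z) * trig (k i) (snd z))" ..
  from choice[OF this] obtain k where "\<forall>m. (\<forall>i. continuous_on {0..1} (a m i)) \<and>
    S m = DT_sum (K m) (a m) (\<lambda>i. trig (k m i)) \<and> s m = (\<lambda>z. \<Sum>i = 1..K m. a m i (fst z) * trig (k m i) (snd z))" ..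
  then have a: "\<And>m i. continuous_on {0..1} (a m i)" and SK: "\<And>m. S m = DT_sum (K m) (a m) (\<lambda>i. trig (k m i))"
    and sK: "\<And>m. s m = (\<lambda>z. \<Sum>i = 1..K m. a m i (fst z) * trig (k m i) (snd z))" by blast+
  have sK': "(\<lambda>m (x, \<theta>). \<Sum>i = 1..K m. a m i x * trig (k m i) \<theta>) = s"
    by (intro ext) (auto simp: sK)
  have "\<forall>m. \<exists>n0. \<forall>n\<ge>n0. mat_split n (e m) (e m) (A n - S m n)"
    using S(2) by (simp add: pair_split_def eventually_sequentially)
  from choice[OF this] obtain n0 where n0: "\<forall>m. \<forall>n\<ge>n0 m. mat_split n (e m) (e m) (A n - S m n)" ..
  have acs: "acs S A"
    unfolding acs_def
  proof (intro conjI allI exI[of _ n0] exI[of _ e] impI)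
    show "matrix_seq A" by (rule gclass_matrix_seq[OF A])
    show "matrix_seq (S m)" for m by (rule basic_sum_matrix_seq[OF S(1)])
    fix m n assume "n0 m \<le> n"
    then have "mat_split n (e m) (e m) (A n - S m n)" using n0 by simp
    then obtain R N where RN: "lowrank n (e m * real n) R" "op_bound n (e m) N" "A n - S m n = R + N"
      unfolding mat_split_def by blast
    have c: "R \<in> carrier_mat n n" "N \<in> carrier_mat n n" "A n \<in> carrier_mat n n" "S m n \<in> carrier_mat n n"
      by (rule lowrank_carrier[OF RN(1)] op_boundD(1)[OF RN(2)] gclass_carrier[OF A] basic_sum_carrier[OF S(1)])+
    have "A n = S m n + R + N" by (rule eq_add_of_minus_eq_mat[OF RN(3) c(3,4,1,2)])
    then show "\<exists>R\<in>carrier_mat n n. \<exists>N\<in>carrier_mat n n. A n = S m n + R + N \<and>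
      real (vec_space.rank n R) \<le> e m * real n \<and> spectral_norm N \<le> e m"
      using c rank_le_lowrank[OF RN(1)] spectral_norm_le[OF RN(2)] by blast
  qed (rule elim)+
  have tim: "tendsto_in_measure glt_measure s \<kappa>"
    unfolding tendsto_in_measure_def
  proof (intro conjI allI impI \<kappa>)
    show sm: "s m \<in> borel_measurable glt_measure" for m
      by (rule continuous_imp_measurable_on_sets_lebesgue[OF basic_sum_continuous[OF S(1)] domain_sets])
    fix \<epsilon> :: real assume "0 < \<epsilon>"
    let ?E = "\<lambda>m. {z \<in> space glt_measure. cmod (s m z - \<kappa> z) > \<epsilon>}"
    \<comment> \<open>Once \<open>e m\<close> is below the given \<epsilon>, a point with error
      above \<epsilon> has error above \<open>e m\<close> and thus lies in the exceptional set, of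
      measure at most \<open>e m\<close>.\<close>
    have ev: "eventually (\<lambda>m. emeasure glt_measure (?E m) \<le> ennreal (e m)) sequentially"
      using order_tendstoD(2)[OF elim \<open>0 < \<epsilon>\<close>]
    proof (rule eventually_mono)
      fix m assume m: "e m < \<epsilon>"
      obtain F where F: "F \<in> sets lebesgue" "emeasure lebesgue F \<le> ennreal (e m)"
        "\<And>z. z \<in> {0..1} \<times> {-pi..pi} - F \<Longrightarrow> cmod (\<kappa> z - s m z) \<le> e m"
        using S(2)[of m] unfolding pair_split_def symbol_split_def by (elim conjE bexE) blast
      have sub: "?E m \<subseteq> F"
      proof
        fix z assume z: "z \<in> ?E m"
        then have "z \<in> {0..1} \<times> {-pi..pi}" by (auto simp: space_restrict_space)
        then show "z \<in> F" using F(3)[of z] z m by (auto simp: norm_minus_commute)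
      qed
      have "?E m \<subseteq> {0..1} \<times> {-pi..pi}" by (auto simp: space_restrict_space)
      then have "emeasure glt_measure (?E m) = emeasure lebesgue (?E m)"
        using domain_sets by (intro emeasure_restrict_space) auto
      also have "\<dots> \<le> emeasure lebesgue F" by (rule emeasure_mono[OF sub F(1)])
      also note F(2)
      finally show "emeasure glt_measure (?E m) \<le> ennreal (e m)" .
    qed
    have nonneg: "eventually (\<lambda>m. 0 \<le> emeasure glt_measure (?E m)) sequentially" by simp
    have "(\<lambda>m. ennreal (e m)) \<longlonglongrightarrow> 0" using tendsto_ennrealI[OF elim] by simp
    then show "(\<lambda>m. emeasure glt_measure (?E m)) \<longlonglongrightarrow> 0"
      by (rule tendsto_sandwich[OF nonneg ev tendsto_const])
  qed
  have "continuous_ae_01 (a m i)" for m i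
    using a[of m i] unfolding continuous_ae_01_def continuous_on_eq_continuous_within by (intro AE_I2) simp
  then have "\<forall>m. \<forall>i\<in>{1..K m}. continuous_ae_01 (a m i) \<and> integrable lebpi (trig (k m i))"
    using integrable_trig by blast
  moreover have "tendsto_in_measure glt_measure (\<lambda>m (x, \<theta>). \<Sum>i = 1..K m. a m i x * trig (k m i) \<theta>) \<kappa>"
    unfolding sK' by (rule tim)
  moreover have "acs (\<lambda>m. DT_sum (K m) (a m) (\<lambda>i. trig (k m i))) A"
    unfolding SK[symmetric] by (rule acs)
  ultimately show ?thesis
    unfolding glt_def
    by (intro conjI exI[of _ K] exI[of _ a] exI[of _ "\<lambda>m i. trig (k m i)"] gclass_matrix_seq[OF A] \<kappa>)
qed

section \<open>Functional calculus of one unitarily diagonalized sequence\<close>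

context
  fixes A :: "nat \<Rightarrow> complex mat" and \<kappa> :: "real \<times> real \<Rightarrow> complex"
    and U :: "nat \<Rightarrow> complex mat" and d :: "nat \<Rightarrow> nat \<Rightarrow> complex"
  assumes A: "gclass A \<kappa>" and U: "\<And>n. unitary_mat n (U n)" and diag: "\<And>n. A n = udiag n (U n) (d n)"
begin

text \<open>This is \<open>h\<close> of A_n written in one fixed eigenbasis, where the calculus
  visibly respects sums and products; the link with \<open>mat_fun\<close> is
  \<open>mat_fun_udiag\<close>.\<close>

abbreviation funcalc :: "(complex \<Rightarrow> complex) \<Rightarrow> nat \<Rightarrow> complex mat" where
  "funcalc h n \<equiv> udiag n (U n) (\<lambda>i. h (d n i))"

lemma gclass_funcalc_const: "gclass (funcalc (\<lambda>_. c)) (\<lambda>_. c)"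
proof -
  have "funcalc (\<lambda>_. c) = basic_seq (\<lambda>_. c) 0"
    using U by (intro ext) (simp add: udiag_const basic_seq_0_eq diag_sampling_def)
  then show ?thesis using gclass_basic_sum[OF basic_sum_basic_seq[of "\<lambda>_. c" 0]] by simp
qed

lemma gclass_funcalc_add:
  assumes "gclass (funcalc h) (\<lambda>z. h (\<kappa> z))" "gclass (funcalc k) (\<lambda>z. k (\<kappa> z))"
  shows "gclass (funcalc (\<lambda>w. h w + k w)) (\<lambda>z. h (\<kappa> z) + k (\<kappa> z))"
  using gclass_add[OF assms] unitary_matD(1)[OF U] by (simp add: udiag_add)

lemma gclass_funcalc_mult:
  assumes "gclass (funcalc h) (\<lambda>z. h (\<kappa> z))" "gclass (funcalc k) (\<lambda>z. k (\<kappa> z))"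
  shows "gclass (funcalc (\<lambda>w. h w * k w)) (\<lambda>z. h (\<kappa> z) * k (\<kappa> z))"
  using gclass_mult[OF assms] U by (simp add: udiag_mult)

lemma gclass_funcalc_cmult:
  assumes "gclass (funcalc h) (\<lambda>z. h (\<kappa> z))"
  shows "gclass (funcalc (\<lambda>w. c * h w)) (\<lambda>z. c * h (\<kappa> z))"
  by (rule gclass_funcalc_mult[OF gclass_funcalc_const assms])

lemma gclass_funcalc_id: "gclass (funcalc (\<lambda>w. w)) (\<lambda>z. \<kappa> z)"
  using A by (simp flip: diag)

text \<open>Here normality does its work: in a unitary eigenbasis the adjoint is diagonal too, with
  the conjugate eigenvalues, so conjugation is realized by an operation of the class.\<close>

lemma gclass_funcalc_cnj: "gclass (funcalc cnj) (\<lambda>z. cnj (\<kappa> z))"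
  using gclass_adjoint[OF gclass_funcalc_id] unitary_matD(1)[OF U] by (simp add: udiag_adjoint)

lemma gclass_funcalc_polynomial:
  assumes "real_polynomial_function q"
  shows "gclass (funcalc (\<lambda>w. complex_of_real (q w))) (\<lambda>z. complex_of_real (q (\<kappa> z)))"
  using assms
proof (induction rule: real_polynomial_function.induct)
  case (linear f)
  then interpret bounded_linear f .
  \<comment> \<open>A real-linear functional on the plane is a complex combination of
    \<open>w\<close> and its conjugate; inserting 1 and \<i> determines the coefficients.\<close>
  have eq: "complex_of_real (f w) = ((f 1 - \<i> * f \<i>) / 2) * w + ((f 1 + \<i> * f \<i>) / 2) * cnj w" for w
  proof -
    have "f w = f (Re w *\<^sub>R 1 + Im w *\<^sub>R \<i>)"
      by (rule arg_cong[of _ _ f]) (simp add: complex_eq_iff)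
    also have "\<dots> = Re w * f 1 + Im w * f \<i>" by (simp add: add scale)
    finally show ?thesis by (simp add: complex_eq_iff field_simps)
  qed
  show ?case
    using gclass_funcalc_add[OF gclass_funcalc_cmult[OF gclass_funcalc_id, of "(f 1 - \<i> * f \<i>) / 2"]
      gclass_funcalc_cmult[OF gclass_funcalc_cnj, of "(f 1 + \<i> * f \<i>) / 2"]]
    unfolding eq[symmetric] .
next
  case (const c)
  then show ?case by (rule gclass_funcalc_const)
next
  case (add f g)
  show ?case
    using gclass_funcalc_add[where h = "\<lambda>w. complex_of_real (f w)" and k = "\<lambda>w. complex_of_real (g w)", OF add.IH]
    by simp
next
  case (mult f g)
  show ?case
    using gclass_funcalc_mult[where h = "\<lambda>w. complex_of_real (f w)" and k = "\<lambda>w. complex_of_real (g w)", OF mult.IH]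
    by simp
qed

text \<open>\<open>M\<close> is fixed by \<epsilon> before the polynomial \<open>p\<close> is
  chosen. Outside the ball f - p is uncontrolled, but this concerns at most \<epsilon> n eigenvalues
  and a set of measure at most \<epsilon>, whatever the size of f - p there.\<close>

lemma gclass_funcalc_continuous:
  assumes f: "continuous_on UNIV f"
  shows "gclass (funcalc f) (\<lambda>z. f (\<kappa> z))"
proof (rule gclass_approx)
  show "matrix_seq (funcalc f)" using unitary_matD(1)[OF U] by (simp add: matrix_seq_def)
  fix \<epsilon> :: real assume "0 < \<epsilon>"
  obtain M where M: "0 < M" "pair_split \<epsilon> M A \<kappa>" using gclass_pair_split[OF A \<open>0 < \<epsilon>\<close>] by blast
  have e: "0 < \<epsilon> / 2" using \<open>0 < \<epsilon>\<close> by simp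
  have fM: "continuous_on (cball 0 M) f" by (rule continuous_on_subset[OF f]) simp
  \<comment> \<open>The real and the imaginary part of \<open>f\<close> are approximated separately,
    each within half of \<epsilon>.\<close>
  obtain q1 where q1: "real_polynomial_function q1" "\<And>w. w \<in> cball 0 M \<Longrightarrow> \<bar>Re (f w) - q1 w\<bar> < \<epsilon> / 2"
    using Stone_Weierstrass_real_polynomial_function[OF compact_cball continuous_on_Re[OF fM] e] by blast
  obtain q2 where q2: "real_polynomial_function q2" "\<And>w. w \<in> cball 0 M \<Longrightarrow> \<bar>Im (f w) - q2 w\<bar> < \<epsilon> / 2"
    using Stone_Weierstrass_real_polynomial_function[OF compact_cball continuous_on_Im[OF fM] e] by blast
  define p where "p w = complex_of_real (q1 w) + \<i> * complex_of_real (q2 w)" for w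
  have p: "gclass (funcalc p) (\<lambda>z. p (\<kappa> z))"
    unfolding p_def by (intro gclass_funcalc_add gclass_funcalc_cmult gclass_funcalc_polynomial q1 q2)
  have fp: "cmod (f w - p w) \<le> \<epsilon>" if "cmod w \<le> M" for w
    using cmod_le[of "f w - p w"] q1(2)[of w] q2(2)[of w] that by (simp add: p_def)
  have "eventually (\<lambda>n. mat_split n \<epsilon> \<epsilon> (funcalc f n - funcalc p n)) sequentially"
  proof (rule eventually_mono)
    show "eventually (\<lambda>n. mat_split n \<epsilon> M (A n)) sequentially" using M(2) by (simp add: pair_split_def)
    fix n assume n: "mat_split n \<epsilon> M (A n)"
    have "card {i. i < n \<and> cmod (f (d n i) - p (d n i)) > \<epsilon>} \<le> card {i. i < n \<and> cmod (d n i) > M}"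
    proof (rule card_mono)
      show "{i. i < n \<and> cmod (f (d n i) - p (d n i)) > \<epsilon>} \<subseteq> {i. i < n \<and> cmod (d n i) > M}"
        using fp not_le by blast
    qed simp
    also have "real \<dots> \<le> \<epsilon> * real n"
      by (rule mat_split_udiag_card[OF U]) (use n diag in simp)
    finally show "mat_split n \<epsilon> \<epsilon> (funcalc f n - funcalc p n)"
      unfolding udiag_minus[OF unitary_matD(1)[OF U]] using \<open>0 < \<epsilon>\<close> by (intro mat_split_udiag U) auto
  qed
  moreover have "symbol_split \<epsilon> \<epsilon> (\<lambda>z. f (\<kappa> z) - p (\<kappa> z))"
  proof -
    have "symbol_split \<epsilon> M \<kappa>" using M(2) by (simp add: pair_split_def)
    then obtain E where "E \<in> sets lebesgue" "emeasure lebesgue E \<le> ennreal \<epsilon>"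
      "\<forall>z\<in>{0..1} \<times> {-pi..pi} - E. cmod (\<kappa> z) \<le> M" unfolding symbol_split_def by blast
    then show ?thesis unfolding symbol_split_def using fp \<open>0 < \<epsilon>\<close> by (intro conjI bexI[of _ E]) auto
  qed
  ultimately show "\<exists>B \<xi>. gclass B \<xi> \<and> pair_split \<epsilon> \<epsilon> (\<lambda>n. funcalc f n - B n) (\<lambda>z. f (\<kappa> z) - \<xi> z)"
    using p unfolding pair_split_def by blast
qed

end

theorem theorem3p4:
  fixes \<kappa> :: "real \<times> real \<Rightarrow> complex"
    and A :: "nat \<Rightarrow> complex mat"
    and f :: "complex \<Rightarrow> complex"
  assumes "\<kappa> \<in> borel_measurable (lebesgue_on ({0..1} \<times> {-pi..pi}))"
    and "matrix_seq A"
    and "A \<sim>\<^sub>G\<^sub>L\<^sub>T \<kappa>"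
    and "\<And>n. normal_mat (A n)"
    and "continuous_on UNIV f"
  shows "(\<lambda>n. mat_fun f (A n)) \<sim>\<^sub>G\<^sub>L\<^sub>T (f \<circ> \<kappa>)"
proof (rule gclass_imp_glt)
  have "\<exists>U d. unitary_mat n U \<and> A n = udiag n U d" for n
    by (rule normal_unitary_diagonalization) (use assms(2,4) in \<open>auto simp: matrix_seq_def normal_mat_def\<close>)
  then obtain U d where Ud: "\<And>n. unitary_mat n (U n)" "\<And>n. A n = udiag n (U n) (d n)" by metis
  \<comment> \<open>Evaluating \<open>mat_fun\<close> in the eigenbasis chosen for each
    \<open>n\<close> reduces the claim to the calculus above.\<close>
  have "(\<lambda>n. mat_fun f (A n)) = (\<lambda>n. udiag n (U n) (\<lambda>i. f (d n i)))"
    using Ud by (simp add: mat_fun_udiag)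
  then show "gclass (\<lambda>n. mat_fun f (A n)) (f \<circ> \<kappa>)"
    using gclass_funcalc_continuous[OF glt_imp_gclass[OF assms(3)] Ud assms(5)] by (simp add: comp_def)
  show "f \<circ> \<kappa> \<in> borel_measurable (lebesgue_on ({0..1} \<times> {-pi..pi}))"
    by (rule measurable_comp[OF assms(1)]) (rule borel_measurable_continuous_onI[OF assms(5)])
qed

end
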